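(* Let $K\subset\mathbb{R}^2$ be a convex body with support function $\phi$, and suppose that there exist $z_0\in\mathscr{D}(K)$ and linearly independent directions $\nu_1,\nu_2\in\mathbb{S}^1$ such that: (i) $z_0$ belongs to the interior of the convex cone generated by $\nu_1$ and $\nu_2$; (ii) $L_K(\nu_1)\cap L_K(\nu_2)=\{P\}$ with $P\in\partial K$, where $L_K(\nu_i)=\{x\in\mathbb{R}^2: x\cdot\nu_i=\phi(\nu_i)\}$, $i=1,2$, is the supporting line of $K$ in direction $\nu_i$. Then, for every $M\in(0,1)$ for which the lamella $L_M^{z_0}$ is a minimizer of $$\min\{P^\phi_{\mathbb{T}^2}(E): E\subseteq\mathbb{T}^2,\ |E|=M\},$$ this problem has infinitely many minimizers, pairwise distinct up to translations and Lebesgue-negligible sets.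
   Context: $\mathbb{T}^2=\mathbb{R}^2/\mathbb{Z}^2$ is the flat torus and $|\cdot|$ denotes Lebesgue measure of sets. A convex body is a compact convex subset of $\mathbb{R}^2$ containing the origin in its interior. Its support function is $\phi(y)=\sup\{x\cdot y: x\in K\}$. For a set of finite perimeter $E\subset\mathbb{T}^2$, with reduced boundary $\partial^*E$ and measure-theoretic outer unit normal $\nu_E$, the anisotropic perimeter is $P^\phi_{\mathbb{T}^2}(E)=\int_{\partial^*E}\phi(\nu_E)\,d\mathcal{H}^1$. The minimization is over measurable sets of finite perimeter. Lattice width: $w(K)=\min_{z\in\mathbb{Z}^2\setminus\{0\}}\big(\phi(z)+\phi(-z)\big)$, and $\mathscr{D}(K)=\{z\in\mathbb{Z}^2\setminus\{0\}: \phi(z)+\phi(-z)=w(K)\}$ (its elements automatically have coprime coordinates). Lamella: for $z\in\mathbb{Z}^2\setminus\{0\}$ with coprime coordinates and $M\in(0,1)$, $L_M^z\subset\mathbb{T}^2$ is the projection to $\mathbb{T}^2$ of $\{tz^\perp+sz: t\in\mathbb{R},\ 0\le s\le M/|z|^2\}$, where $z^\perp$ is $z$ rotated by $90$ degrees; it has area $M$. *)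

theory Defs
  imports "HOL-Analysis.Analysis"
begin

definition lattice :: "(real^2) set" where
  "lattice = {z. \<forall>i. z $ i \<in> \<int>}"

quotient_type torus = "real^2" / "\<lambda>x y. x - y \<in> lattice"
  morphisms rep_torus proj
proof (rule equivpI)
  show "reflp (\<lambda>x y. x - y \<in> lattice)"
    by (auto simp: reflp_def lattice_def)
  show "symp (\<lambda>x y. x - y \<in> lattice)"
  proof (rule sympI)
    fix x y :: "real^2"
    assume "x - y \<in> lattice"
    then have "- (x - y) $ i \<in> \<int>" for i
      unfolding lattice_def by (blast intro: Ints_minus)
    then show "y - x \<in> lattice" by (simp add: lattice_def)
  qed
  show "transp (\<lambda>x y. x - y \<in> lattice)"
  proof (rule transpI)
    fix x y z :: "real^2"
    assume "x - y \<in> lattice" "y - z \<in> lattice"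
    then have "(x - y) $ i + (y - z) $ i \<in> \<int>" for i
      unfolding lattice_def by (blast intro: Ints_add)
    then show "x - z \<in> lattice" by (simp add: lattice_def)
  qed
qed

text \<open>The projection \<^term>\<open>proj\<close> is a local isometry and is bijective from the half-open unit
  square onto the torus. Accordingly, measure-theoretic notions for a set \<open>E\<close> in the torus are
  those of its periodic lift \<^term>\<open>proj -` E\<close>, with local quantities evaluated in the plane and
  global ones obtained by integrating over the unit square.\<close>

definition unit_square :: "(real^2) set" where
  "unit_square = {x. \<forall>i. 0 \<le> x $ i \<and> x $ i < 1}"

definition torus_measurable :: "torus set \<Rightarrow> bool" where
  "torus_measurable E \<longleftrightarrow> proj -` E \<in> sets lebesgue"

definition torus_area :: "torus set \<Rightarrow> real" where
  "torus_area E = measure lebesgue (proj -` E \<inter> unit_square)"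

definition torus_translate :: "real^2 \<Rightarrow> torus set \<Rightarrow> torus set" where
  "torus_translate v E = {proj (x + v) | x. proj x \<in> E}"

definition equiv_up_to_translation :: "torus set \<Rightarrow> torus set \<Rightarrow> bool" where
  "equiv_up_to_translation E F \<longleftrightarrow>
     (\<exists>v. proj -` sym_diff (torus_translate v E) F \<in> null_sets lebesgue)"

definition hausdorff1_delta :: "real \<Rightarrow> 'a::metric_space set \<Rightarrow> ennreal" where
  "hausdorff1_delta \<delta> A =
     (INF C \<in> {C :: nat \<Rightarrow> 'a set. A \<subseteq> (\<Union>i. C i) \<and> (\<forall>i. bounded (C i) \<and> diameter (C i) \<le> \<delta>)}.
        \<Sum>i. ennreal (diameter (C i)))"

definition hausdorff1_outer :: "'a::metric_space set \<Rightarrow> ennreal" where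
  "hausdorff1_outer A = (SUP \<delta> \<in> {0<..}. hausdorff1_delta \<delta> A)"

text \<open>The outer measure above is a metric outer measure, hence countably additive on Borel sets;
  so \<^const>\<open>measure_of\<close> does not degenerate to the zero measure here.\<close>

definition hausdorff1 :: "'a::metric_space measure" where
  "hausdorff1 = measure_of UNIV (sets borel) hausdorff1_outer"

definition divergence :: "(real^2 \<Rightarrow> real^2) \<Rightarrow> real^2 \<Rightarrow> real" where
  "divergence T x = (\<Sum>i\<in>UNIV. frechet_derivative T (at x) (axis i 1) $ i)"

definition test_field :: "(real^2 \<Rightarrow> real^2) \<Rightarrow> bool" where
  "test_field T \<longleftrightarrow>
     (\<forall>x. T differentiable (at x)) \<and>
     (\<forall>v. continuous_on UNIV (\<lambda>x. frechet_derivative T (at x) v)) \<and>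
     compact (closure {x. T x \<noteq> 0})"

definition locally_finite_perimeter :: "(real^2) set \<Rightarrow> bool" where
  "locally_finite_perimeter A \<longleftrightarrow>
     A \<in> sets lebesgue \<and>
     (\<forall>C. compact C \<longrightarrow>
        bdd_above {LINT x:A|lebesgue. divergence T x | T.
          test_field T \<and> closure {x. T x \<noteq> 0} \<subseteq> C \<and> (\<forall>x. norm (T x) \<le> 1)})"

text \<open>\<open>is_gauss_green A \<mu> \<sigma>\<close>: the vector-valued Gauss--Green measure of \<open>A\<close> (minus the
  distributional gradient of the indicator function) has polar decomposition \<open>\<sigma> \<mu>\<close>. When \<open>A\<close> has
  locally finite perimeter such a pair exists by the Riesz representation theorem; \<open>\<mu>\<close> is then
  unique and \<open>\<sigma>\<close> is unique \<open>\<mu>\<close>-almost everywhere.\<close>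

definition is_gauss_green ::
  "(real^2) set \<Rightarrow> (real^2) measure \<Rightarrow> (real^2 \<Rightarrow> real^2) \<Rightarrow> bool" where
  "is_gauss_green A \<mu> \<sigma> \<longleftrightarrow>
     sets \<mu> = sets borel \<and>
     (\<forall>C. compact C \<longrightarrow> emeasure \<mu> C < \<infinity>) \<and>
     \<sigma> \<in> borel_measurable borel \<and>
     (AE x in \<mu>. norm (\<sigma> x) = 1) \<and>
     (\<forall>T. test_field T \<longrightarrow>
        (LINT x:A|lebesgue. divergence T x) = (LINT x|\<mu>. T x \<bullet> \<sigma> x))"

definition outer_normal_at :: "(real^2) set \<Rightarrow> real^2 \<Rightarrow> real^2 \<Rightarrow> bool" where
  "outer_normal_at A x \<nu> \<longleftrightarrow>
     (\<exists>\<mu> \<sigma>. is_gauss_green A \<mu> \<sigma> \<and>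
        (\<forall>r>0. emeasure \<mu> (ball x r) > 0) \<and>
        ((\<lambda>r. (LINT y:ball x r|\<mu>. \<sigma> y) /\<^sub>R measure \<mu> (ball x r)) \<longlongrightarrow> \<nu>) (at_right 0) \<and>
        norm \<nu> = 1)"

definition reduced_boundary :: "(real^2) set \<Rightarrow> (real^2) set" where
  "reduced_boundary A = {x. \<exists>\<nu>. outer_normal_at A x \<nu>}"

definition outer_normal :: "(real^2) set \<Rightarrow> real^2 \<Rightarrow> real^2" where
  "outer_normal A x = (THE \<nu>. outer_normal_at A x \<nu>)"

definition finite_perimeter :: "torus set \<Rightarrow> bool" where
  "finite_perimeter E \<longleftrightarrow> locally_finite_perimeter (proj -` E)"

text \<open>The integrand is nonnegative whenever \<open>\<phi>\<close> is the support function of a set containing the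
  origin, so truncation by \<^const>\<open>ennreal\<close> has no effect.\<close>

definition aniso_perimeter :: "(real^2 \<Rightarrow> real) \<Rightarrow> torus set \<Rightarrow> ennreal" where
  "aniso_perimeter \<phi> E =
     (\<integral>\<^sup>+ x \<in> reduced_boundary (proj -` E) \<inter> unit_square.
        ennreal (\<phi> (outer_normal (proj -` E) x)) \<partial>hausdorff1)"

definition admissible :: "real \<Rightarrow> torus set \<Rightarrow> bool" where
  "admissible M E \<longleftrightarrow> torus_measurable E \<and> finite_perimeter E \<and> torus_area E = M"

definition is_minimizer :: "(real^2 \<Rightarrow> real) \<Rightarrow> real \<Rightarrow> torus set \<Rightarrow> bool" where
  "is_minimizer \<phi> M E \<longleftrightarrow>
     admissible M E \<and> (\<forall>F. admissible M F \<longrightarrow> aniso_perimeter \<phi> E \<le> aniso_perimeter \<phi> F)"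

definition convex_body :: "(real^2) set \<Rightarrow> bool" where
  "convex_body K \<longleftrightarrow> compact K \<and> convex K \<and> 0 \<in> interior K"

definition support_fun :: "(real^2) set \<Rightarrow> real^2 \<Rightarrow> real" where
  "support_fun K y = (SUP x\<in>K. x \<bullet> y)"

definition supporting_line :: "(real^2) set \<Rightarrow> real^2 \<Rightarrow> (real^2) set" where
  "supporting_line K \<nu> = {x. x \<bullet> \<nu> = support_fun K \<nu>}"

text \<open>For a convex body the infimum is attained, since the support function is bounded below
  by a positive multiple of the norm.\<close>

definition lattice_width :: "(real^2) set \<Rightarrow> real" where
  "lattice_width K = (INF z \<in> lattice - {0}. support_fun K z + support_fun K (- z))"

definition width_directions :: "(real^2) set \<Rightarrow> (real^2) set" where
  "width_directions K =
     {z \<in> lattice - {0}. support_fun K z + support_fun K (- z) = lattice_width K}"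

definition rot90 :: "real^2 \<Rightarrow> real^2" where
  "rot90 z = vector [- z $ 2, z $ 1]"

definition lamella :: "real^2 \<Rightarrow> real \<Rightarrow> torus set" where
  "lamella z M = proj ` {t *\<^sub>R rot90 z + s *\<^sub>R z | t s. 0 \<le> s \<and> s \<le> M / (norm z)\<^sup>2}"

end

theory Submission
  imports Defs
begin

text \<open>Write \<open>z\<^sub>0 = c + d\<close> with \<open>c\<close>, \<open>d\<close> positive multiples of \<open>\<nu>\<^sub>1\<close>, \<open>\<nu>\<^sub>2\<close>. Both supporting lines pass
  through \<open>P\<close>, so the support function \<open>\<phi>\<close> is linear on the cone spanned by \<open>c\<close> and \<open>d\<close> and
  \<open>\<phi> z\<^sub>0 = \<phi> c + \<phi> d\<close>. Hence the upper boundary line of the lamella, with normal \<open>z\<^sub>0\<close>, can be replaced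
  by a zigzag with normals \<open>c\<close> and \<open>d\<close> without changing the anisotropic perimeter; if the zigzag is
  centred at the line, a point reflection shows that the area does not change either. Zigzags with
  teeth of different sizes leave gaps of different widths, so they are not translates of each other.

  Only two inequalities between perimeters are needed. The one for the zigzag follows from the local
  uniqueness of the Gauss--Green measure: where the set is locally a half-plane or trivial, the
  polar vector is determined by monotonicity of the set along suitable directions. The one for the
  lamella requires, in addition, its Gauss--Green measure.\<close>

subsection \<open>One-dimensional Hausdorff measure\<close>

text \<open>Minimality of the lamella is a hypothesis, so a zigzag is a minimizer once it is
  admissible and its perimeter is at most that of the lamella. Hence the asymmetry of the two
  estimates. The upper bound for the zigzag only identifies normals at points already in the reduced
  boundary, where \<open>outer_normal_at\<close> hands over a Gauss--Green pair. The lower bound for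
  the lamella has to put points into the reduced boundary, so there a pair must be constructed.

  The obstacle to drawing the zigzag is periodicity: its edges must match under all lattice vectors,
  not only under those along the boundary line. A width direction z is primitive, so the lattice
  vectors orthogonal to z are the integer multiples of \<open>rot90 z\<close> and the period is D =
  \<open>c \<bullet> rot90 z\<close>. Other lattice vectors shift the teeth by multiples of D /
  (\<open>z \<bullet> z\<close>), which is why one period carries k * (\<open>z \<bullet> z\<close>)
  teeth. The half height of a tooth, measured by \<open>x \<bullet> z\<close>, must be less than min
  M (1 - M) for the zigzag to stay inside its strip. All large k satisfy this, and the total edge
  lengths do not depend on k.\<close>

lemma hausdorff1_delta_le:
  assumes "A \<subseteq> (\<Union>i. C i)" and "\<And>i. bounded (C i)" and "\<And>i. diameter (C i) \<le> \<delta>"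
  shows "hausdorff1_delta \<delta> A \<le> (\<Sum>i. ennreal (diameter (C i)))"
  unfolding hausdorff1_delta_def by (rule INF_lower) (use assms in auto)

lemma hausdorff1_delta_mono: "A \<subseteq> B \<Longrightarrow> hausdorff1_delta \<delta> A \<le> hausdorff1_delta \<delta> B"
  unfolding hausdorff1_delta_def by (rule INF_superset_mono) auto

lemma hausdorff1_delta_antimono: "\<delta> \<le> \<delta>' \<Longrightarrow> hausdorff1_delta \<delta>' A \<le> hausdorff1_delta \<delta> A"
  unfolding hausdorff1_delta_def by (rule INF_superset_mono) (auto intro: order_trans)

lemma hausdorff1_outer_mono: "A \<subseteq> B \<Longrightarrow> hausdorff1_outer A \<le> hausdorff1_outer B"
  unfolding hausdorff1_outer_def by (intro SUP_mono) (auto intro: hausdorff1_delta_mono)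

text \<open>The n-th piece is covered with an excess of at most e / 2^(n+1). Covers are sequences in
  \<open>hausdorff1_delta\<close>, so the doubly indexed family is renumbered by
  \<open>prod_decode\<close>.\<close>

lemma hausdorff1_delta_countably_subadditive:
  fixes A :: "nat \<Rightarrow> 'a::metric_space set"
  shows "hausdorff1_delta \<delta> (\<Union>i. A i) \<le> (\<Sum>i. hausdorff1_delta \<delta> (A i))"
proof (rule ennreal_le_epsilon)
  let ?O = "hausdorff1_delta \<delta>"
  fix e :: real assume "0 < e" and fin: "(\<Sum>n. ?O (A n)) < top"
  then have *: "?O (A n) < ?O (A n) + e * (1/2)^Suc n" for n
    by (auto simp add: less_top dest!: ennreal_suminf_lessD)
  define good where "good n C \<longleftrightarrow> A n \<subseteq> (\<Union>i. C i) \<and> (\<forall>i. bounded (C i) \<and> diameter (C i) \<le> \<delta>) \<and>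
          (\<Sum>i. ennreal (diameter (C i))) \<le> ?O (A n) + e * (1/2)^Suc n" for n C
  have "\<exists>C. good n C" for n
    using *[of n] unfolding hausdorff1_delta_def INF_less_iff good_def by (auto intro: less_imp_le)
  then obtain B where "good n (B n)" for n by metis
  then have B: "\<And>n. A n \<subseteq> (\<Union>i. B n i)" "\<And>n i. bounded (B n i)"
      "\<And>n i. diameter (B n i) \<le> \<delta>"
      "\<And>n. (\<Sum>i. ennreal (diameter (B n i))) \<le> ?O (A n) + e * (1/2)^Suc n"
    by (simp_all add: good_def)
  define C where "C = case_prod B o prod_decode"
  have "?O (\<Union>i. A i) \<le> (\<Sum>i. ennreal (diameter (C i)))"
  proof (rule hausdorff1_delta_le)
    show "(\<Union>i. A i) \<subseteq> (\<Union>i. C i)"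
      using B(1) by (auto simp add: C_def subset_eq) (metis prod.case prod_encode_inverse)
  qed (auto simp: C_def B split: prod.split)
  also have "\<dots> = (\<Sum>n. \<Sum>i. ennreal (diameter (B n i)))"
    using suminf_ennreal_2dimen[where f = "\<lambda>p. ennreal (diameter (case_prod B p))"
        and g = "\<lambda>n. \<Sum>i. ennreal (diameter (B n i))"]
    by (simp add: C_def comp_def)
  also have "\<dots> \<le> (\<Sum>n. ?O (A n) + e * (1/2) ^ Suc n)"
    by (intro suminf_le allI B) auto
  also have "... = (\<Sum>n. ?O (A n)) + (\<Sum>n. ennreal e * ennreal ((1/2) ^ Suc n))"
    using \<open>0 < e\<close> by (subst suminf_add[symmetric])
                     (auto simp del: ennreal_suminf_cmult simp add: ennreal_mult[symmetric])
  also have "\<dots> = (\<Sum>n. ?O (A n)) + e"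
    unfolding ennreal_suminf_cmult
    by (subst suminf_ennreal_eq[OF zero_le_power power_half_series]) auto
  finally show "?O (\<Union>i. A i) \<le> (\<Sum>n. ?O (A n)) + e" .
qed

lemma hausdorff1_outer_countably_subadditive:
  fixes A :: "nat \<Rightarrow> 'a::metric_space set"
  shows "hausdorff1_outer (\<Union>i. A i) \<le> (\<Sum>i. hausdorff1_outer (A i))"
proof -
  have "hausdorff1_delta \<delta> (\<Union>i. A i) \<le> (\<Sum>i. hausdorff1_outer (A i))" if "0 < \<delta>" for \<delta>
  proof -
    have "hausdorff1_delta \<delta> (A i) \<le> hausdorff1_outer (A i)" for i
      unfolding hausdorff1_outer_def using that by (intro SUP_upper) auto
    then show ?thesis
      by (intro order_trans[OF hausdorff1_delta_countably_subadditive] suminf_le) auto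
  qed
  then show ?thesis
    by (subst hausdorff1_outer_def) (auto intro: SUP_least)
qed

lemma hausdorff1_outer_empty: "hausdorff1_outer {} = 0"
proof -
  have "hausdorff1_delta \<delta> ({} :: 'a set) \<le> 0" if "0 < \<delta>" for \<delta>
    using hausdorff1_delta_le[of "{}" "\<lambda>_. {}" \<delta>] that by auto
  then show ?thesis
    by (auto simp: hausdorff1_outer_def)
qed

lemma outer_measure_space_hausdorff1_outer: "outer_measure_space (Pow UNIV) hausdorff1_outer"
  unfolding outer_measure_space_def positive_def increasing_def countably_subadditive_def
  by (simp add: hausdorff1_outer_empty hausdorff1_outer_mono hausdorff1_outer_countably_subadditive)

lemma hausdorff1_outer_subadditive:
  "hausdorff1_outer (A \<union> B) \<le> hausdorff1_outer A + hausdorff1_outer B"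
proof -
  have "hausdorff1_outer (\<Union>i. binaryset A B i) \<le> (\<Sum>i. hausdorff1_outer (binaryset A B i))"
    by (rule hausdorff1_outer_countably_subadditive)
  also have "(\<Sum>i. hausdorff1_outer (binaryset A B i)) = hausdorff1_outer A + hausdorff1_outer B"
    by (rule suminf_binaryset_eq) (rule hausdorff1_outer_empty)
  finally show ?thesis
    by (simp add: UN_binaryset_eq)
qed

text \<open>At scales below d no member of a cover meets both A and B, so a cover of the union
  splits into covers of the two sets. The supremum over scales is then treated as a limit at 0,
  because limits can be added.\<close>

lemma hausdorff1_outer_separated:
  fixes A B :: "'a::metric_space set"
  assumes "0 < d" and sep: "\<And>x y. x \<in> A \<Longrightarrow> y \<in> B \<Longrightarrow> d \<le> dist x y"
  shows "hausdorff1_outer A + hausdorff1_outer B \<le> hausdorff1_outer (A \<union> B)"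
proof -
  have *: "hausdorff1_delta \<delta> A + hausdorff1_delta \<delta> B \<le> hausdorff1_delta \<delta> (A \<union> B)"
    if "0 < \<delta>" "\<delta> < d" for \<delta>
    unfolding hausdorff1_delta_def[of _ "A \<union> B"]
  proof (rule INF_greatest)
    fix C :: "nat \<Rightarrow> 'a set"
    assume C: "C \<in> {C. A \<union> B \<subseteq> (\<Union>i. C i) \<and> (\<forall>i. bounded (C i) \<and> diameter (C i) \<le> \<delta>)}"
    \<comment> \<open>Discarded members become the empty set, of diameter 0; this keeps the indexing
      by natural numbers.\<close>
    define CA where "CA i = (if C i \<inter> A = {} then {} else C i)" for i
    define CB where "CB i = (if C i \<inter> B = {} then {} else C i)" for i
    have dj: "C i \<inter> A = {} \<or> C i \<inter> B = {}" for i
    proof (rule ccontr)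
      assume "\<not> ?thesis"
      then obtain x y where xy: "x \<in> C i" "x \<in> A" "y \<in> C i" "y \<in> B" by auto
      then have "dist x y \<le> \<delta>"
        using C by (intro order_trans[OF diameter_bounded_bound[of "C i" x y]]) auto
      with sep[of x y] xy that show False by auto
    qed
    have "hausdorff1_delta \<delta> A \<le> (\<Sum>i. ennreal (diameter (CA i)))"
    proof (rule hausdorff1_delta_le)
      show "A \<subseteq> (\<Union>i. CA i)"
      proof
        fix x assume "x \<in> A"
        moreover from this C obtain i where "x \<in> C i" by blast
        ultimately have "x \<in> CA i" by (auto simp: CA_def)
        then show "x \<in> (\<Union>i. CA i)" by blast
      qed
    qed (use C that in \<open>auto simp: CA_def\<close>)
    moreover have "hausdorff1_delta \<delta> B \<le> (\<Sum>i. ennreal (diameter (CB i)))"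
    proof (rule hausdorff1_delta_le)
      show "B \<subseteq> (\<Union>i. CB i)"
      proof
        fix x assume "x \<in> B"
        moreover from this C obtain i where "x \<in> C i" by blast
        ultimately have "x \<in> CB i" by (auto simp: CB_def)
        then show "x \<in> (\<Union>i. CB i)" by blast
      qed
    qed (use C that in \<open>auto simp: CB_def\<close>)
    moreover have "ennreal (diameter (CA i)) + ennreal (diameter (CB i)) \<le> ennreal (diameter (C i))" for i
      using dj[of i] by (auto simp: CA_def CB_def)
    ultimately have "hausdorff1_delta \<delta> A + hausdorff1_delta \<delta> B
        \<le> (\<Sum>i. ennreal (diameter (CA i)) + ennreal (diameter (CB i)))"
      and "(\<Sum>i. ennreal (diameter (CA i)) + ennreal (diameter (CB i))) \<le> (\<Sum>i. ennreal (diameter (C i)))"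
      by (simp add: suminf_add[symmetric] add_mono, intro suminf_le) auto
    then show "hausdorff1_delta \<delta> A + hausdorff1_delta \<delta> B \<le> (\<Sum>i. ennreal (diameter (C i)))"
      by (rule order_trans)
  qed
  have lim: "((\<lambda>\<delta>. hausdorff1_delta \<delta> X) \<longlongrightarrow> hausdorff1_outer X) (at_right 0)" for X :: "'a set"
  proof (rule order_tendstoI)
    fix a assume "a < hausdorff1_outer X"
    then obtain \<delta> where \<delta>: "0 < \<delta>" "a < hausdorff1_delta \<delta> X"
      by (auto simp: hausdorff1_outer_def less_SUP_iff)
    then have "\<forall>\<^sub>F t in at_right 0. t \<in> {0<..<\<delta>}"
      by (intro eventually_at_right_real)
    then show "\<forall>\<^sub>F t in at_right 0. a < hausdorff1_delta t X"
      by eventually_elim (use \<delta>(2) hausdorff1_delta_antimono[of _ \<delta> X] in \<open>auto intro: less_le_trans\<close>)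
  next
    fix a assume a: "hausdorff1_outer X < a"
    have "\<forall>\<^sub>F t in at_right 0. t \<in> {0<..<(1::real)}"
      by (intro eventually_at_right_real) auto
    then show "\<forall>\<^sub>F t in at_right 0. hausdorff1_delta t X < a"
    proof eventually_elim
      case (elim t)
      then have "hausdorff1_delta t X \<le> hausdorff1_outer X"
        unfolding hausdorff1_outer_def by (intro SUP_upper) auto
      then show ?case using a by auto
    qed
  qed
  have "\<forall>\<^sub>F \<delta> in at_right 0. \<delta> \<in> {0<..<d}"
    using \<open>0 < d\<close> by (intro eventually_at_right_real)
  then have "\<forall>\<^sub>F \<delta> in at_right 0. hausdorff1_delta \<delta> A + hausdorff1_delta \<delta> B
               \<le> hausdorff1_delta \<delta> (A \<union> B)"
    by eventually_elim (use * in auto)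
  then show ?thesis
    by (intro tendsto_le[OF _ lim[of "A \<union> B"] tendsto_add[OF lim[of A] lim[of B]]]) auto
qed

text \<open>In the shell argument below, the head u of a series is added to both sides in place of
  subtracting its tail t, since cancellation in \<open>ennreal\<close> requires finiteness.\<close>

lemma ennreal_add_chain:
  fixes a b x y t s u :: ennreal
  assumes "b \<le> y + t" and "a + y \<le> x" and "s = t + u"
  shows "a + b + u \<le> x + s"
proof -
  have "a + b + u \<le> a + (y + t) + u"
    by (intro add_mono assms order_refl)
  also have "\<dots> = (a + y) + (t + u)"
    by (simp only: ac_simps)
  also have "\<dots> \<le> x + s"
    unfolding assms(3) by (intro add_mono assms order_refl)
  finally show ?thesis .
qed

text \<open>The shells around \<open>C\<close> with indices of equal parity are separated, so the sum of their outer
  measures converges; its tails bound the part of \<open>X - C\<close> close to \<open>C\<close>.\<close>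

lemma closed_caratheodory_hausdorff1:
  fixes C X :: "'a::metric_space set"
  assumes "closed C"
  shows "hausdorff1_outer (X \<inter> C) + hausdorff1_outer (X - C) \<le> hausdorff1_outer X"
proof (cases "C = {} \<or> hausdorff1_outer X = top")
  case True
  then show ?thesis by (auto simp: hausdorff1_outer_empty)
next
  case False
  then have ne: "C \<noteq> {}" and fin: "hausdorff1_outer X < top" by (auto simp: less_top)
  let ?H = "hausdorff1_outer :: 'a set \<Rightarrow> ennreal"
  define f where "f x = infdist x C" for x
  define r where "r n = 1 / (real n + 1)" for n
  define D where "D n = {x \<in> X. r (Suc n) \<le> f x \<and> f x < r n}" for n
  define Y where "Y n = {x \<in> X. r n \<le> f x}" for n
  have f_dist: "f x - f y \<le> dist x y" for x y
    using infdist_triangle[of x C y] by (simp add: f_def)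
  have r_mono: "r n < r m" if "m < n" for m n
    using that by (simp add: r_def frac_less2)
  have par: "(\<Sum>i<n. ?H (D (2 * i + e))) \<le> ?H (\<Union>i<n. D (2 * i + e))" for n e
  proof (induction n)
    case (Suc n)
    show ?case
    proof (cases "n = 0")
      case True then show ?thesis by (simp add: lessThan_Suc)
    next
      case False
      let ?m = "2 * n + e"
      have "(\<Sum>i<Suc n. ?H (D (2 * i + e))) \<le> ?H (\<Union>i<n. D (2 * i + e)) + ?H (D ?m)"
        using Suc by (simp add: add_mono)
      also have "\<dots> \<le> ?H ((\<Union>i<n. D (2 * i + e)) \<union> D ?m)"
      \<comment> \<open>The shell of index \<open>?m - 1\<close> has the other parity and is absent
        from the union; its thickness is the separating distance. For n = 0 the truncated difference
        \<open>?m - 1\<close> could equal \<open>?m\<close>, so that case is settled first.\<close>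
      proof (rule hausdorff1_outer_separated[where d = "r (?m - 1) - r ?m"])
        fix x y assume "x \<in> (\<Union>i<n. D (2 * i + e))" and y: "y \<in> D ?m"
        then obtain i where "i < n" "r (Suc (2 * i + e)) \<le> f x" by (auto simp: D_def)
        moreover have "r (?m - 1) \<le> r (Suc (2 * i + e))"
          using \<open>i < n\<close> by (simp add: r_def frac_le)
        moreover have "f y < r ?m" using y by (auto simp: D_def)
        ultimately show "r (?m - 1) - r ?m \<le> dist x y"
          using f_dist[of x y] by linarith
      qed (use False r_mono in auto)
      finally show ?thesis by (simp add: lessThan_Suc Un_commute)
    qed
  qed (simp add: hausdorff1_outer_empty)
  have par': "(\<Sum>i. ?H (D (2 * i + e))) \<le> ?H X" for e
    by (intro suminf_le_const summableI order_trans[OF par] hausdorff1_outer_mono)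
      (auto simp: D_def)
  have "(\<Sum>i<2*n. ?H (D i)) = (\<Sum>i<n. ?H (D (2*i+0))) + (\<Sum>i<n. ?H (D (2*i+1)))" for n
    by (induction n) (auto simp: ac_simps)
  moreover have "(\<Sum>i<n. ?H (D (2*i+e))) \<le> ?H X" for n e
    by (rule order_trans[OF sum_le_suminf par']) auto
  ultimately have "(\<Sum>i<2*n. ?H (D i)) \<le> ?H X + ?H X" for n
    by (metis add_mono)
  moreover have "(\<Sum>i<n. ?H (D i)) \<le> (\<Sum>i<2*n. ?H (D i))" for n
    by (rule sum_mono2) auto
  ultimately have "(\<Sum>i. ?H (D i)) \<le> ?H X + ?H X"
    by (intro suminf_le_const summableI) (meson order_trans)
  then have S_fin: "(\<Sum>i. ?H (D i)) < top"
    using fin by (simp add: le_less_trans)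
  have "?H (X \<inter> C) + ?H (X - C) + (\<Sum>i<n. ?H (D i)) \<le> ?H X + (\<Sum>i. ?H (D i))" for n
  proof -
    have "X - C \<subseteq> Y n \<union> (\<Union>i. D (i + n))"
    proof
      fix x assume x: "x \<in> X - C"
      then have "0 < f x"
        using \<open>closed C\<close> ne by (simp add: f_def infdist_pos_not_in_closed)
      moreover have "r \<longlonglongrightarrow> 0"
        unfolding r_def using LIMSEQ_inverse_real_of_nat by (simp add: inverse_eq_divide add.commute)
      ultimately have "\<forall>\<^sub>F m in sequentially. r m < f x"
        by (simp add: order_tendstoD(2))
      then obtain m where m: "r m < f x" by (auto simp: eventually_sequentially)
      show "x \<in> Y n \<union> (\<Union>i. D (i + n))"
      proof (cases "r n \<le> f x")
        case False
        \<comment> \<open>The first radius not exceeding \<open>f x\<close>. Then x lies in the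
          shell of index k - 1, which belongs to the tail because n < k.\<close>
        define k where "k = (LEAST k. r k \<le> f x)"
        have k: "r k \<le> f x" unfolding k_def by (rule LeastI[of "\<lambda>k. r k \<le> f x", OF less_imp_le[OF m]])
        have "n < k"
        proof (rule ccontr)
          assume "\<not> n < k"
          then have "r n \<le> r k" using r_mono[of k n] by (cases "k = n") auto
          with False k show False by simp
        qed
        then have "f x < r (k - 1)" using not_less_Least[of "k - 1" "\<lambda>k. r k \<le> f x"]
          by (auto simp: k_def)
        with k \<open>n < k\<close> x have "x \<in> D ((k - 1 - n) + n)" by (auto simp: D_def)
        then show ?thesis by blast
      qed (use x in \<open>auto simp: Y_def\<close>)
    qed
    then have "?H (X - C) \<le> ?H (Y n \<union> (\<Union>i. D (i + n)))"
      by (rule hausdorff1_outer_mono)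
    also have "\<dots> \<le> ?H (Y n) + ?H (\<Union>i. D (i + n))"
      by (rule hausdorff1_outer_subadditive)
    also have "\<dots> \<le> ?H (Y n) + (\<Sum>i. ?H (D (i + n)))"
      by (intro add_left_mono hausdorff1_outer_countably_subadditive)
    finally have "?H (X - C) \<le> ?H (Y n) + (\<Sum>i. ?H (D (i + n)))" .
    moreover have "?H (X \<inter> C) + ?H (Y n) \<le> ?H X"
    proof -
      have "?H (Y n) + ?H (X \<inter> C) \<le> ?H (Y n \<union> (X \<inter> C))"
      proof (rule hausdorff1_outer_separated[where d = "r n"])
        fix x y assume "x \<in> Y n" "y \<in> X \<inter> C"
        moreover from this have "f x \<le> dist x y" unfolding f_def by (auto intro: infdist_le)
        ultimately show "r n \<le> dist x y" by (auto simp: Y_def)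
      qed (auto simp: r_def)
      also have "\<dots> \<le> ?H X" by (rule hausdorff1_outer_mono) (auto simp: Y_def)
      finally show ?thesis by (simp add: add.commute)
    qed
    moreover have "(\<Sum>i. ?H (D i)) = (\<Sum>i. ?H (D (i + n))) + (\<Sum>i<n. ?H (D i))"
      by (rule suminf_offset) auto
    ultimately show ?thesis
      by (rule ennreal_add_chain)
  qed
  moreover have "(\<lambda>n. ?H (X \<inter> C) + ?H (X - C) + (\<Sum>i<n. ?H (D i)))
      \<longlonglongrightarrow> ?H (X \<inter> C) + ?H (X - C) + (\<Sum>i. ?H (D i))"
    by (intro tendsto_add tendsto_const summable_LIMSEQ summableI)
  ultimately have "?H (X \<inter> C) + ?H (X - C) + (\<Sum>i. ?H (D i)) \<le> ?H X + (\<Sum>i. ?H (D i))"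
    by (intro LIMSEQ_le_const2) auto
  then show ?thesis
    using S_fin by (auto simp: add.commute[of _ "suminf _"] ennreal_add_left_cancel_le)
qed

text \<open>\<open>measure_of\<close> agrees with the given set function where the latter is
  countably additive. Caratheodory's construction gives additivity on \<open>lambda_system\<close>,
  which contains the closed sets by the preceding lemma and hence all Borel sets.\<close>

lemma emeasure_hausdorff1:
  assumes "A \<in> sets borel"
  shows "emeasure hausdorff1 A = hausdorff1_outer A"
proof -
  let ?L = "lambda_system UNIV (Pow UNIV) hausdorff1_outer :: 'a set set"
  have ms: "measure_space UNIV ?L hausdorff1_outer"
    by (rule sigma_algebra.caratheodory_lemma[OF sigma_algebra_Pow outer_measure_space_hausdorff1_outer])
  then interpret L: sigma_algebra UNIV ?L by (simp add: measure_space_def)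
  have "C \<in> ?L" if "closed C" for C :: "'a set"
  proof -
    have "hausdorff1_outer X \<le> hausdorff1_outer (X \<inter> C) + hausdorff1_outer (X - C)" for X
      using hausdorff1_outer_subadditive[of "X \<inter> C" "X - C"] by (simp add: Int_Diff_Un)
    then have "hausdorff1_outer (X \<inter> C) + hausdorff1_outer (X - C) = hausdorff1_outer X" for X
      by (intro antisym closed_caratheodory_hausdorff1[OF that])
    moreover have "(UNIV - C) \<inter> X = X - C" "C \<inter> X = X \<inter> C" for X by auto
    ultimately show ?thesis
      by (simp add: lambda_system_def)
  qed
  then have "Collect closed \<subseteq> ?L" by auto
  then have "sets borel \<subseteq> ?L"
    using L.sigma_sets_subset[of "Collect closed"] by (simp add: borel_eq_closed)
  then have "measure_space UNIV (sets borel) (hausdorff1_outer :: 'a set \<Rightarrow> ennreal)"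
    using measure_down[OF ms] sets.sigma_algebra_axioms[of borel] by simp
  then have "sigma_algebra UNIV (sets borel :: 'a set set)"
    "positive (sets borel) (hausdorff1_outer :: 'a set \<Rightarrow> ennreal)"
    "countably_additive (sets borel) (hausdorff1_outer :: 'a set \<Rightarrow> ennreal)"
    by (simp_all add: measure_space_def)
  then show ?thesis
    unfolding hausdorff1_def using assms by (rule emeasure_measure_of_sigma)
qed

lemma sets_hausdorff1 [simp, measurable_cong]: "sets hausdorff1 = sets borel"
  unfolding hausdorff1_def by (simp add: sets.sigma_sets_eq[of borel, simplified])

lemma space_hausdorff1 [simp]: "space hausdorff1 = UNIV"
  by (simp add: hausdorff1_def)

section \<open>Translation invariance and the length of segments\<close>

lemma hausdorff1_outer_translation:
  fixes A :: "'a::real_normed_vector set"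
  shows "hausdorff1_outer ((+) v ` A) = hausdorff1_outer A"
proof -
  have "hausdorff1_delta \<delta> ((+) w ` B) \<le> hausdorff1_delta \<delta> B" for \<delta> w and B :: "'a set"
    unfolding hausdorff1_delta_def[of _ B]
  proof (rule INF_greatest)
    fix C :: "nat \<Rightarrow> 'a set"
    assume C: "C \<in> {C. B \<subseteq> (\<Union>i. C i) \<and> (\<forall>i. bounded (C i) \<and> diameter (C i) \<le> \<delta>)}"
    have d: "diameter ((+) w ` C i) = diameter (C i)" for i
    proof -
      have "(\<lambda>(x,y). dist x y) ` ((+) w ` C i \<times> (+) w ` C i) = (\<lambda>(x,y). dist x y) ` (C i \<times> C i)"
        by (force simp: image_iff)
      then show ?thesis by (simp add: diameter_def image_is_empty)
    qed
    have "hausdorff1_delta \<delta> ((+) w ` B) \<le> (\<Sum>i. ennreal (diameter ((+) w ` C i)))"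
      using C by (intro hausdorff1_delta_le) (auto simp: d bounded_translation image_UN[symmetric])
    then show "hausdorff1_delta \<delta> ((+) w ` B) \<le> (\<Sum>i. ennreal (diameter (C i)))"
      by (simp add: d)
  qed
  from this[of _ v A] this[of _ "-v" "(+) v ` A"]
  have "hausdorff1_delta \<delta> ((+) v ` A) = hausdorff1_delta \<delta> A" for \<delta>
    by (intro antisym) (auto simp: image_image)
  then show ?thesis by (simp add: hausdorff1_outer_def)
qed

text \<open>With n > norm d / \<delta>, cutting the segment into n equal pieces gives a cover of
  mesh \<delta> whose diameters add up to at most norm d.\<close>

lemma hausdorff1_segment_le:
  fixes p d :: "'a::real_normed_vector"
  assumes "X \<subseteq> {p + t *\<^sub>R d | t. 0 \<le> t \<and> t \<le> 1}"
  shows "hausdorff1_outer X \<le> ennreal (norm d)"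
  unfolding hausdorff1_outer_def
proof (rule SUP_least)
  fix \<delta> :: real assume "\<delta> \<in> {0<..}"
  then have "0 < \<delta>" by auto
  obtain n :: nat where n: "norm d / \<delta> < n" using reals_Archimedean2 by auto
  then have "0 < real n" using \<open>0 < \<delta>\<close> by (smt (verit) divide_nonneg_pos norm_ge_zero)
  define C where "C i = (if i < n then {p + t *\<^sub>R d | t. real i / n \<le> t \<and> t \<le> (real i + 1) / n} else {})" for i
  have dist: "norm (x - y) \<le> norm d / n" if "x \<in> C i" "y \<in> C i" for x y i
  proof -
    from that obtain s t where st: "x = p + s *\<^sub>R d" "y = p + t *\<^sub>R d"
      "real i / n \<le> t" "t \<le> (real i + 1) / n" "real i / n \<le> s" "s \<le> (real i + 1) / n"
      by (auto simp: C_def split: if_splits)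
    have "\<bar>s - t\<bar> \<le> 1 / n" using st by (auto simp: abs_if add_divide_distrib)
    have "x - y = (s - t) *\<^sub>R d" using st by (simp add: algebra_simps)
    then have "norm (x - y) = \<bar>s - t\<bar> * norm d" by simp
    also have "\<dots> \<le> 1 / n * norm d" using \<open>\<bar>s - t\<bar> \<le> 1 / n\<close> by (intro mult_right_mono) auto
    finally show ?thesis by simp
  qed
  have diam: "diameter (C i) \<le> (if i < n then norm d / n else 0)" for i
  proof (cases "i < n")
    case True
    then show ?thesis using dist[of _ i] by (auto intro!: diameter_le)
  qed (simp add: C_def)
  have "X \<subseteq> (\<Union>i. C i)"
  proof
    fix x assume "x \<in> X"
    then obtain t where t: "x = p + t *\<^sub>R d" "0 \<le> t" "t \<le> 1" using assms by auto
    \<comment> \<open>The minimum puts the endpoint t = 1, where the floor is n, into the last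
      piece.\<close>
    define i where "i = min (nat \<lfloor>t * n\<rfloor>) (n - 1)"
    have "i < n" using \<open>0 < real n\<close> by (auto simp: i_def)
    moreover have "real i / n \<le> t"
    proof -
      have "real i \<le> real (nat \<lfloor>t * n\<rfloor>)" by (simp add: i_def)
      also have "\<dots> \<le> t * n" using t by (simp add: of_nat_floor)
      finally show ?thesis using \<open>0 < real n\<close> by (simp add: field_simps)
    qed
    moreover have "t \<le> (real i + 1) / n"
    proof (cases "nat \<lfloor>t * n\<rfloor> \<le> n - 1")
      case True
      then have "real i = real_of_int \<lfloor>t * n\<rfloor>" using t by (simp add: i_def)
      moreover have "t * n < real_of_int \<lfloor>t * n\<rfloor> + 1" by linarith
      ultimately show ?thesis using \<open>0 < real n\<close> by (simp add: field_simps)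
    next
      case False
      then have "real i + 1 = n" using \<open>0 < real n\<close> by (simp add: i_def min_def of_nat_diff)
      then show ?thesis using t \<open>0 < real n\<close> by simp
    qed
    ultimately have "x \<in> C i" using t by (auto simp: C_def)
    then show "x \<in> (\<Union>i. C i)" by blast
  qed
  moreover have "bounded (C i)" for i
  proof (cases "i < n")
    case True
    have "p + (real i / n) *\<^sub>R d \<in> C i"
      using True \<open>0 < real n\<close> by (auto simp: C_def intro!: exI[of _ "real i / n"] divide_right_mono)
    then show ?thesis
      using dist[of _ i] unfolding bounded_def dist_norm by blast
  qed (simp add: C_def)
  moreover have "norm d / n \<le> \<delta>"
    using n \<open>0 < \<delta>\<close> \<open>0 < real n\<close> by (simp add: field_simps)
  ultimately have "hausdorff1_delta \<delta> X \<le> (\<Sum>i. ennreal (diameter (C i)))"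
    using order_trans[OF diam] \<open>0 < \<delta>\<close> by (intro hausdorff1_delta_le) auto
  also have "\<dots> \<le> (\<Sum>i. ennreal (if i < n then norm d / n else 0))"
    by (intro suminf_le ennreal_leI diam) auto
  also have "\<dots> = (\<Sum>i<n. ennreal (if i < n then norm d / n else 0))"
    by (rule suminf_finite) auto
  also have "\<dots> = ennreal (\<Sum>i<n. norm d / n)"
    by (subst sum_ennreal[symmetric]) auto
  also have "(\<Sum>i<n. norm d / n) = norm d" using \<open>0 < real n\<close> by simp
  finally show "hausdorff1_delta \<delta> X \<le> ennreal (norm d)" .
qed

text \<open>Pulled back to the parameter line, each member of a cover lies in an interval as long as
  its diameter, so Lebesgue measure bounds the sum from below. Scale 1 is enough, since the outer
  measure is a supremum over scales.\<close>

lemma hausdorff1_segment_ge: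
  fixes p u :: "'a::real_inner"
  assumes "norm u = 1" and X: "\<And>t. 0 < t \<Longrightarrow> t < l \<Longrightarrow> p + t *\<^sub>R u \<in> X"
  shows "ennreal l \<le> hausdorff1_outer X"
proof -
  have "ennreal l \<le> hausdorff1_delta 1 X"
    unfolding hausdorff1_delta_def
  proof (rule INF_greatest)
    fix C :: "nat \<Rightarrow> 'a set"
    assume C: "C \<in> {C. X \<subseteq> (\<Union>i. C i) \<and> (\<forall>i. bounded (C i) \<and> diameter (C i) \<le> 1)}"
    define T where "T i = {t. p + t *\<^sub>R u \<in> C i}" for i
    have T: "\<exists>a. T i \<subseteq> {a..a + diameter (C i)}" for i
    proof (cases "T i = {}")
      case False
      have bd: "\<bar>s - t\<bar> \<le> diameter (C i)" if "s \<in> T i" "t \<in> T i" for s t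
      proof -
        have "dist (p + s *\<^sub>R u) (p + t *\<^sub>R u) \<le> diameter (C i)"
          using that C by (intro diameter_bounded_bound) (auto simp: T_def)
        moreover have "dist (p + s *\<^sub>R u) (p + t *\<^sub>R u) = norm ((s - t) *\<^sub>R u)"
          by (simp add: dist_norm algebra_simps)
        ultimately show ?thesis using assms(1) by simp
      qed
      obtain t0 where t0: "t0 \<in> T i" using False by auto
      have bb: "bdd_below (T i)"
        by (rule bdd_belowI[of _ "t0 - diameter (C i)"]) (use bd[OF _ t0] in force)
      have "t \<le> Inf (T i) + diameter (C i)" if "t \<in> T i" for t
      proof -
        have "t - diameter (C i) \<le> Inf (T i)"
          by (rule cInf_greatest[OF False]) (use bd[OF that] in force)
        then show ?thesis by simp
      qed
      then show ?thesis
        using bb by (auto intro!: exI[of _ "Inf (T i)"] cInf_lower)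
    qed auto
    then obtain a where a: "\<And>i. T i \<subseteq> {a i..a i + diameter (C i)}" by metis
    have "{0<..<l} \<subseteq> (\<Union>i. {a i..a i + diameter (C i)})"
    proof
      fix t assume "t \<in> {0<..<l}"
      then obtain i where "t \<in> T i" using X[of t] C by (auto simp: T_def)
      then show "t \<in> (\<Union>i. {a i..a i + diameter (C i)})" using a by blast
    qed
    then have "emeasure lborel {0<..<l} \<le> emeasure lborel (\<Union>i. {a i..a i + diameter (C i)})"
      by (rule emeasure_mono) auto
    also have "\<dots> \<le> (\<Sum>i. emeasure lborel {a i..a i + diameter (C i)})"
      by (rule emeasure_subadditive_countably) auto
    also have "\<dots> = (\<Sum>i. ennreal (diameter (C i)))"
      using C diameter_ge_0[of "C _"] by (intro suminf_cong) auto
    finally show "ennreal l \<le> (\<Sum>i. ennreal (diameter (C i)))"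
      by (cases "0 \<le> l") (auto simp: ennreal_neg)
  qed
  also have "\<dots> \<le> hausdorff1_outer X"
    unfolding hausdorff1_outer_def by (rule SUP_upper) auto
  finally show ?thesis .
qed

lemma countable_null_hausdorff1:
  fixes X :: "'a::real_normed_vector set"
  assumes "countable X"
  shows "X \<in> null_sets hausdorff1"
proof -
  have "{x} \<in> null_sets hausdorff1" for x :: 'a
    using hausdorff1_segment_le[of "{x}" x 0] by (force simp: null_sets_def emeasure_hausdorff1)
  then have "(\<Union>x\<in>X. {x}) \<in> null_sets hausdorff1"
    using assms by (intro null_sets_UN') auto
  then show ?thesis by simp
qed

subsection \<open>Fundamental domains of the integer lattice\<close>

lemma inner_real2: "(x::real^2) \<bullet> y = x $ 1 * y $ 1 + x $ 2 * y $ 2"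
  by (simp add: inner_vec_def sum_2)

lemma rot90_nth [simp]: "rot90 z $ 1 = - z $ 2" "rot90 z $ 2 = z $ 1"
  by (simp_all add: rot90_def)

lemma real2_eq_iff: "(x::real^2) = y \<longleftrightarrow> x $ 1 = y $ 1 \<and> x $ 2 = y $ 2"
  by (simp add: vec_eq_iff forall_2)

lemma rot90_inner_rot90 [simp]: "rot90 x \<bullet> rot90 y = x \<bullet> y"
  by (simp add: inner_real2)

lemma inner_rot90_self [simp]: "z \<bullet> rot90 z = 0" "rot90 z \<bullet> z = 0"
  by (simp_all add: inner_real2)

lemma norm_rot90 [simp]: "norm (rot90 z) = norm z"
  by (simp add: norm_eq_sqrt_inner)

lemma rot90_scaleR: "rot90 (c *\<^sub>R z) = c *\<^sub>R rot90 z"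
  by (simp add: real2_eq_iff)

lemma real2_decomp:
  assumes "norm u = 1"
  shows "x = (x \<bullet> u) *\<^sub>R u + (x \<bullet> rot90 u) *\<^sub>R rot90 u"
proof -
  have "u \<bullet> u = 1" using assms by (simp add: norm_eq_sqrt_inner)
  then have u: "u $ 1 * u $ 1 + u $ 2 * u $ 2 = 1" by (simp add: inner_real2)
  have "x $ 1 = x $ 1 * (u $ 1 * u $ 1 + u $ 2 * u $ 2)"
    "x $ 2 = x $ 2 * (u $ 1 * u $ 1 + u $ 2 * u $ 2)"
    unfolding u by simp_all
  then show ?thesis by (simp add: real2_eq_iff inner_real2 algebra_simps)
qed

lemma lattice_zero [simp]: "0 \<in> lattice"
  by (simp add: lattice_def)

lemma lattice_add: "x \<in> lattice \<Longrightarrow> y \<in> lattice \<Longrightarrow> x + y \<in> lattice"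
  by (simp add: lattice_def)

lemma lattice_uminus [simp]: "- x \<in> lattice \<longleftrightarrow> x \<in> lattice"
  by (simp add: lattice_def)

lemma lattice_diff: "x \<in> lattice \<Longrightarrow> y \<in> lattice \<Longrightarrow> x - y \<in> lattice"
  by (simp add: lattice_def)

lemma lattice_scaleR: "x \<in> lattice \<Longrightarrow> c \<in> \<int> \<Longrightarrow> c *\<^sub>R x \<in> lattice"
  by (simp add: lattice_def)

lemma lattice_rot90: "x \<in> lattice \<Longrightarrow> rot90 x \<in> lattice"
  by (simp add: lattice_def forall_2)

lemma lattice_inner_Ints: "x \<in> lattice \<Longrightarrow> y \<in> lattice \<Longrightarrow> x \<bullet> y \<in> \<int>"
  by (simp add: lattice_def inner_real2)

lemma countable_lattice: "countable lattice"
proof -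
  have "x \<in> (\<lambda>(a, b). vector [of_int a, of_int b]) ` UNIV" if "x \<in> lattice" for x
  proof -
    from that obtain a b where "x $ 1 = of_int a" "x $ 2 = of_int b"
      unfolding lattice_def mem_Collect_eq by (meson Ints_cases)
    then have "x = vector [of_int a, of_int b]" by (simp add: real2_eq_iff)
    then show ?thesis by auto
  qed
  then show ?thesis by (meson countable_image countableI_type countable_subset subsetI)
qed

lemma Ints_abs_less_1: "(c::real) \<in> \<int> \<Longrightarrow> \<bar>c\<bar> < 1 \<Longrightarrow> c = 0"
  using Ints_nonzero_abs_less1 by blast

section \<open>Periodic sets and change of the fundamental domain\<close>

definition periodic :: "(real^2) set \<Rightarrow> bool" where
  "periodic A \<longleftrightarrow> (\<forall>x. \<forall>\<zeta>\<in>lattice. x + \<zeta> \<in> A \<longleftrightarrow> x \<in> A)"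

definition fundamental_domain :: "(real^2) set \<Rightarrow> bool" where
  "fundamental_domain F \<longleftrightarrow> F \<in> sets borel \<and> (\<forall>x. \<exists>!\<zeta>. \<zeta> \<in> lattice \<and> x + \<zeta> \<in> F)"

lemma fundamental_domain_borel: "fundamental_domain F \<Longrightarrow> F \<in> sets borel"
  by (simp add: fundamental_domain_def)

lemma fundamental_domain_ex: "fundamental_domain F \<Longrightarrow> \<exists>\<zeta>\<in>lattice. x + \<zeta> \<in> F"
  unfolding fundamental_domain_def by blast

lemma fundamental_domain_unique:
  "fundamental_domain F \<Longrightarrow> \<zeta> \<in> lattice \<Longrightarrow> \<xi> \<in> lattice \<Longrightarrow> x + \<zeta> \<in> F \<Longrightarrow> x + \<xi> \<in> F \<Longrightarrow> \<zeta> = \<xi>"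
  unfolding fundamental_domain_def by blast

text \<open>Cut F into the pieces that a lattice vector carries into G. Translating them gives the
  pieces of G that the opposite vector carries into F, with the same measure. The measure is left
  abstract because both area and length have to be moved from the unit square to domains adapted to
  z.\<close>

lemma fundamental_domain_emeasure_eq:
  fixes M :: "(real^2) measure"
  assumes M: "sets M = sets borel"
    and inv: "\<And>B \<zeta>. B \<in> sets borel \<Longrightarrow> \<zeta> \<in> lattice \<Longrightarrow> emeasure M ((+) \<zeta> ` B) = emeasure M B"
    and B: "B \<in> sets borel" "periodic B"
    and F: "fundamental_domain F" and G: "fundamental_domain G"
  shows "emeasure M (B \<inter> F) = emeasure M (B \<inter> G)"
proof -
  define X where "X F G \<zeta> = {x \<in> B \<inter> F. x + \<zeta> \<in> G}" for F G \<zeta>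
  have meas: "X F G \<zeta> \<in> sets borel" if "fundamental_domain F" "fundamental_domain G" for F G \<zeta>
  proof -
    have [measurable]: "F \<in> sets borel" "G \<in> sets borel" "B \<in> sets borel"
      using that B by (simp_all add: fundamental_domain_borel)
    show ?thesis unfolding X_def by measurable
  qed
  have sum: "emeasure M (B \<inter> F) = (\<integral>\<^sup>+ \<zeta>. emeasure M (X F G \<zeta>) \<partial>count_space lattice)"
    if "fundamental_domain F" "fundamental_domain G" for F G
  proof -
    have "(\<Union>\<zeta>\<in>lattice. X F G \<zeta>) = B \<inter> F"
      using fundamental_domain_ex[OF that(2)] by (auto simp: X_def)
    moreover have "disjoint_family_on (X F G) lattice"
      using fundamental_domain_unique[OF that(2)] by (auto simp: X_def disjoint_family_on_def)
    ultimately show ?thesis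
      using emeasure_UN_countable[of lattice "X F G" M] countable_lattice meas[OF that] by (simp add: M)
  qed
  have tr: "emeasure M (X F G (- \<zeta>)) = emeasure M (X G F \<zeta>)" if "\<zeta> \<in> lattice" for \<zeta>
  proof -
    have Bper: "y + \<zeta> \<in> B \<longleftrightarrow> y \<in> B" for y
      using B(2) that unfolding periodic_def by blast
    have "(+) (- \<zeta>) ` S = {y. y + \<zeta> \<in> S}" for S :: "(real^2) set"
    proof (intro set_eqI iffI)
      fix y assume "y \<in> {y. y + \<zeta> \<in> S}"
      then show "y \<in> (+) (- \<zeta>) ` S" by (intro image_eqI[of _ _ "y + \<zeta>"]) simp_all
    qed (elim imageE, simp)
    then have "(+) (- \<zeta>) ` X F G (- \<zeta>) = {y. y + \<zeta> \<in> X F G (- \<zeta>)}" .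
    also have "\<dots> = X G F \<zeta>"
      by (simp add: X_def Bper conj_ac)
    finally have "(+) (- \<zeta>) ` X F G (- \<zeta>) = X G F \<zeta>" .
    moreover have "- \<zeta> \<in> lattice" using that by simp
    ultimately show ?thesis using inv[OF meas[OF F G], of "- \<zeta>" "- \<zeta>"] by (simp only:)
  qed
  have bij: "bij_betw uminus lattice lattice"
    by (rule bij_betw_byWitness[where f' = uminus]) auto
  have "emeasure M (B \<inter> F) = (\<integral>\<^sup>+ \<zeta>. emeasure M (X F G \<zeta>) \<partial>count_space lattice)"
    by (rule sum[OF F G])
  also have "\<dots> = (\<integral>\<^sup>+ \<zeta>. emeasure M (X F G (- \<zeta>)) \<partial>count_space lattice)"
    by (rule nn_integral_bij_count_space[OF bij, symmetric])
  also have "\<dots> = (\<integral>\<^sup>+ \<zeta>. emeasure M (X G F \<zeta>) \<partial>count_space lattice)"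
    by (rule nn_integral_cong) (simp add: tr)
  also have "\<dots> = emeasure M (B \<inter> G)"
    by (rule sum[OF G F, symmetric])
  finally show ?thesis .
qed

lemma borel_translation:
  assumes "B \<in> sets borel"
  shows "(+) v ` B \<in> sets (borel :: 'a::euclidean_space measure)"
proof -
  have "(+) v ` B = (\<lambda>x. x - v) -` B"
    by (auto simp: image_iff algebra_simps) (metis add.commute diff_add_cancel)
  moreover have "(\<lambda>x. x - v) -` B \<inter> space borel \<in> sets borel"
    using assms by (intro measurable_sets[where A = borel]) auto
  ultimately show ?thesis by simp
qed

lemma emeasure_lborel_translation:
  "B \<in> sets borel \<Longrightarrow> emeasure lborel ((+) v ` B) = emeasure lborel (B :: 'a::euclidean_space set)"
  using emeasure_lebesgue_affine[of 1 v B] borel_translation[of B v]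
  by (simp add: emeasure_completion add.commute[of _ v])

lemma fundamental_domain_hausdorff1_eq:
  assumes "B \<in> sets borel" "periodic B" "fundamental_domain F" "fundamental_domain G"
  shows "emeasure hausdorff1 (B \<inter> F) = emeasure hausdorff1 (B \<inter> G)"
proof (rule fundamental_domain_emeasure_eq)
  fix B :: "(real^2) set" and \<zeta> assume "B \<in> sets borel"
  then show "emeasure hausdorff1 ((+) \<zeta> ` B) = emeasure hausdorff1 B"
    by (simp add: emeasure_hausdorff1 hausdorff1_outer_translation borel_translation)
qed (simp_all add: assms)

lemma fundamental_domain_lborel_eq:
  assumes "B \<in> sets borel" "periodic B" "fundamental_domain F" "fundamental_domain G"
  shows "emeasure lborel (B \<inter> F) = emeasure lborel (B \<inter> G)"
  by (rule fundamental_domain_emeasure_eq[OF sets_lborel emeasure_lborel_translation assms])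

lemma fundamental_domain_unit_square: "fundamental_domain unit_square"
  unfolding fundamental_domain_def
proof (intro conjI allI)
  have "unit_square = {x. (0 \<le> x $ 1 \<and> x $ 1 < 1) \<and> (0 \<le> x $ 2 \<and> x $ 2 < 1)}"
    by (auto simp: unit_square_def forall_2)
  also have "\<dots> \<in> sets borel" by measurable
  finally show "unit_square \<in> sets borel" .
  fix x :: "real^2"
  show "\<exists>!\<zeta>. \<zeta> \<in> lattice \<and> x + \<zeta> \<in> unit_square"
  proof (rule ex1I[of _ "\<chi> i. - of_int \<lfloor>x $ i\<rfloor>"])
    show "(\<chi> i. - of_int \<lfloor>x $ i\<rfloor>) \<in> lattice \<and> x + (\<chi> i. - of_int \<lfloor>x $ i\<rfloor>) \<in> unit_square"
      by (auto simp: lattice_def unit_square_def) linarith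
    fix \<zeta> assume \<zeta>: "\<zeta> \<in> lattice \<and> x + \<zeta> \<in> unit_square"
    have "\<zeta> $ i = - of_int \<lfloor>x $ i\<rfloor>" for i
    proof -
      obtain k where k: "\<zeta> $ i = of_int k" using \<zeta> by (auto simp: lattice_def elim!: Ints_cases)
      have "0 \<le> x $ i + of_int k" "x $ i + of_int k < 1"
        using \<zeta> unfolding unit_square_def mem_Collect_eq vector_add_component k[symmetric] by blast+
      then have "\<lfloor>x $ i\<rfloor> = - k" by linarith
      then show ?thesis by (simp add: k)
    qed
    then show "\<zeta> = (\<chi> i. - of_int \<lfloor>x $ i\<rfloor>)" by (simp add: vec_eq_iff)
  qed
qed

text \<open>A multiple of w normalizes \<open>x \<bullet> z\<close>; then a multiple of
  \<open>rot90 z\<close> normalizes \<open>c \<bullet> x\<close> without disturbing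
  \<open>x \<bullet> z\<close>. The condition \<open>w \<bullet> z = 1\<close> says that z is
  primitive and gives uniqueness: a lattice vector orthogonal to z is an integer multiple of
  \<open>rot90 z\<close>.\<close>

lemma fundamental_domain_strip:
  fixes z w c :: "real^2"
  assumes z: "z \<in> lattice" and w: "w \<in> lattice" "w \<bullet> z = 1" and D: "0 < c \<bullet> rot90 z"
  shows "fundamental_domain {x. 0 \<le> x \<bullet> z \<and> x \<bullet> z < 1 \<and> 0 \<le> c \<bullet> x \<and> c \<bullet> x < c \<bullet> rot90 z}"
    (is "fundamental_domain ?F")
  unfolding fundamental_domain_def
proof (intro conjI allI)
  show "?F \<in> sets borel" by measurable
  fix x :: "real^2"
  let ?D = "c \<bullet> rot90 z"
  define n where "n = - real_of_int \<lfloor>x \<bullet> z\<rfloor>"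
  define m where "m = - real_of_int \<lfloor>c \<bullet> (x + n *\<^sub>R w) / ?D\<rfloor>"
  define \<zeta> where "\<zeta> = n *\<^sub>R w + m *\<^sub>R rot90 z"
  show "\<exists>!\<zeta>. \<zeta> \<in> lattice \<and> x + \<zeta> \<in> ?F"
  proof (rule ex1I[of _ \<zeta>])
    have "\<zeta> \<in> lattice"
      unfolding \<zeta>_def n_def m_def by (intro lattice_add lattice_scaleR w lattice_rot90 z) auto
    moreover have "(x + \<zeta>) \<bullet> z = x \<bullet> z + n"
      by (simp add: \<zeta>_def inner_add_left w)
    moreover have "0 \<le> x \<bullet> z + n" "x \<bullet> z + n < 1" unfolding n_def by linarith+
    moreover have "c \<bullet> (x + \<zeta>) = c \<bullet> (x + n *\<^sub>R w) + m * ?D"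
      by (simp add: \<zeta>_def inner_add_right)
    moreover have "0 \<le> c \<bullet> (x + n *\<^sub>R w) / ?D + m" "c \<bullet> (x + n *\<^sub>R w) / ?D + m < 1"
      unfolding m_def by linarith+
    then have "0 \<le> c \<bullet> (x + n *\<^sub>R w) + m * ?D" "c \<bullet> (x + n *\<^sub>R w) + m * ?D < ?D"
      using D by (simp_all add: field_simps)
    ultimately show "\<zeta> \<in> lattice \<and> x + \<zeta> \<in> ?F" by simp
    fix \<xi> assume \<xi>: "\<xi> \<in> lattice \<and> x + \<xi> \<in> ?F"
    define \<eta> where "\<eta> = \<xi> - \<zeta>"
    have \<eta>: "\<eta> \<in> lattice" using \<xi> \<open>\<zeta> \<in> lattice\<close> by (simp add: \<eta>_def lattice_diff)
    have "\<bar>\<eta> \<bullet> z\<bar> < 1"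
      using \<xi> \<open>\<zeta> \<in> lattice \<and> x + \<zeta> \<in> ?F\<close> by (simp add: \<eta>_def inner_add_left inner_diff_left abs_less_iff)
    then have 0: "\<eta> \<bullet> z = 0" by (intro Ints_abs_less_1 lattice_inner_Ints \<eta> z)
    \<comment> \<open>The coefficient is an integer, as the inner product of two lattice
      vectors.\<close>
    have "\<eta> = (\<eta> \<bullet> rot90 w) *\<^sub>R rot90 z"
    proof -
      have e1: "\<eta> $ 1 * z $ 1 + \<eta> $ 2 * z $ 2 = 0" and e2: "w $ 1 * z $ 1 + w $ 2 * z $ 2 = 1"
        using 0 w by (simp_all add: inner_real2)
      have "\<eta> $ 1 = (\<eta> $ 2 * w $ 1 - \<eta> $ 1 * w $ 2) * - z $ 2" using e1 e2 by algebra
      moreover have "\<eta> $ 2 = (\<eta> $ 2 * w $ 1 - \<eta> $ 1 * w $ 2) * z $ 1" using e1 e2 by algebra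
      ultimately show ?thesis by (simp add: real2_eq_iff inner_real2 algebra_simps)
    qed
    then have "c \<bullet> \<eta> = (\<eta> \<bullet> rot90 w) * ?D" by (metis inner_scaleR_right)
    moreover have "\<bar>c \<bullet> \<eta>\<bar> < ?D"
      using \<xi> \<open>\<zeta> \<in> lattice \<and> x + \<zeta> \<in> ?F\<close> by (simp add: \<eta>_def inner_add_right inner_diff_right abs_less_iff)
    ultimately have "\<bar>\<eta> \<bullet> rot90 w\<bar> < 1" using D by (simp add: abs_mult)
    then have "\<eta> \<bullet> rot90 w = 0" by (intro Ints_abs_less_1 lattice_inner_Ints \<eta> lattice_rot90 w)
    with \<open>\<eta> = (\<eta> \<bullet> rot90 w) *\<^sub>R rot90 z\<close> show "\<xi> = \<zeta>" by (simp add: \<eta>_def)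
  qed
qed

section \<open>Torus sets as projections of periodic sets\<close>

lemma proj_eq_iff: "proj x = proj y \<longleftrightarrow> x - y \<in> lattice"
  by (rule torus.abs_eq_iff)

lemma vimage_proj_image:
  assumes "periodic A"
  shows "proj -` proj ` A = A"
proof -
  have "x \<in> A" if "a \<in> A" "x - a \<in> lattice" for x a
    using assms that unfolding periodic_def by (metis add.commute diff_add_cancel)
  then show ?thesis by (auto simp: proj_eq_iff)
qed

lemma vimage_proj_torus_translate: "proj -` torus_translate v (proj ` A) = (+) v ` (proj -` proj ` A)"
proof (intro set_eqI iffI)
  fix y assume "y \<in> proj -` torus_translate v (proj ` A)"
  then obtain x where x: "proj x \<in> proj ` A" "y - (x + v) \<in> lattice"
    by (auto simp: torus_translate_def proj_eq_iff)
  then have "proj (y - v) = proj x" by (simp add: proj_eq_iff algebra_simps)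
  then show "y \<in> (+) v ` (proj -` proj ` A)"
    using x(1) by (intro image_eqI[of _ _ "y - v"]) auto
next
  fix y assume "y \<in> (+) v ` (proj -` proj ` A)"
  then show "y \<in> proj -` torus_translate v (proj ` A)"
    by (auto simp: torus_translate_def add.commute)
qed

lemma torus_area_proj_image:
  assumes "A \<in> sets borel" "periodic A" "fundamental_domain F"
  shows "torus_area (proj ` A) = measure lborel (A \<inter> F)"
proof -
  have "A \<inter> unit_square \<in> sets borel"
    using assms(1) fundamental_domain_borel[OF fundamental_domain_unit_square] by (rule sets.Int)
  then have "measure lebesgue (A \<inter> unit_square) = measure lborel (A \<inter> unit_square)"
    by (intro measure_completion) simp
  moreover have "measure lborel (A \<inter> unit_square) = measure lborel (A \<inter> F)"
    unfolding measure_def fundamental_domain_lborel_eq[OF assms(1,2) fundamental_domain_unit_square assms(3)] ..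
  ultimately show ?thesis
    unfolding torus_area_def vimage_proj_image[OF assms(2)] by (rule trans)
qed

subsection \<open>Continuously differentiable functions\<close>

text \<open>Continuity is asked for each fixed direction, in the same form as in
  \<open>test_field\<close>.\<close>

definition C1 :: "('a::real_normed_vector \<Rightarrow> 'b::real_normed_vector) \<Rightarrow> bool" where
  "C1 f \<longleftrightarrow> (\<exists>f'. (\<forall>x. (f has_derivative f' x) (at x)) \<and> (\<forall>v. continuous_on UNIV (\<lambda>x. f' x v)))"

lemma C1I:
  assumes "\<And>x. (f has_derivative f' x) (at x)" and "\<And>v. continuous_on UNIV (\<lambda>x. f' x v)"
  shows "C1 f"
  unfolding C1_def using assms by (intro exI[of _ f']) simp

lemma C1_continuous: "C1 f \<Longrightarrow> continuous_on S f"
  unfolding C1_def by (auto intro: has_derivative_continuous_on has_derivative_at_withinI)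

lemma C1_const: "C1 (\<lambda>x. c)"
  by (rule C1I[where f' = "\<lambda>_ _. 0"]) auto

lemma C1_bounded_linear: "bounded_linear f \<Longrightarrow> C1 f"
  by (rule C1I[where f' = "\<lambda>_. f"]) (auto intro: bounded_linear_imp_has_derivative)

lemma C1_add:
  assumes "C1 f" "C1 g" shows "C1 (\<lambda>x. f x + g x)"
proof -
  from assms obtain f' g' where f: "\<And>x. (f has_derivative f' x) (at x)" "\<And>v. continuous_on UNIV (\<lambda>x. f' x v)"
    and g: "\<And>x. (g has_derivative g' x) (at x)" "\<And>v. continuous_on UNIV (\<lambda>x. g' x v)"
    unfolding C1_def by metis
  show ?thesis
    by (rule C1I[where f' = "\<lambda>x v. f' x v + g' x v"])
      (intro has_derivative_add f continuous_on_add g)+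
qed

lemma C1_scaleR:
  assumes "C1 f" "C1 g" shows "C1 (\<lambda>x. f x *\<^sub>R g x)"
proof -
  from assms obtain f' g' where f: "\<And>x. (f has_derivative f' x) (at x)" "\<And>v. continuous_on UNIV (\<lambda>x. f' x v)"
    and g: "\<And>x. (g has_derivative g' x) (at x)" "\<And>v. continuous_on UNIV (\<lambda>x. g' x v)"
    unfolding C1_def by metis
  show ?thesis
    by (rule C1I[where f' = "\<lambda>x v. f x *\<^sub>R g' x v + f' x v *\<^sub>R g x"])
      (intro has_derivative_scaleR f continuous_intros g C1_continuous assms)+
qed

lemma C1_mult:
  fixes f g :: "'a::real_normed_vector \<Rightarrow> real"
  shows "C1 f \<Longrightarrow> C1 g \<Longrightarrow> C1 (\<lambda>x. f x * g x)"
  using C1_scaleR[of f g] by simp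

lemma C1_real_polynomial_function: "real_polynomial_function f \<Longrightarrow> C1 f"
  by (induction rule: real_polynomial_function.induct)
    (auto intro: C1_bounded_linear C1_const C1_add C1_mult)

text \<open>Squaring removes the kink of the positive part: at 0 the difference quotient is at most
  the modulus of h.\<close>

lemma DERIV_max0_power2: "((\<lambda>t. (max 0 t)\<^sup>2) has_real_derivative 2 * max 0 t) (at t)"
proof -
  consider "t < 0" | "t = 0" | "0 < t" by linarith
  then show ?thesis
  proof cases
    case 1
    have "((\<lambda>t. 0) has_real_derivative 0) (at t)" by simp
    then have "((\<lambda>t. (max 0 t)\<^sup>2) has_real_derivative 0) (at t)"
      by (rule has_field_derivative_transform_within_open[where S = "{..<0}"]) (use 1 in auto)
    then show ?thesis using 1 by simp
  next
    case 2
    have "((\<lambda>h. (max 0 h)\<^sup>2 / h) \<longlongrightarrow> 0) (at (0::real))"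
    proof (rule Lim_null_comparison)
      show "\<forall>\<^sub>F h in at 0. norm ((max 0 h)\<^sup>2 / h) \<le> \<bar>h\<bar>"
        by (rule always_eventually) (auto simp: max_def power2_eq_square)
      show "((\<lambda>h. \<bar>h\<bar>) \<longlongrightarrow> 0) (at (0::real))"
        using tendsto_rabs[OF tendsto_ident_at[of "0::real" UNIV]] by simp
    qed
    then show ?thesis using 2 by (simp add: DERIV_def)
  next
    case 3
    have "((\<lambda>t. t\<^sup>2) has_real_derivative 2 * t) (at t)"
      by (auto intro!: derivative_eq_intros)
    then have "((\<lambda>t. (max 0 t)\<^sup>2) has_real_derivative 2 * t) (at t)"
      by (rule has_field_derivative_transform_within_open[where S = "{0<..}"]) (use 3 in auto)
    then show ?thesis using 3 by simp
  qed
qed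

text \<open>Test fields need one continuous derivative, so the squared positive part of a quadratic
  polynomial serves as a cutoff; for 0 < r it is positive exactly on the open ball.\<close>

definition bump :: "'a::real_inner \<Rightarrow> real \<Rightarrow> 'a \<Rightarrow> real" where
  "bump x r y = (max 0 (r\<^sup>2 - (y - x) \<bullet> (y - x)))\<^sup>2"

lemma C1_bump: "C1 (bump x r)"
proof (rule C1I[where f' = "\<lambda>y v. - 4 * max 0 (r\<^sup>2 - (y - x) \<bullet> (y - x)) * ((y - x) \<bullet> v)"])
  fix y
  have "((\<lambda>y. r\<^sup>2 - (y - x) \<bullet> (y - x)) has_derivative (\<lambda>v. - 2 * ((y - x) \<bullet> v))) (at y)"
    by (auto intro!: derivative_eq_intros simp: inner_commute)
  from has_derivative_compose[OF this DERIV_max0_power2[unfolded has_field_derivative_def]]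
  show "(bump x r has_derivative (\<lambda>v. - 4 * max 0 (r\<^sup>2 - (y - x) \<bullet> (y - x)) * ((y - x) \<bullet> v))) (at y)"
    unfolding bump_def by (simp add: mult.assoc mult.left_commute)
next
  fix v
  show "continuous_on UNIV (\<lambda>y. - 4 * max 0 (r\<^sup>2 - (y - x) \<bullet> (y - x)) * ((y - x) \<bullet> v))"
    by (intro continuous_intros)
qed

lemma bump_nonneg [simp]: "0 \<le> bump x r y"
  by (simp add: bump_def)

lemma bump_pos_iff:
  assumes "0 < r"
  shows "0 < bump x r y \<longleftrightarrow> y \<in> ball x r"
proof -
  have "0 < bump x r y \<longleftrightarrow> 0 < r\<^sup>2 - (norm (y - x))\<^sup>2"
    by (auto simp: bump_def power2_norm_eq_inner max_def)
  also have "\<dots> \<longleftrightarrow> norm (y - x) < r"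
    using assms power_strict_mono[of "norm (y - x)" r 2] power2_less_imp_less[of "norm (y - x)" r] by auto
  finally show ?thesis by (simp add: dist_norm norm_minus_commute)
qed

lemma bump_eq_0: "0 < r \<Longrightarrow> y \<notin> ball x r \<Longrightarrow> bump x r y = 0"
  using bump_pos_iff[of r x y] bump_nonneg[of x r y] by linarith

lemma has_derivative_zero_off_support:
  assumes f: "(f has_derivative f') (at y)" and "\<And>y. y \<notin> S \<Longrightarrow> f y = 0" "closed S" "y \<notin> S"
  shows "f' = (\<lambda>v. 0)"
proof -
  have "((\<lambda>y. 0) has_derivative (\<lambda>v. 0)) (at y)" by simp
  then have "(f has_derivative (\<lambda>v. 0)) (at y)"
    by (rule has_derivative_transform_within_open[where s = "- S"]) (use assms in auto)
  then show ?thesis using f has_derivative_unique by blast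
qed

lemma integrable_compact_support:
  fixes f :: "'a::euclidean_space \<Rightarrow> 'b::euclidean_space"
  assumes "sets M = sets borel" "emeasure M (cball x r) < \<infinity>"
    and "f \<in> borel_measurable borel" "\<And>y. norm (f y) \<le> B" "\<And>y. y \<notin> cball x r \<Longrightarrow> f y = 0"
  shows "integrable M f"
proof (rule integrableI_bounded_set[where A = "cball x r" and B = B])
  show "f \<in> borel_measurable M"
    using assms(3) by (simp cong: measurable_cong_sets[OF assms(1) refl])
qed (use assms in auto)

lemma continuous_compact_support_bounded:
  fixes f :: "'a::euclidean_space \<Rightarrow> 'b::real_normed_vector"
  assumes "continuous_on UNIV f" "\<And>y. y \<notin> cball x r \<Longrightarrow> f y = 0"
  obtains B where "0 \<le> B" "\<And>y. norm (f y) \<le> B"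
proof -
  have "compact (f ` cball x r)"
    using assms(1) by (intro compact_continuous_image) (auto intro: continuous_on_subset)
  then have "bounded (f ` cball x r)"
    by (rule compact_imp_bounded)
  then obtain B where "0 < B" and "\<forall>z\<in>f ` cball x r. norm z \<le> B"
    unfolding bounded_pos by (elim exE conjE)
  then have B: "0 < B" "\<And>y. y \<in> cball x r \<Longrightarrow> norm (f y) \<le> B"
    by simp_all
  have "norm (f y) \<le> B" for y
    using B assms(2)[of y] by (cases "y \<in> cball x r") auto
  then show ?thesis by (rule that[OF less_imp_le[OF B(1)]])
qed

subsection \<open>Local structure of Gauss--Green measures\<close>

lemma test_fieldI:
  assumes T: "\<And>x. (T has_derivative T' x) (at x)" "\<And>v. continuous_on UNIV (\<lambda>x. T' x v)"
    and supp: "\<And>y. y \<notin> cball x r \<Longrightarrow> T y = 0"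
  shows "test_field T" and "divergence T y = (\<Sum>i\<in>UNIV. T' y (axis i 1) $ i)"
proof -
  have fd: "frechet_derivative T (at y) = T' y" for y
    using frechet_derivative_at[OF T(1)] by simp
  have "closure {y. T y \<noteq> 0} \<subseteq> cball x r"
    by (rule closure_minimal) (use supp in fastforce)+
  then have "compact (closure {y. T y \<noteq> 0})"
    by (meson bounded_cball bounded_subset closed_closure compact_eq_bounded_closed)
  then show "test_field T"
    unfolding test_field_def fd using T by (auto simp: differentiable_def)
  show "divergence T y = (\<Sum>i\<in>UNIV. T' y (axis i 1) $ i)"
    by (simp add: divergence_def fd)
qed

text \<open>By a change of variables, integrating f (y + t w) - f y over A amounts to integrating f
  against the indicator of A at y - t w minus that at y. This is nonnegative because A absorbs the
  translation by - t w near the support of f. Dividing by t and letting t tend to 0 gives the claim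
  for an arbitrary Borel set A with this monotonicity.\<close>

lemma integral_monotone_derivative_nonneg:
  fixes f :: "'a::euclidean_space \<Rightarrow> real"
  assumes f: "\<And>x. (f has_derivative f' x) (at x)" "\<And>v. continuous_on UNIV (\<lambda>x. f' x v)"
    and A: "A \<in> sets borel"
    and nonneg: "\<And>y. 0 \<le> f y" and supp: "\<And>y. y \<notin> cball x s \<Longrightarrow> f y = 0" and "s < r"
    and mono: "\<And>y t. y \<in> ball x r \<Longrightarrow> 0 \<le> t \<Longrightarrow> y \<in> A \<Longrightarrow> y - t *\<^sub>R w \<in> ball x r \<Longrightarrow> y - t *\<^sub>R w \<in> A"
  shows "0 \<le> (LINT y:A|lebesgue. f' y w)"
proof -
  have contf: "continuous_on UNIV f"
    using f(1) by (auto intro: has_derivative_continuous_on has_derivative_at_withinI)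
  have [measurable]: "f \<in> borel_measurable borel" "(\<lambda>y. f' y w) \<in> borel_measurable borel"
    using contf f(2) by (auto intro: borel_measurable_continuous_onI)
  have [measurable]: "A \<in> sets borel" by (rule A)
  have supp': "f' y w = 0" if "y \<notin> cball x s" for y
    using has_derivative_zero_off_support[OF f(1) supp _ that] by (simp add: fun_eq_iff)
  obtain B where B: "0 \<le> B" "\<And>y. norm (f' y w) \<le> B"
    using continuous_compact_support_bounded[OF f(2) supp'] by metis
  obtain Bf where Bf: "0 \<le> Bf" "\<And>y. norm (f y) \<le> Bf"
    using continuous_compact_support_bounded[OF contf supp] by metis
  \<comment> \<open>Displacements shorter than r - s keep the support inside
    \<open>ball x r\<close>; the 1 in the denominator covers w = 0.\<close>
  obtain \<eta> where \<eta>: "0 < \<eta>" "\<eta> * norm w \<le> r - s"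
  proof
    show "0 < (r - s) / (norm w + 1)" using \<open>s < r\<close> by (simp add: add_nonneg_pos)
    have "norm w / (norm w + 1) \<le> 1" by (simp add: add_nonneg_pos)
    then have "(r - s) * (norm w / (norm w + 1)) \<le> (r - s) * 1"
      using \<open>s < r\<close> by (intro mult_left_mono) auto
    then show "(r - s) / (norm w + 1) * norm w \<le> r - s" by simp
  qed
  \<comment> \<open>The offset 2 makes every step strictly smaller than \<eta>.\<close>
  define t where "t n = \<eta> / real (n + 2)" for n
  have t: "0 < t n" "t n * norm w < r - s" for n
  proof -
    show "0 < t n" using \<eta> by (simp add: t_def)
    have "t n < \<eta>" using \<eta>(1) by (simp add: t_def divide_less_eq)
    then show "t n * norm w < r - s"
      using \<eta> \<open>s < r\<close> by (cases "w = 0") (auto intro: less_le_trans[OF mult_strict_right_mono])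
  qed
  have t0: "t \<longlonglongrightarrow> 0"
    unfolding t_def using LIMSEQ_ignore_initial_segment[OF lim_const_over_n[of \<eta>], of 2] .
  define Q where "Q n y = indicator A y * ((f (y + t n *\<^sub>R w) - f y) / t n)" for n y
  have int_f: "integrable lborel f"
    by (rule integrable_compact_support[OF sets_lborel emeasure_lborel_cball_finite _ Bf(2) supp]) simp
  have int_ft: "integrable lborel (\<lambda>y. f (y + t n *\<^sub>R w))" for n
    using int_f lborel_distr_plus[of "t n *\<^sub>R w"]
      integrable_distr_eq[of "(+) (t n *\<^sub>R w)" lborel borel f]
    by (simp add: add.commute)
  have "0 \<le> (\<integral>y. Q n y \<partial>lborel)" for n
  proof -
    have i1: "integrable lborel (\<lambda>y. indicator A y * f (y + t n *\<^sub>R w))"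
      and i2: "integrable lborel (\<lambda>y. indicator A y * f y)"
      using integrable_mult_indicator[OF _ int_ft, of A] integrable_mult_indicator[OF _ int_f, of A] by simp_all
    have "(\<integral>y. indicator A y * f (y + t n *\<^sub>R w) \<partial>lborel)
        = (\<integral>y. indicator A (y - t n *\<^sub>R w) * f y \<partial>lborel)"
    proof -
      have "(\<integral>y. indicator A (y - t n *\<^sub>R w) * f y \<partial>lborel)
          = (\<integral>y. indicator A (y - t n *\<^sub>R w) * f y \<partial>distr lborel borel ((+) (t n *\<^sub>R w)))"
        by (simp add: lborel_distr_plus)
      also have "\<dots> = (\<integral>y. indicator A (t n *\<^sub>R w + y - t n *\<^sub>R w) * f (t n *\<^sub>R w + y) \<partial>lborel)"
        by (rule integral_distr) measurable
      finally show ?thesis by (simp add: add.commute)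
    qed
    moreover have "(\<integral>y. indicator A y * f y \<partial>lborel) \<le> (\<integral>y. indicator A (y - t n *\<^sub>R w) * f y \<partial>lborel)"
    proof (rule integral_mono)
      have "integrable lborel (\<lambda>y. indicator A (y - t n *\<^sub>R w) * f y)"
      proof (rule Bochner_Integration.integrable_bound[OF int_f])
        show "AE y in lborel. norm (indicator A (y - t n *\<^sub>R w) * f y) \<le> norm (f y)"
          by (auto simp: indicator_def)
      qed measurable
      then show "integrable lborel (\<lambda>y. indicator A (y - t n *\<^sub>R w) * f y)" .
      fix y
      show "indicator A y * f y \<le> indicator A (y - t n *\<^sub>R w) * f y"
      proof (cases "y \<in> A \<and> f y \<noteq> 0")
        case True
        then have "y \<in> cball x s" using supp by blast
        moreover have "dist x (y - t n *\<^sub>R w) \<le> dist x y + t n * norm w"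
          using norm_triangle_ineq[of "x - y" "t n *\<^sub>R w"] t(1)[of n] by (simp add: dist_norm algebra_simps)
        ultimately have "y \<in> ball x r" "y - t n *\<^sub>R w \<in> ball x r"
          using t(2)[of n] \<open>s < r\<close> by auto
        then have "y - t n *\<^sub>R w \<in> A" using mono[of y "t n"] True t(1)[of n] by auto
        then show ?thesis using True by simp
      qed (use nonneg in \<open>auto simp: indicator_def\<close>)
    qed (rule i2)
    ultimately have "0 \<le> (\<integral>y. indicator A y * f (y + t n *\<^sub>R w) \<partial>lborel) - (\<integral>y. indicator A y * f y \<partial>lborel)"
      by simp
    also have "\<dots> = (\<integral>y. indicator A y * f (y + t n *\<^sub>R w) - indicator A y * f y \<partial>lborel)"
      using i1 i2 by simp
    also have "\<dots> = t n * (\<integral>y. Q n y \<partial>lborel)"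
    proof -
      have "indicator A y * f (y + t n *\<^sub>R w) - indicator A y * f y = t n * Q n y" for y
        using t(1)[of n] by (simp add: Q_def field_simps)
      then show ?thesis by simp
    qed
    finally show ?thesis using t(1)[of n] by (simp add: zero_le_mult_iff)
  qed
  moreover have "(\<lambda>n. \<integral>y. Q n y \<partial>lborel) \<longlonglongrightarrow> (\<integral>y. indicator A y * f' y w \<partial>lborel)"
  proof (rule integral_dominated_convergence[where w = "\<lambda>y. indicator (cball x r) y * B"])
    show "integrable lborel (\<lambda>y. indicator (cball x r) y * B)"
      by (intro integrable_mult_left integrable_real_indicator emeasure_lborel_cball_finite) simp
    show "AE y in lborel. (\<lambda>n. Q n y) \<longlonglongrightarrow> indicator A y * f' y w"
    proof (rule AE_I2)
      fix y
      have "((\<lambda>\<tau>. f (y + \<tau> *\<^sub>R w)) has_real_derivative f' y w) (at 0)"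
      proof -
        have "((\<lambda>\<tau>. y + \<tau> *\<^sub>R w) has_derivative (\<lambda>\<tau>. \<tau> *\<^sub>R w)) (at 0)"
          by (auto intro!: derivative_eq_intros)
        from has_derivative_compose[OF this, of f "f' y"] f(1)[of y]
        have "((\<lambda>\<tau>. f (y + \<tau> *\<^sub>R w)) has_derivative (\<lambda>\<tau>. f' y (\<tau> *\<^sub>R w))) (at 0)" by simp
        moreover have "f' y (\<tau> *\<^sub>R w) = f' y w * \<tau>" for \<tau>
          using f(1)[of y] by (simp add: linear_cmul has_derivative_linear)
        ultimately show ?thesis by (simp add: has_field_derivative_def)
      qed
      then have "((\<lambda>h. (f (y + h *\<^sub>R w) - f y) / h) \<longlongrightarrow> f' y w) (at 0)"
        by (simp add: DERIV_def)
      moreover have "filterlim t (at 0) sequentially"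
        using t0 t(1) by (auto simp: filterlim_at less_imp_neq[symmetric])
      ultimately have "(\<lambda>n. (f (y + t n *\<^sub>R w) - f y) / t n) \<longlonglongrightarrow> f' y w"
        by (rule filterlim_compose)
      then show "(\<lambda>n. Q n y) \<longlonglongrightarrow> indicator A y * f' y w"
        unfolding Q_def by (intro tendsto_intros)
    qed
    fix n
    show "AE y in lborel. norm (Q n y) \<le> indicator (cball x r) y * B"
    proof (rule AE_I2)
      fix y
      show "norm (Q n y) \<le> indicator (cball x r) y * B"
      proof (cases "y \<in> cball x r")
        case True
        \<comment> \<open>The mean value theorem bounds all difference quotients by the bound B of
          the derivative; this supplies the dominating function.\<close>
        have "\<exists>z>0. z < t n \<and> f (y + t n *\<^sub>R w) - f (y + 0 *\<^sub>R w) = (t n - 0) * f' (y + z *\<^sub>R w) w"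
        proof (rule MVT2)
          fix \<tau>
          have "((\<lambda>\<tau>. y + \<tau> *\<^sub>R w) has_derivative (\<lambda>\<tau>. \<tau> *\<^sub>R w)) (at \<tau>)"
            by (auto intro!: derivative_eq_intros)
          from has_derivative_compose[OF this f(1)]
          have "((\<lambda>\<tau>. f (y + \<tau> *\<^sub>R w)) has_derivative (\<lambda>h. f' (y + \<tau> *\<^sub>R w) (h *\<^sub>R w))) (at \<tau>)" .
          moreover have "f' (y + \<tau> *\<^sub>R w) (h *\<^sub>R w) = f' (y + \<tau> *\<^sub>R w) w * h" for h
            using f(1)[of "y + \<tau> *\<^sub>R w"] by (simp add: linear_cmul has_derivative_linear)
          ultimately show "((\<lambda>\<tau>. f (y + \<tau> *\<^sub>R w)) has_real_derivative f' (y + \<tau> *\<^sub>R w) w) (at \<tau>)"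
            by (simp add: has_field_derivative_def)
        qed (rule t)
        then obtain z where z: "f (y + t n *\<^sub>R w) - f y = t n * f' (y + z *\<^sub>R w) w" by auto
        have "norm (Q n y) \<le> norm (f' (y + z *\<^sub>R w) w)"
          using t(1)[of n] by (auto simp: Q_def z indicator_def)
        then show ?thesis using B(2)[of "y + z *\<^sub>R w"] True by simp
      next
        case False
        have "dist x y \<le> dist x (y + t n *\<^sub>R w) + t n * norm w"
          using norm_triangle_ineq[of "x - (y + t n *\<^sub>R w)" "t n *\<^sub>R w"] t(1)[of n] by (simp add: dist_norm)
        then have "y \<notin> cball x s" "y + t n *\<^sub>R w \<notin> cball x s"
          using False t(2)[of n] \<open>s < r\<close> by auto
        then show ?thesis using False by (simp add: Q_def supp)
      qed
    qed
  qed (unfold Q_def, measurable)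
  ultimately have "0 \<le> (\<integral>y. indicator A y * f' y w \<partial>lborel)"
    by (intro LIMSEQ_le_const) auto
  also have "\<dots> = (LINT y:A|lebesgue. f' y w)"
    unfolding set_lebesgue_integral_def by (subst integral_completion) auto
  finally show ?thesis .
qed

lemma gauss_green_measurable:
  assumes "is_gauss_green A \<mu> \<sigma>"
  shows "sets \<mu> = sets borel" "space \<mu> = UNIV" "\<sigma> \<in> borel_measurable borel"
    "AE x in \<mu>. norm (\<sigma> x) = 1" "emeasure \<mu> (cball x r) < \<infinity>"
  using assms sets_eq_imp_space_eq[of \<mu> borel] by (simp_all add: is_gauss_green_def)

text \<open>The field f w has divergence \<open>f' y w\<close>, so the vector identity becomes one
  for directional derivatives of scalar functions.\<close>

lemma gauss_green_test_scalar:
  fixes w :: "real^2"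
  assumes gg: "is_gauss_green A \<mu> \<sigma>"
    and f: "\<And>x. (f has_derivative f' x) (at x)" "\<And>v. continuous_on UNIV (\<lambda>x. f' x v)"
    and supp: "\<And>y. y \<notin> cball x s \<Longrightarrow> f y = 0"
  shows "(LINT y:A|lebesgue. f' y w) = (LINT y|\<mu>. f y * (w \<bullet> \<sigma> y))"
proof -
  define T where "T y = f y *\<^sub>R w" for y
  have T: "(T has_derivative (\<lambda>v. f' y v *\<^sub>R w)) (at y)" for y
    unfolding T_def by (rule has_derivative_scaleR_left[OF f(1)])
  have T_cont: "continuous_on UNIV (\<lambda>y. f' y v *\<^sub>R w)" for v
    by (intro continuous_intros f)
  have T_supp: "y \<notin> cball x s \<Longrightarrow> T y = 0" for y
    using supp by (simp add: T_def)
  have "divergence T = (\<lambda>y. f' y w)"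
  proof
    fix y
    have lin: "linear (f' y)" using f(1) has_derivative_linear by blast
    have "divergence T y = (\<Sum>i\<in>UNIV. f' y (axis i 1) * w $ i)"
      using test_fieldI(2)[of T "\<lambda>y v. f' y v *\<^sub>R w", OF T T_cont T_supp] by simp
    also have "\<dots> = f' y (\<Sum>i\<in>UNIV. w $ i *\<^sub>R axis i 1)"
      by (simp add: linear_sum[OF lin] linear_cmul[OF lin] mult.commute)
    also have "(\<Sum>i\<in>UNIV. w $ i *\<^sub>R axis i 1) = w"
      using basis_expansion[of w] by (simp add: scalar_mult_eq_scaleR)
    finally show "divergence T y = f' y w" .
  qed
  moreover have "test_field T"
    by (rule test_fieldI(1)[of T "\<lambda>y v. f' y v *\<^sub>R w", OF T T_cont T_supp])
  moreover have "T y \<bullet> \<sigma> y = f y * (w \<bullet> \<sigma> y)" for y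
    by (simp add: T_def)
  moreover have "(LINT y:A|lebesgue. divergence T y) = (LINT y|\<mu>. T y \<bullet> \<sigma> y)" if "test_field T"
    using gg that unfolding is_gauss_green_def by blast
  ultimately show ?thesis by simp
qed

text \<open>Compare the measures whose densities are the positive and the negative part of q. The
  second is at most the first on open sets, and the first vanishes where q < 0. Outer regularity of
  the first then forces the second to vanish there too.\<close>

lemma AE_nonneg_of_open_integrals:
  fixes M :: "'a::euclidean_space measure" and q :: "'a \<Rightarrow> real"
  assumes M: "sets M = sets borel" and q: "integrable M q"
    and pos: "\<And>U. open U \<Longrightarrow> 0 \<le> (\<integral>x. indicator U x * q x \<partial>M)"
  shows "AE x in M. 0 \<le> q x"
proof -
  have space: "space M = UNIV" using sets_eq_imp_space_eq[OF M] by simp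
  have [measurable]: "q \<in> borel_measurable M" using q by auto
  have [simp]: "S \<in> sets M \<longleftrightarrow> S \<in> sets borel" for S by (simp add: M)
  define Np where "Np = density M (\<lambda>x. ennreal (max 0 (q x)))"
  define Nm where "Nm = density M (\<lambda>x. ennreal (max 0 (- q x)))"
  have ip: "integrable M (\<lambda>x. max 0 (q x))" and im: "integrable M (\<lambda>x. max 0 (- q x))"
    using q by (auto intro!: integrable_max)
  have eN: "emeasure Np S = ennreal (\<integral>x. indicator S x * max 0 (q x) \<partial>M)"
    "emeasure Nm S = ennreal (\<integral>x. indicator S x * max 0 (- q x) \<partial>M)" if "S \<in> sets borel" for S
  proof -
    have "integrable M (\<lambda>x. indicator S x * max 0 (q x))" "integrable M (\<lambda>x. indicator S x * max 0 (- q x))"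
      using integrable_mult_indicator[OF _ ip, of S] integrable_mult_indicator[OF _ im, of S] that by simp_all
    moreover have "ennreal (max 0 a) * indicator S x = ennreal (indicator S x * max 0 a)" for x a
      by (auto simp: indicator_def)
    ultimately show "emeasure Np S = ennreal (\<integral>x. indicator S x * max 0 (q x) \<partial>M)"
      "emeasure Nm S = ennreal (\<integral>x. indicator S x * max 0 (- q x) \<partial>M)"
      using that by (simp_all add: Np_def Nm_def emeasure_density nn_integral_eq_integral)
  qed
  have le: "emeasure Nm U \<le> emeasure Np U" if "open U" for U
  proof -
    have "integrable M (\<lambda>x. indicator U x * max 0 (q x))" "integrable M (\<lambda>x. indicator U x * max 0 (- q x))"
      using integrable_mult_indicator[OF _ ip, of U] integrable_mult_indicator[OF _ im, of U] that by simp_all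
    then have "(\<integral>x. indicator U x * max 0 (q x) \<partial>M) - (\<integral>x. indicator U x * max 0 (- q x) \<partial>M)
        = (\<integral>x. indicator U x * max 0 (q x) - indicator U x * max 0 (- q x) \<partial>M)"
      by simp
    also have "\<dots> = (\<integral>x. indicator U x * q x \<partial>M)"
      by (rule Bochner_Integration.integral_cong) (auto simp: indicator_def max_def)
    finally show ?thesis
      using pos[OF that] that by (simp add: eN ennreal_leI)
  qed
  have B: "{x. q x < 0} \<in> sets borel"
  proof -
    have "{x \<in> space M. q x < 0} \<in> sets M" by measurable
    then show ?thesis by (simp add: space)
  qed
  have "sets Np = sets borel" "emeasure Np (space Np) \<noteq> \<infinity>"
    using eN(1)[of UNIV] by (simp_all add: Np_def M space)
  note reg = outer_regular[OF this B]
  have "emeasure Np {x. q x < 0} = ennreal (\<integral>x. 0 \<partial>M)"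
    unfolding eN(1)[OF B] by (intro arg_cong[of _ _ ennreal] Bochner_Integration.integral_cong)
      (auto simp: indicator_def)
  then have "(INF U \<in> {U. {x. q x < 0} \<subseteq> U \<and> open U}. emeasure Np U) = 0"
    using reg by simp
  moreover have "emeasure Nm {x. q x < 0} \<le> (INF U \<in> {U. {x. q x < 0} \<subseteq> U \<and> open U}. emeasure Np U)"
  proof (rule INF_greatest)
    fix U assume U: "U \<in> {U. {x. q x < 0} \<subseteq> U \<and> open U}"
    then have "emeasure Nm {x. q x < 0} \<le> emeasure Nm U"
      by (intro emeasure_mono) (auto simp: Nm_def)
    then show "emeasure Nm {x. q x < 0} \<le> emeasure Np U"
      using le[of U] U by auto
  qed
  ultimately have "{x. q x < 0} \<in> null_sets Nm"
    using B by (auto simp: null_sets_def Nm_def)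
  then have "AE x in Nm. x \<notin> {x. q x < 0}"
    by (rule AE_not_in)
  then have "AE x in M. 0 < ennreal (max 0 (- q x)) \<longrightarrow> x \<notin> {x. q x < 0}"
    unfolding Nm_def by (subst (asm) AE_density) auto
  then show ?thesis
    by eventually_elim (auto simp: max_def not_less split: if_splits)
qed

text \<open>Polynomials multiplied by a bump function are admissible test functions, and by Weierstrass
  they approximate every continuous function on the ball.\<close>

lemma gauss_green_monotone:
  fixes w :: "real^2"
  assumes gg: "is_gauss_green A \<mu> \<sigma>" and A: "A \<in> sets borel" and s: "0 < s" "s < r"
    and mono: "\<And>y t. y \<in> ball x r \<Longrightarrow> 0 \<le> t \<Longrightarrow> y \<in> A \<Longrightarrow> y - t *\<^sub>R w \<in> ball x r \<Longrightarrow> y - t *\<^sub>R w \<in> A"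
  shows "AE y in \<mu>. y \<in> ball x s \<longrightarrow> 0 \<le> w \<bullet> \<sigma> y"
proof -
  note [measurable] = gauss_green_measurable(3)[OF gg]
  have M: "sets \<mu> = sets borel" and space: "space \<mu> = UNIV" and cb: "emeasure \<mu> (cball x s) < \<infinity>"
    and n1: "AE x in \<mu>. norm (\<sigma> x) = 1"
    using gauss_green_measurable[OF gg] by auto
  have meas: "f \<in> borel_measurable borel \<Longrightarrow> f \<in> borel_measurable \<mu>" for f :: "real^2 \<Rightarrow> real"
    by (simp cong: measurable_cong_sets[OF M refl])
  have bmeas [measurable]: "bump x s \<in> borel_measurable borel"
    by (intro borel_measurable_continuous_onI C1_continuous C1_bump)
  have bump0: "y \<notin> cball x s \<Longrightarrow> bump x s y = 0" for y
    using bump_eq_0[OF s(1), of y x] by simp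
  obtain Bb where Bb: "0 \<le> Bb" "\<And>y. norm (bump x s y) \<le> Bb"
    using continuous_compact_support_bounded[OF C1_continuous[OF C1_bump] bump0] by metis
  have int: "integrable \<mu> (\<lambda>y. bump x s y * F y * (w \<bullet> \<sigma> y))"
    if [measurable]: "F \<in> borel_measurable borel" and C: "\<And>y. y \<in> cball x s \<Longrightarrow> \<bar>F y\<bar> \<le> C" for F C
  proof -
    \<comment> \<open>\<open>\<sigma>\<close> is normalized only almost everywhere; cutting it off
      elsewhere makes the integrand bounded at every point.\<close>
    have "integrable \<mu> (\<lambda>y. bump x s y * F y * (if norm (\<sigma> y) = 1 then w \<bullet> \<sigma> y else 0))"
    proof (rule integrable_compact_support[OF M cb])
      fix y
      have "0 \<le> C" using C[of x] s by auto
      have "\<bar>if norm (\<sigma> y) = 1 then w \<bullet> \<sigma> y else 0\<bar> \<le> norm w"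
        using Cauchy_Schwarz_ineq2[of w "\<sigma> y"] by auto
      moreover have "\<bar>bump x s y * F y\<bar> \<le> Bb * C"
        using Bb(2)[of y] Bb(1) C[of y] bump0[of y] \<open>0 \<le> C\<close>
        by (cases "y \<in> cball x s") (auto simp: abs_mult intro!: mult_mono)
      ultimately show "norm (bump x s y * F y * (if norm (\<sigma> y) = 1 then w \<bullet> \<sigma> y else 0)) \<le> Bb * C * norm w"
        using Bb(1) \<open>0 \<le> C\<close> unfolding real_norm_def abs_mult[of "bump x s y * F y"] by (intro mult_mono) auto
    qed (auto simp: bump0)
    moreover have "AE y in \<mu>. bump x s y * F y * (if norm (\<sigma> y) = 1 then w \<bullet> \<sigma> y else 0)
        = bump x s y * F y * (w \<bullet> \<sigma> y)"
      using n1 by eventually_elim simp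
    ultimately show ?thesis
      by (subst (asm) integrable_cong_AE) (auto intro!: meas)
  qed
  \<comment> \<open>A polynomial within \<epsilon> of a nonnegative function may drop below 0 by up
    to \<epsilon>, so it is raised by that amount.\<close>
  have poly: "0 \<le> (\<integral>y. bump x s y * (g y + \<epsilon>) * (w \<bullet> \<sigma> y) \<partial>\<mu>)"
    if g: "real_polynomial_function g" and nonneg: "\<And>y. y \<in> cball x s \<Longrightarrow> 0 \<le> g y + \<epsilon>" for g \<epsilon>
  proof -
    have "C1 (\<lambda>y. bump x s y * (g y + \<epsilon>))"
      by (intro C1_mult C1_bump C1_add C1_const C1_real_polynomial_function g)
    then obtain f' where f': "\<And>y. ((\<lambda>y. bump x s y * (g y + \<epsilon>)) has_derivative f' y) (at y)"
        "\<And>v. continuous_on UNIV (\<lambda>y. f' y v)"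
      unfolding C1_def by metis
    have supp: "y \<notin> cball x s \<Longrightarrow> bump x s y * (g y + \<epsilon>) = 0" for y
      using bump0 by simp
    have nn: "0 \<le> bump x s y * (g y + \<epsilon>)" for y
      using nonneg[of y] supp[of y] by (cases "y \<in> cball x s") auto
    have "0 \<le> (LINT y:A|lebesgue. f' y w)"
      using mono by (intro integral_monotone_derivative_nonneg[OF f' A nn supp s(2)])
    then show ?thesis
      using gauss_green_test_scalar[OF gg f' supp] by simp
  qed
  have cont: "0 \<le> (\<integral>y. bump x s y * F y * (w \<bullet> \<sigma> y) \<partial>\<mu>)"
    if F: "continuous_on UNIV F" "\<And>y. 0 \<le> F y" "\<And>y. F y \<le> 1" for F
  proof (rule field_le_epsilon)
    have [measurable]: "F \<in> borel_measurable borel" using F by (intro borel_measurable_continuous_onI)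
    define C where "C = (\<integral>y. \<bar>bump x s y * 1 * (w \<bullet> \<sigma> y)\<bar> \<partial>\<mu>)"
    have C0: "0 \<le> C" by (simp add: C_def)
    fix e :: real assume "0 < e"
    \<comment> \<open>Approximating and raising together cost at most 2 * \<epsilon> * C. The
      summand 1 covers C = 0, and the cap 1 on \<epsilon> keeps the raised polynomials bounded by 3
      on the ball.\<close>
    define \<epsilon> where "\<epsilon> = min 1 (e / (2 * (C + 1)))"
    have \<epsilon>: "0 < \<epsilon>" "\<epsilon> \<le> 1" "2 * \<epsilon> * C \<le> e"
    proof -
      show "0 < \<epsilon>" "\<epsilon> \<le> 1" using \<open>0 < e\<close> C0 by (auto simp: \<epsilon>_def)
      have "2 * \<epsilon> * C \<le> 2 * (e / (2 * (C + 1))) * C"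
        using C0 by (intro mult_right_mono) (auto simp: \<epsilon>_def)
      also have "\<dots> = e * (C / (C + 1))" using C0 by (simp add: field_simps)
      also have "\<dots> \<le> e * 1" using \<open>0 < e\<close> C0 by (intro mult_left_mono) auto
      finally show "2 * \<epsilon> * C \<le> e" by simp
    qed
    obtain g where g: "real_polynomial_function g" "\<And>y. y \<in> cball x s \<Longrightarrow> \<bar>F y - g y\<bar> < \<epsilon>"
      using Stone_Weierstrass_real_polynomial_function[OF compact_cball continuous_on_subset[OF F(1) subset_UNIV] \<epsilon>(1)]
      by metis
    have [measurable]: "g \<in> borel_measurable borel"
      using g(1) by (intro borel_measurable_continuous_onI C1_continuous C1_real_polynomial_function)
    have i1: "integrable \<mu> (\<lambda>y. bump x s y * F y * (w \<bullet> \<sigma> y))"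
      by (rule int[where C = 1]) (use F in \<open>auto simp: abs_le_iff intro: order_trans[of _ 0]\<close>)
    have i2: "integrable \<mu> (\<lambda>y. bump x s y * (g y + \<epsilon>) * (w \<bullet> \<sigma> y))"
    proof (rule int[where C = 3])
      fix y assume "y \<in> cball x s"
      then show "\<bar>g y + \<epsilon>\<bar> \<le> 3" using g(2)[of y] F(2,3)[of y] \<epsilon>(1,2) by linarith
    qed measurable
    have i3: "integrable \<mu> (\<lambda>y. \<bar>bump x s y * 1 * (w \<bullet> \<sigma> y)\<bar>)"
      by (rule integrable_abs[OF int[where C = 1]]) auto
    have "0 \<le> (\<integral>y. bump x s y * (g y + \<epsilon>) * (w \<bullet> \<sigma> y) \<partial>\<mu>)"
      using g(2) F(2) by (intro poly g(1)) (smt (verit))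
    also have "\<dots> \<le> (\<integral>y. bump x s y * F y * (w \<bullet> \<sigma> y) + 2 * \<epsilon> * \<bar>bump x s y * 1 * (w \<bullet> \<sigma> y)\<bar> \<partial>\<mu>)"
    proof (rule integral_mono[OF i2])
      fix y
      show "bump x s y * (g y + \<epsilon>) * (w \<bullet> \<sigma> y) \<le> bump x s y * F y * (w \<bullet> \<sigma> y) + 2 * \<epsilon> * \<bar>bump x s y * 1 * (w \<bullet> \<sigma> y)\<bar>"
      proof (cases "y \<in> cball x s")
        case True
        have "\<bar>g y + \<epsilon> - F y\<bar> \<le> 2 * \<epsilon>" using g(2)[OF True] by linarith
        then have "\<bar>g y + \<epsilon> - F y\<bar> * \<bar>bump x s y * (w \<bullet> \<sigma> y)\<bar> \<le> 2 * \<epsilon> * \<bar>bump x s y * (w \<bullet> \<sigma> y)\<bar>"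
          by (intro mult_right_mono) simp_all
        moreover have "(g y + \<epsilon> - F y) * (bump x s y * (w \<bullet> \<sigma> y)) \<le> \<bar>g y + \<epsilon> - F y\<bar> * \<bar>bump x s y * (w \<bullet> \<sigma> y)\<bar>"
          unfolding abs_mult[symmetric] by (rule abs_ge_self)
        ultimately have "(g y + \<epsilon> - F y) * (bump x s y * (w \<bullet> \<sigma> y)) \<le> 2 * \<epsilon> * \<bar>bump x s y * (w \<bullet> \<sigma> y)\<bar>"
          by linarith
        then show ?thesis by (simp add: algebra_simps)
      qed (use bump0 in simp)
    qed (use i1 i3 in simp)
    also have "\<dots> = (\<integral>y. bump x s y * F y * (w \<bullet> \<sigma> y) \<partial>\<mu>) + 2 * \<epsilon> * C"
      using i1 i3 by (simp add: C_def)
    also have "\<dots> \<le> (\<integral>y. bump x s y * F y * (w \<bullet> \<sigma> y) \<partial>\<mu>) + e"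
      using \<epsilon>(3) by simp
    finally show "0 \<le> (\<integral>y. bump x s y * F y * (w \<bullet> \<sigma> y) \<partial>\<mu>) + e" .
  qed
  have "AE y in \<mu>. 0 \<le> bump x s y * 1 * (w \<bullet> \<sigma> y)"
  proof (rule AE_nonneg_of_open_integrals[OF M])
    show q: "integrable \<mu> (\<lambda>y. bump x s y * 1 * (w \<bullet> \<sigma> y))"
      by (rule int[where C = 1]) auto
    fix U :: "(real^2) set" assume "open U"
    show "0 \<le> (\<integral>y. indicator U y * (bump x s y * 1 * (w \<bullet> \<sigma> y)) \<partial>\<mu>)"
    \<comment> \<open>The indicator of U is approximated through the distance to the complement.
      When the complement is empty, \<open>infdist\<close> is 0 by convention and this would
      fail.\<close>
    proof (cases "U = UNIV")
      case True
      then show ?thesis using cont[of "\<lambda>_. 1"] by simp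
    next
      case False
      define F where "F k y = min 1 (real k * infdist y (- U))" for k :: nat and y
      have Fc: "continuous_on UNIV (F k)" for k
        unfolding F_def by (intro continuous_intros)
      have F01: "0 \<le> F k y" "F k y \<le> 1" for k y
        by (auto simp: F_def infdist_nonneg)
      have [measurable]: "F k \<in> borel_measurable borel" for k
        using Fc by (intro borel_measurable_continuous_onI)
      have lim: "(\<lambda>k. F k y) \<longlonglongrightarrow> indicator U y" for y
      proof (cases "y \<in> U")
        case True
        then have "0 < infdist y (- U)"
          using \<open>open U\<close> False by (intro infdist_pos_not_in_closed) auto
        then obtain N :: nat where "1 / infdist y (- U) < N" using reals_Archimedean2 by blast
        then have N: "1 < N * infdist y (- U)" using \<open>0 < infdist y (- U)\<close> by (simp add: divide_less_eq)
        have "F k y = 1" if "N \<le> k" for k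
        proof -
          have "real N * infdist y (- U) \<le> real k * infdist y (- U)"
            using that by (intro mult_right_mono) (auto simp: infdist_nonneg)
          then show ?thesis using N by (simp add: F_def)
        qed
        then have "\<forall>\<^sub>F k in sequentially. F k y = 1" by (auto simp: eventually_sequentially)
        then show ?thesis using True by (simp add: tendsto_eventually)
      qed (simp add: F_def)
      have "(\<lambda>k. \<integral>y. bump x s y * F k y * (w \<bullet> \<sigma> y) \<partial>\<mu>) \<longlonglongrightarrow>
          (\<integral>y. indicator U y * (bump x s y * 1 * (w \<bullet> \<sigma> y)) \<partial>\<mu>)"
      proof (rule integral_dominated_convergence[where w = "\<lambda>y. \<bar>bump x s y * 1 * (w \<bullet> \<sigma> y)\<bar>"])
        show "AE y in \<mu>. (\<lambda>k. bump x s y * F k y * (w \<bullet> \<sigma> y)) \<longlonglongrightarrow> indicator U y * (bump x s y * 1 * (w \<bullet> \<sigma> y))"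
        proof (rule AE_I2)
          fix y
          have "(\<lambda>k. F k y * (bump x s y * 1 * (w \<bullet> \<sigma> y))) \<longlonglongrightarrow> indicator U y * (bump x s y * 1 * (w \<bullet> \<sigma> y))"
            by (intro tendsto_mult lim tendsto_const)
          then show "(\<lambda>k. bump x s y * F k y * (w \<bullet> \<sigma> y)) \<longlonglongrightarrow> indicator U y * (bump x s y * 1 * (w \<bullet> \<sigma> y))"
            by (simp add: mult_ac)
        qed
        fix k
        show "AE y in \<mu>. norm (bump x s y * F k y * (w \<bullet> \<sigma> y)) \<le> \<bar>bump x s y * 1 * (w \<bullet> \<sigma> y)\<bar>"
        proof (rule AE_I2)
          fix y
          have "F k y * \<bar>bump x s y * (w \<bullet> \<sigma> y)\<bar> \<le> 1 * \<bar>bump x s y * (w \<bullet> \<sigma> y)\<bar>"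
            using F01 by (intro mult_right_mono) auto
          then show "norm (bump x s y * F k y * (w \<bullet> \<sigma> y)) \<le> \<bar>bump x s y * 1 * (w \<bullet> \<sigma> y)\<bar>"
            using F01(1)[of k y] by (simp add: abs_mult mult_ac)
        qed
      next
        show "(\<lambda>y. indicator U y * (bump x s y * 1 * (w \<bullet> \<sigma> y))) \<in> borel_measurable \<mu>"
          using \<open>open U\<close> by (intro meas) measurable
        show "(\<lambda>y. bump x s y * F k y * (w \<bullet> \<sigma> y)) \<in> borel_measurable \<mu>" for k
          by (intro meas) measurable
      qed (rule integrable_abs[OF q])
      then show ?thesis
        using cont[OF Fc F01] by (intro LIMSEQ_le_const) auto
    qed
  qed
  then show ?thesis
  proof eventually_elim
    case (elim y)
    show ?case
    proof
      assume "y \<in> ball x s"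
      then have "0 < bump x s y" using bump_pos_iff[OF s(1), of x y] by simp
      then show "0 \<le> w \<bullet> \<sigma> y" using elim by (simp add: zero_le_mult_iff)
    qed
  qed
qed

text \<open>On such a ball A is monotone in all four axis directions, so \<open>\<sigma>\<close>
  vanishes almost everywhere there; having norm 1 almost everywhere, it leaves no mass on the
  smaller ball.\<close>

lemma gauss_green_locally_trivial:
  assumes gg: "is_gauss_green A \<mu> \<sigma>" and A: "A \<in> sets borel" and s: "0 < s" "s < r"
    and triv: "ball x r \<subseteq> A \<or> ball x r \<inter> A = {}"
  shows "emeasure \<mu> (ball x s) = 0"
proof -
  have "AE y in \<mu>. y \<in> ball x s \<longrightarrow> 0 \<le> w \<bullet> \<sigma> y" for w
    by (rule gauss_green_monotone[OF gg A s]) (use triv in auto)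
  from this[of "axis 1 1"] this[of "- axis 1 1"] this[of "axis 2 1"] this[of "- axis 2 1"]
    gauss_green_measurable(4)[OF gg]
  have "AE y in \<mu>. y \<notin> ball x s"
  proof eventually_elim
    case (elim y)
    show ?case
    proof
      assume "y \<in> ball x s"
      with elim have "\<sigma> y = 0" by (simp add: real2_eq_iff inner_axis' antisym)
      with elim show False by simp
    qed
  qed
  moreover have "ball x s \<in> sets \<mu>" using gauss_green_measurable(1)[OF gg] by simp
  ultimately show ?thesis
    using AE_iff_null_sets[of "ball x s" \<mu>] by auto
qed

text \<open>A half-plane is monotone in every direction w with \<open>0 \<le> w \<bullet> n\<close>.
  The directions n, \<open>rot90 n\<close> and \<open>- rot90 n\<close> leave only the unit vector
  n.\<close>

lemma gauss_green_halfplane: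
  assumes gg: "is_gauss_green A \<mu> \<sigma>" and A: "A \<in> sets borel" and s: "0 < s" "s < r"
    and n: "norm n = 1" and half: "\<And>y. y \<in> ball x r \<Longrightarrow> y \<in> A \<longleftrightarrow> y \<bullet> n \<le> c"
  shows "AE y in \<mu>. y \<in> ball x s \<longrightarrow> \<sigma> y = n"
proof -
  have *: "AE y in \<mu>. y \<in> ball x s \<longrightarrow> 0 \<le> w \<bullet> \<sigma> y" if w: "0 \<le> w \<bullet> n" for w
  proof (rule gauss_green_monotone[OF gg A s])
    fix y t assume "y \<in> ball x r" "0 \<le> (t::real)" "y \<in> A" "y - t *\<^sub>R w \<in> ball x r"
    moreover from this have "0 \<le> t * (w \<bullet> n)" "y \<bullet> n \<le> c" using w half by auto
    ultimately show "y - t *\<^sub>R w \<in> A" using half by (simp add: inner_diff_left)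
  qed
  have "AE y in \<mu>. y \<in> ball x s \<longrightarrow> 0 \<le> n \<bullet> \<sigma> y"
    "AE y in \<mu>. y \<in> ball x s \<longrightarrow> 0 \<le> rot90 n \<bullet> \<sigma> y"
    "AE y in \<mu>. y \<in> ball x s \<longrightarrow> 0 \<le> - rot90 n \<bullet> \<sigma> y"
    by (rule *; simp)+
  then show ?thesis using gauss_green_measurable(4)[OF gg]
  proof eventually_elim
    case (elim y)
    show ?case
    proof
      assume "y \<in> ball x s"
      with elim have a: "0 \<le> \<sigma> y \<bullet> n" "\<sigma> y \<bullet> rot90 n = 0" by (simp_all add: inner_commute)
      then have "\<sigma> y = (\<sigma> y \<bullet> n) *\<^sub>R n" using real2_decomp[OF n, of "\<sigma> y"] by simp
      moreover from this have "norm (\<sigma> y) = \<bar>\<sigma> y \<bullet> n\<bar>" using n by (metis mult.right_neutral norm_scaleR)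
      ultimately show "\<sigma> y = n" using elim(4) a by simp
    qed
  qed
qed

section \<open>Consequences for the reduced boundary and its normals\<close>

lemma not_outer_normal_at_trivial:
  assumes "A \<in> sets borel" "0 < r" "ball x r \<subseteq> A \<or> ball x r \<inter> A = {}"
  shows "\<not> outer_normal_at A x \<nu>"
proof
  assume "outer_normal_at A x \<nu>"
  then obtain \<mu> \<sigma> where "is_gauss_green A \<mu> \<sigma>" "\<forall>r>0. emeasure \<mu> (ball x r) > 0"
    unfolding outer_normal_at_def by blast
  moreover from this have "emeasure \<mu> (ball x (r/2)) = 0"
    using assms by (intro gauss_green_locally_trivial[of A \<mu> \<sigma> "r/2" r x]) auto
  moreover have "0 < r / 2" using assms by simp
  ultimately show False by (metis less_irrefl)
qed

text \<open>For radii below r the field equals n almost everywhere on the ball, so the averages are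
  constant near 0.\<close>

lemma gauss_green_average_halfplane:
  assumes gg: "is_gauss_green A \<mu> \<sigma>" and A: "A \<in> sets borel" and r: "0 < r"
    and n: "norm n = 1" and half: "\<And>y. y \<in> ball x r \<Longrightarrow> y \<in> A \<longleftrightarrow> y \<bullet> n \<le> c"
    and pos: "\<And>t. 0 < t \<Longrightarrow> 0 < emeasure \<mu> (ball x t)"
  shows "((\<lambda>t. (LINT y:ball x t|\<mu>. \<sigma> y) /\<^sub>R measure \<mu> (ball x t)) \<longlongrightarrow> n) (at_right 0)"
proof (rule tendsto_eventually)
  have "\<forall>\<^sub>F t in at_right 0. t \<in> {0<..<r}"
    using r by (intro eventually_at_right_real)
  then show "\<forall>\<^sub>F t in at_right 0. (LINT y:ball x t|\<mu>. \<sigma> y) /\<^sub>R measure \<mu> (ball x t) = n"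
  proof eventually_elim
    case (elim t)
    note M = gauss_green_measurable[OF gg]
    have fin: "emeasure \<mu> (ball x t) < \<infinity>"
      by (rule le_less_trans[OF emeasure_mono[OF ball_subset_cball] M(5)]) (simp add: M(1))
    have "(LINT y:ball x t|\<mu>. \<sigma> y) = (LINT y|\<mu>. indicator (ball x t) y *\<^sub>R n)"
      unfolding set_lebesgue_integral_def
    proof (rule integral_cong_AE)
      have "AE y in \<mu>. y \<in> ball x t \<longrightarrow> \<sigma> y = n"
        using elim by (intro gauss_green_halfplane[OF gg A _ _ n half]) auto
      then show "AE y in \<mu>. indicator (ball x t) y *\<^sub>R \<sigma> y = indicator (ball x t) y *\<^sub>R n"
        by eventually_elim (auto simp: indicator_def)
      have [measurable]: "\<sigma> \<in> borel_measurable \<mu>" "ball x t \<in> sets \<mu>"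
        using M(1,3) by (simp_all cong: measurable_cong_sets[OF M(1) refl])
      show "(\<lambda>y. indicator (ball x t) y *\<^sub>R \<sigma> y) \<in> borel_measurable \<mu>"
        "(\<lambda>y. indicator (ball x t) y *\<^sub>R n) \<in> borel_measurable \<mu>" by measurable
    qed
    also have "\<dots> = measure \<mu> (ball x t) *\<^sub>R n"
      using fin M(1,2) by simp
    finally have "(LINT y:ball x t|\<mu>. \<sigma> y) = measure \<mu> (ball x t) *\<^sub>R n" .
    moreover have "0 < measure \<mu> (ball x t)"
      using pos[of t] fin elim by (simp add: measure_def enn2real_positive_iff)
    ultimately show ?case by simp
  qed
qed

text \<open>\<open>outer_normal_at\<close> chooses its Gauss--Green pair existentially, but the
  averages of every pair that charges all balls around x tend to n.\<close>

lemma outer_normal_at_halfplane_unique: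
  assumes "A \<in> sets borel" "0 < r" "norm n = 1" "\<And>y. y \<in> ball x r \<Longrightarrow> y \<in> A \<longleftrightarrow> y \<bullet> n \<le> c"
    and "outer_normal_at A x \<nu>"
  shows "\<nu> = n"
proof -
  from assms(5) obtain \<mu> \<sigma> where gg: "is_gauss_green A \<mu> \<sigma>" "\<And>r. r > 0 \<Longrightarrow> emeasure \<mu> (ball x r) > 0"
    and lim: "((\<lambda>r. (LINT y:ball x r|\<mu>. \<sigma> y) /\<^sub>R measure \<mu> (ball x r)) \<longlongrightarrow> \<nu>) (at_right 0)"
    unfolding outer_normal_at_def by blast
  have "((\<lambda>r. (LINT y:ball x r|\<mu>. \<sigma> y) /\<^sub>R measure \<mu> (ball x r)) \<longlongrightarrow> n) (at_right 0)"
    by (rule gauss_green_average_halfplane[OF gg(1) assms(1-4) gg(2)])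
  with lim show ?thesis
    by (intro tendsto_unique[of "at_right (0::real)"]) auto
qed

lemma outer_normal_at_halfplane:
  assumes "is_gauss_green A \<mu> \<sigma>" "\<And>r. 0 < r \<Longrightarrow> 0 < emeasure \<mu> (ball x r)"
    and "A \<in> sets borel" "0 < r" "norm n = 1" "\<And>y. y \<in> ball x r \<Longrightarrow> y \<in> A \<longleftrightarrow> y \<bullet> n \<le> c"
  shows "outer_normal_at A x n"
  unfolding outer_normal_at_def
  using assms(1,2,5) gauss_green_average_halfplane[OF assms(1,3,4,5,6,2)] by blast

lemma outer_normal_halfplane:
  assumes "A \<in> sets borel" "0 < r" "norm n = 1" "\<And>y. y \<in> ball x r \<Longrightarrow> y \<in> A \<longleftrightarrow> y \<bullet> n \<le> c"
    and "x \<in> reduced_boundary A"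
  shows "outer_normal A x = n"
proof -
  obtain \<nu> where \<nu>: "outer_normal_at A x \<nu>"
    using assms(5) by (auto simp: reduced_boundary_def)
  then have "outer_normal_at A x n"
    using outer_normal_at_halfplane_unique[OF assms(1-4) \<nu>] by simp
  then show ?thesis
    unfolding outer_normal_def by (rule the_equality) (rule outer_normal_at_halfplane_unique[OF assms(1-4)])
qed

subsection \<open>Fubini in rotated coordinates\<close>

lemma prod_Basis_real2: "(\<Prod>b\<in>(Basis :: (real^2) set). f b) = f (axis 1 1) * f (axis 2 1)"
proof -
  have B: "(Basis :: (real^2) set) = {axis 1 1, axis 2 1}"
    by (auto simp: Basis_vec_def UNIV_2)
  have "axis 1 (1::real) \<noteq> (axis 2 1 :: real^2)"
    by (simp add: axis_eq_axis)
  then show ?thesis unfolding B by simp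
qed

lemma lborel_real2_eq:
  "lborel = distr (lborel \<Otimes>\<^sub>M lborel) borel (\<lambda>(a::real, b::real). vector [a, b] :: real^2)"
proof (rule lborel_eqI)
  have eq: "(\<lambda>(a, b). vector [a, b] :: real^2) = (\<lambda>p. fst p *\<^sub>R axis 1 1 + snd p *\<^sub>R axis 2 1)"
    by (auto simp: fun_eq_iff real2_eq_iff axis_def)
  have m: "(\<lambda>(a, b). vector [a, b] :: real^2) \<in> borel_measurable (lborel \<Otimes>\<^sub>M lborel)"
    unfolding eq by measurable
  fix l u :: "real^2" assume le: "\<And>b. b \<in> Basis \<Longrightarrow> l \<bullet> b \<le> u \<bullet> b"
  have "l \<bullet> axis 1 1 \<le> u \<bullet> axis 1 1" "l \<bullet> axis 2 1 \<le> u \<bullet> axis 2 1"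
    by (rule le; simp add: axis_in_Basis_iff)+
  then have lu: "l $ 1 \<le> u $ 1" "l $ 2 \<le> u $ 2" by (simp_all add: inner_axis)
  have "(\<lambda>(a, b). vector [a, b] :: real^2) -` box l u \<inter> space (lborel \<Otimes>\<^sub>M lborel)
      = {l $ 1<..<u $ 1} \<times> {l $ 2<..<u $ 2}"
    by (auto simp: space_pair_measure mem_box_cart forall_2)
  then have "emeasure (distr (lborel \<Otimes>\<^sub>M lborel) borel (\<lambda>(a, b). vector [a, b] :: real^2)) (box l u)
      = emeasure (lborel \<Otimes>\<^sub>M lborel) ({l $ 1<..<u $ 1} \<times> {l $ 2<..<u $ 2})"
    by (subst emeasure_distr[OF m]) simp_all
  also have "\<dots> = ennreal (u $ 1 - l $ 1) * ennreal (u $ 2 - l $ 2)"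
    using lu by (subst lborel.emeasure_pair_measure_Times) simp_all
  also have "\<dots> = ennreal (\<Prod>b\<in>Basis. (u - l) \<bullet> b)"
    using lu by (simp add: prod_Basis_real2 inner_axis ennreal_mult)
  finally show "emeasure (distr (lborel \<Otimes>\<^sub>M lborel) borel (\<lambda>(a, b). vector [a, b])) (box l u)
      = ennreal (\<Prod>b\<in>Basis. (u - l) \<bullet> b)" .
qed simp

lemma lborel_orthogonal_image:
  fixes f :: "real^'n::{finite,wellorder} \<Rightarrow> real^'n::_"
  assumes f: "orthogonal_transformation f"
  shows "distr lborel borel f = lborel"
proof (rule lborel_eqI[symmetric])
  obtain g where g: "orthogonal_transformation g" "\<And>x. f (g x) = x" "\<And>x. g (f x) = x"
    using orthogonal_transformation_bij[OF f] orthogonal_transformation_inv[OF f]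
    by (metis bij_inv_eq_iff)
  have m: "f \<in> borel_measurable lborel"
    using orthogonal_transformation_linear[OF f]
    by (simp add: borel_measurable_continuous_onI linear_continuous_on linear_conv_bounded_linear)
  fix l u :: "real^'n::{finite,wellorder}" assume le: "\<And>b. b \<in> Basis \<Longrightarrow> l \<bullet> b \<le> u \<bullet> b"
  have vim: "f -` box l u = g ` box l u"
    using g by (auto simp: image_iff) metis
  have lm: "g ` box l u \<in> lmeasurable"
    by (rule measurable_orthogonal_image[OF g(1)]) simp
  have "f -` box l u \<in> sets borel"
    using measurable_sets[OF m, of "box l u"] by simp
  then have "emeasure (distr lborel borel f) (box l u) = emeasure lebesgue (g ` box l u)"
    by (subst emeasure_distr[OF m]) (simp_all add: vim)
  also have "\<dots> = ennreal (measure lebesgue (g ` box l u))"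
    by (rule emeasure_eq_measure2[OF lm])
  also have "measure lebesgue (g ` box l u) = measure lebesgue (box l u)"
    by (rule measure_orthogonal_image[OF g(1)]) simp
  also have "ennreal (measure lebesgue (box l u)) = ennreal (\<Prod>b\<in>Basis. (u - l) \<bullet> b)"
    using le by (simp add: measure_completion measure_lborel_box_eq)
  finally show "emeasure (distr lborel borel f) (box l u) = ennreal (\<Prod>b\<in>Basis. (u - l) \<bullet> b)" .
qed simp

lemma lborel_rotated:
  assumes "norm u = 1"
  shows "lborel = distr (lborel \<Otimes>\<^sub>M lborel) borel (\<lambda>p. fst p *\<^sub>R u + snd p *\<^sub>R rot90 u)"
proof -
  define f where "f x = x $ 1 *\<^sub>R u + x $ 2 *\<^sub>R rot90 u" for x :: "real^2"
  have uu: "u \<bullet> u = 1" "rot90 u \<bullet> rot90 u = 1" using assms by (simp_all add: norm_eq_sqrt_inner)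
  have lin: "linear f"
    by (rule linearI) (simp_all add: f_def algebra_simps)
  have "f v \<bullet> f w = v \<bullet> w" for v w
    by (simp add: f_def inner_add_left inner_add_right uu inner_real2[of v w])
  then have f: "orthogonal_transformation f"
    using lin by (simp add: orthogonal_transformation_def)
  have eq: "(\<lambda>(a, b). vector [a, b] :: real^2) = (\<lambda>p. fst p *\<^sub>R axis 1 1 + snd p *\<^sub>R axis 2 1)"
    by (auto simp: fun_eq_iff real2_eq_iff axis_def)
  have m: "(\<lambda>(a, b). vector [a, b] :: real^2) \<in> borel_measurable (lborel \<Otimes>\<^sub>M lborel)"
    unfolding eq by measurable
  have fm: "f \<in> borel_measurable borel"
    using lin by (simp add: borel_measurable_continuous_onI linear_continuous_on linear_conv_bounded_linear)
  have "(lborel :: (real^2) measure) = distr lborel borel f"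
    by (rule lborel_orthogonal_image[OF f, symmetric])
  also have "\<dots> = distr (distr (lborel \<Otimes>\<^sub>M lborel) borel (\<lambda>(a, b). vector [a, b])) borel f"
    by (subst lborel_real2_eq) simp
  also have "\<dots> = distr (lborel \<Otimes>\<^sub>M lborel) borel (f \<circ> (\<lambda>(a, b). vector [a, b]))"
    by (rule distr_distr[OF fm m])
  also have "f \<circ> (\<lambda>(a, b). vector [a, b]) = (\<lambda>p. fst p *\<^sub>R u + snd p *\<^sub>R rot90 u)"
    by (auto simp: fun_eq_iff f_def)
  finally show ?thesis .
qed

lemma lborel_integral_rotated:
  fixes g :: "real^2 \<Rightarrow> real"
  assumes u: "norm u = 1" and g: "integrable lborel g"
  shows "(\<integral>x. g x \<partial>lborel) = (\<integral>a. (\<integral>b. g (a *\<^sub>R u + b *\<^sub>R rot90 u) \<partial>lborel) \<partial>lborel)"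
    and "(\<integral>x. g x \<partial>lborel) = (\<integral>b. (\<integral>a. g (a *\<^sub>R u + b *\<^sub>R rot90 u) \<partial>lborel) \<partial>lborel)"
    and "integrable lborel (\<lambda>b. \<integral>a. g (a *\<^sub>R u + b *\<^sub>R rot90 u) \<partial>lborel)"
proof -
  let ?h = "\<lambda>p. fst p *\<^sub>R u + snd p *\<^sub>R rot90 u"
  have m: "?h \<in> borel_measurable (lborel \<Otimes>\<^sub>M lborel)" by measurable
  have gm: "g \<in> borel_measurable borel" using g by auto
  have "(\<integral>x. g x \<partial>lborel) = (\<integral>x. g x \<partial>distr (lborel \<Otimes>\<^sub>M lborel) borel ?h)"
    by (subst lborel_rotated[OF u]) simp
  also have "\<dots> = (\<integral>p. g (?h p) \<partial>(lborel \<Otimes>\<^sub>M lborel))"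
    by (rule integral_distr[OF m gm])
  finally have eq: "(\<integral>x. g x \<partial>lborel) = (\<integral>p. g (?h p) \<partial>(lborel \<Otimes>\<^sub>M lborel))" .
  have "integrable (distr (lborel \<Otimes>\<^sub>M lborel) borel ?h) g"
    using g by (subst (asm) lborel_rotated[OF u])
  then have i: "integrable (lborel \<Otimes>\<^sub>M lborel) (\<lambda>p. g (?h p))"
    by (subst (asm) integrable_distr_eq[OF m gm])
  then have i': "integrable (lborel \<Otimes>\<^sub>M lborel) (\<lambda>(a, b). g (a *\<^sub>R u + b *\<^sub>R rot90 u))"
    by (simp add: case_prod_beta')
  show "(\<integral>x. g x \<partial>lborel) = (\<integral>a. (\<integral>b. g (a *\<^sub>R u + b *\<^sub>R rot90 u) \<partial>lborel) \<partial>lborel)"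
    using lborel_pair.integral_fst'[OF i] eq by simp
  show "(\<integral>x. g x \<partial>lborel) = (\<integral>b. (\<integral>a. g (a *\<^sub>R u + b *\<^sub>R rot90 u) \<partial>lborel) \<partial>lborel)"
    using lborel_pair.integral_snd[OF i'] eq by (simp add: case_prod_beta')
  show "integrable lborel (\<lambda>b. \<integral>a. g (a *\<^sub>R u + b *\<^sub>R rot90 u) \<partial>lborel)"
    by (rule lborel_pair.integrable_snd[OF i'])
qed

text \<open>Shows where compactly supported fields vanish: if one rotated coordinate exceeds R in
  modulus, the point lies outside \<open>cball 0 R\<close>.\<close>

lemma norm_rotated_ge:
  assumes "norm u = 1"
  shows "\<bar>a\<bar> \<le> norm (a *\<^sub>R u + b *\<^sub>R rot90 u)" "\<bar>b\<bar> \<le> norm (a *\<^sub>R u + b *\<^sub>R rot90 u)"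
proof -
  have uu: "u \<bullet> u = 1" "rot90 u \<bullet> rot90 u = 1" using assms by (simp_all add: norm_eq_sqrt_inner)
  show "\<bar>a\<bar> \<le> norm (a *\<^sub>R u + b *\<^sub>R rot90 u)"
    using Cauchy_Schwarz_ineq2[of "a *\<^sub>R u + b *\<^sub>R rot90 u" u] assms by (simp add: inner_add_left uu)
  show "\<bar>b\<bar> \<le> norm (a *\<^sub>R u + b *\<^sub>R rot90 u)"
    using Cauchy_Schwarz_ineq2[of "a *\<^sub>R u + b *\<^sub>R rot90 u" "rot90 u"] assms by (simp add: inner_add_left uu)
qed

section \<open>Derivatives of test fields in rotated coordinates\<close>

lemma test_field_derivative:
  assumes "test_field T"
  shows "(T has_derivative frechet_derivative T (at x)) (at x)"
    and "continuous_on UNIV (\<lambda>x. frechet_derivative T (at x) v)"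
  using assms frechet_derivative_works by (auto simp: test_field_def)

text \<open>The divergence is the trace of the derivative, which can be computed in any orthonormal
  basis.\<close>

lemma divergence_rotated:
  assumes "test_field T" and u: "norm u = 1"
  shows "divergence T x = frechet_derivative T (at x) u \<bullet> u + frechet_derivative T (at x) (rot90 u) \<bullet> rot90 u"
proof -
  let ?D = "frechet_derivative T (at x)"
  have lin: "linear ?D" using test_field_derivative(1)[OF assms(1)] has_derivative_linear by blast
  have D: "?D v = v $ 1 *\<^sub>R ?D (axis 1 1) + v $ 2 *\<^sub>R ?D (axis 2 1)" for v
  proof -
    have "v = v $ 1 *\<^sub>R axis 1 1 + v $ 2 *\<^sub>R axis 2 1" by (simp add: real2_eq_iff axis_def)
    from arg_cong[OF this, of ?D] show ?thesis
      by (simp only: linear_add[OF lin] linear_cmul[OF lin])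
  qed
  have "u \<bullet> u = 1" using u by (simp add: norm_eq_sqrt_inner)
  then have uu: "u $ 1 * u $ 1 + u $ 2 * u $ 2 = 1" by (simp add: inner_real2)
  have "?D u \<bullet> u + ?D (rot90 u) \<bullet> rot90 u
      = (u $ 1 * u $ 1 + u $ 2 * u $ 2) * (?D (axis 1 1) $ 1 + ?D (axis 2 1) $ 2)"
    unfolding D[of u] D[of "rot90 u"] by (simp add: inner_real2 algebra_simps)
  then show ?thesis by (simp add: uu divergence_def sum_2)
qed

lemma has_real_derivative_along_line:
  assumes "(T has_derivative T') (at (p + t *\<^sub>R v))"
  shows "((\<lambda>t. T (p + t *\<^sub>R v) \<bullet> w) has_real_derivative T' v \<bullet> w) (at t)"
proof -
  have "((\<lambda>t. p + t *\<^sub>R v) has_derivative (\<lambda>h. h *\<^sub>R v)) (at t)"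
    by (auto intro!: derivative_eq_intros)
  from has_derivative_compose[OF this assms]
  have "((\<lambda>t. T (p + t *\<^sub>R v) \<bullet> w) has_derivative (\<lambda>h. T' (h *\<^sub>R v) \<bullet> w)) (at t)"
    by (rule has_derivative_inner_left)
  moreover have "T' (h *\<^sub>R v) \<bullet> w = T' v \<bullet> w * h" for h
    using has_derivative_linear[OF assms] by (simp add: linear_cmul)
  ultimately show ?thesis by (simp add: has_field_derivative_def)
qed

subsection \<open>Finite unions of convex sets have finite perimeter\<close>

text \<open>A bounded convex subset of the line is an interval up to its endpoints, so the integral
  is a difference of two values of F.\<close>

lemma integral_derivative_convex_le:
  fixes F f :: "real \<Rightarrow> real"
  assumes F: "\<And>t. (F has_real_derivative f t) (at t)" and f: "continuous_on UNIV f"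
    and supp: "\<And>t. R < \<bar>t\<bar> \<Longrightarrow> f t = 0" and F1: "\<And>t. \<bar>F t\<bar> \<le> 1"
    and S: "convex S"
  shows "\<bar>\<integral>t. indicator S t * f t \<partial>lborel\<bar> \<le> 2"
proof -
  define I where "I = S \<inter> {-R..R}"
  have eq: "indicator S t * f t = indicator I t * f t" for t
    using supp[of t] by (cases "R < \<bar>t\<bar>") (auto simp: I_def indicator_def)
  show ?thesis
  proof (cases "I = {}")
    case False
    define p where "p = Inf I"
    define q where "q = Sup I"
    have bd: "bdd_below I" "bdd_above I"
      by (auto simp: I_def intro!: bdd_belowI[of _ "-R"] bdd_aboveI[of _ R])
    have sub: "t \<in> I \<Longrightarrow> p \<le> t \<and> t \<le> q" for t
      using bd by (auto simp: p_def q_def intro: cInf_lower cSup_upper)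
    have "convex I" unfolding I_def using S by (intro convex_Int) auto
    have sup: "t \<in> I" if t: "p < t" "t < q" for t
    proof -
      obtain a b where "a \<in> I" "a < t" "b \<in> I" "t < b"
        using t bd False by (auto simp: p_def q_def cInf_less_iff less_cSup_iff)
      then show ?thesis
        using \<open>convex I\<close> unfolding is_interval_convex_1[symmetric] is_interval_1
        by (meson less_imp_le)
    qed
    have "p \<le> q" using False sub by (meson all_not_in_conv order_trans)
    have "(\<integral>t. indicator S t * f t \<partial>lborel) = (\<integral>t. indicator I t * f t \<partial>lborel)"
      by (simp add: eq)
    also have "\<dots> = (\<integral>t. f t * indicator {p..q} t \<partial>lborel)"
    proof (rule integral_cong_AE)
      have "AE t in lborel. t \<noteq> p" "AE t in lborel. t \<noteq> q" by (rule AE_lborel_singleton)+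
      then show "AE t in lborel. indicator I t * f t = f t * indicator {p..q} t"
      proof eventually_elim
        case (elim t)
        then show ?case using sub[of t] sup[of t] by (auto simp: indicator_def)
      qed
      have [measurable]: "f \<in> borel_measurable borel" using f by (rule borel_measurable_continuous_onI)
      have [measurable]: "I \<in> sets borel"
        using \<open>convex I\<close> by (simp add: is_interval_convex_1 real_interval_borel_measurable)
      show "(\<lambda>t. indicator I t * f t) \<in> borel_measurable lborel"
        "(\<lambda>t. f t * indicator {p..q} t) \<in> borel_measurable lborel" by measurable
    qed
    also have "\<dots> = F q - F p"
      using \<open>p \<le> q\<close> F f
      by (intro integral_FTC_Icc_real) (auto simp: continuous_on_eq_continuous_at)
    finally show ?thesis using F1[of p] F1[of q] by linarith
  qed (simp add: eq)
qed

lemma divergence_support: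
  assumes T: "test_field T" and supp: "{x. T x \<noteq> 0} \<subseteq> cball 0 R" and x: "x \<notin> cball 0 R"
  shows "frechet_derivative T (at x) v = 0"
proof -
  have "y \<notin> cball 0 R \<Longrightarrow> T y = 0" for y using supp by blast
  from has_derivative_zero_off_support[OF test_field_derivative(1)[OF T] this closed_cball x]
  show ?thesis by simp
qed

lemma integrable_test_derivative:
  assumes T: "test_field T" and supp: "{x. T x \<noteq> 0} \<subseteq> cball 0 R"
    and A: "A \<in> sets borel"
  shows "integrable lborel (\<lambda>x. indicator A x * (frechet_derivative T (at x) v \<bullet> w))"
proof -
  let ?g = "\<lambda>x. frechet_derivative T (at x) v \<bullet> w"
  have c: "continuous_on UNIV ?g"
    by (intro continuous_intros test_field_derivative(2)[OF T])
  have z: "x \<notin> cball 0 R \<Longrightarrow> ?g x = 0" for x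
    using divergence_support[OF T supp, of x v] by simp
  obtain B where "\<And>x. norm (?g x) \<le> B"
    using continuous_compact_support_bounded[OF c z] by metis
  then have "integrable lborel ?g"
    using borel_measurable_continuous_onI[OF c] z
    by (intro integrable_compact_support[OF sets_lborel emeasure_lborel_cball_finite[of 0 R]])
  then show ?thesis using integrable_mult_indicator[of A lborel ?g] A by simp
qed

lemma set_integral_divergence:
  assumes T: "test_field T" and supp: "{x. T x \<noteq> 0} \<subseteq> cball 0 R"
    and A: "A \<in> sets borel" and u: "norm u = 1"
  shows "(LINT x:A|lebesgue. divergence T x)
      = (\<integral>x. indicator A x * (frechet_derivative T (at x) u \<bullet> u) \<partial>lborel)
        + (\<integral>x. indicator A x * (frechet_derivative T (at x) (rot90 u) \<bullet> rot90 u) \<partial>lborel)"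
proof -
  have i: "integrable lborel (\<lambda>x. indicator A x * (frechet_derivative T (at x) v \<bullet> w))" for v w
    by (rule integrable_test_derivative[OF T supp A])
  have "(LINT x:A|lebesgue. divergence T x)
      = (\<integral>x. indicator A x * (frechet_derivative T (at x) u \<bullet> u)
          + indicator A x * (frechet_derivative T (at x) (rot90 u) \<bullet> rot90 u) \<partial>lebesgue)"
    unfolding set_lebesgue_integral_def divergence_rotated[OF T u] by (simp add: distrib_left)
  also have "\<dots> = (\<integral>x. indicator A x * (frechet_derivative T (at x) u \<bullet> u)
          + indicator A x * (frechet_derivative T (at x) (rot90 u) \<bullet> rot90 u) \<partial>lborel)"
    using i by (intro integral_completion borel_measurable_add) auto
  finally show ?thesis using i by simp
qed

text \<open>Lines parallel to a unit vector u meet S in intervals, each contributing at most 2, and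
  only lines at distance at most R from the origin contribute. This gives 2 * 2 * R for each of two
  orthogonal directions.\<close>

lemma integral_divergence_convex_le:
  assumes T: "test_field T" and supp: "{x. T x \<noteq> 0} \<subseteq> cball 0 R" and R: "0 \<le> R"
    and T1: "\<forall>x. norm (T x) \<le> 1" and S: "S \<in> sets borel" "convex S"
  shows "\<bar>LINT x:S|lebesgue. divergence T x\<bar> \<le> 8 * R"
proof -
  have line: "\<bar>\<integral>x. indicator S x * (frechet_derivative T (at x) u \<bullet> u) \<partial>lborel\<bar> \<le> 4 * R"
    if u: "norm u = 1" for u
  proof -
    let ?D = "\<lambda>x. frechet_derivative T (at x) u \<bullet> u"
    define J where "J b = (\<integral>a. indicator S (a *\<^sub>R u + b *\<^sub>R rot90 u) * ?D (a *\<^sub>R u + b *\<^sub>R rot90 u) \<partial>lborel)" for b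
    have i: "integrable lborel (\<lambda>x. indicator S x * ?D x)"
      by (rule integrable_test_derivative[OF T supp S(1)])
    have Jle: "\<bar>J b\<bar> \<le> 2" for b
    proof -
      define p where "p = b *\<^sub>R rot90 u"
      have "\<bar>\<integral>a. indicator {a. p + a *\<^sub>R u \<in> S} a * ?D (p + a *\<^sub>R u) \<partial>lborel\<bar> \<le> 2"
      proof (rule integral_derivative_convex_le[where F = "\<lambda>a. T (p + a *\<^sub>R u) \<bullet> u" and R = R])
        show "((\<lambda>a. T (p + a *\<^sub>R u) \<bullet> u) has_real_derivative ?D (p + a *\<^sub>R u)) (at a)" for a
          by (rule has_real_derivative_along_line[OF test_field_derivative(1)[OF T]])
        show "continuous_on UNIV (\<lambda>a. ?D (p + a *\<^sub>R u))"
          by (intro continuous_intros continuous_on_compose2[OF test_field_derivative(2)[OF T]]) auto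
        show "?D (p + a *\<^sub>R u) = 0" if "R < \<bar>a\<bar>" for a
          using norm_rotated_ge(1)[OF u, of a b] that divergence_support[OF T supp, of "p + a *\<^sub>R u" u]
          by (simp add: p_def add.commute)
        show "\<bar>T (p + a *\<^sub>R u) \<bullet> u\<bar> \<le> 1" for a
          using Cauchy_Schwarz_ineq2[of "T (p + a *\<^sub>R u)" u] T1[rule_format, of "p + a *\<^sub>R u"] u by simp
        show "convex {a. p + a *\<^sub>R u \<in> S}"
        proof (rule convexI, clarsimp)
          fix x y s t :: real assume "p + x *\<^sub>R u \<in> S" "p + y *\<^sub>R u \<in> S" "0 \<le> s" "0 \<le> t" "s + t = 1"
          then have "s *\<^sub>R (p + x *\<^sub>R u) + t *\<^sub>R (p + y *\<^sub>R u) \<in> S" by (rule convexD[OF S(2)])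
          moreover have "s *\<^sub>R (p + x *\<^sub>R u) + t *\<^sub>R (p + y *\<^sub>R u) = (s + t) *\<^sub>R p + (s * x + t * y) *\<^sub>R u"
            by (simp add: algebra_simps)
          ultimately show "p + (s * x + t * y) *\<^sub>R u \<in> S" using \<open>s + t = 1\<close> by simp
        qed
      qed
      then show ?thesis by (simp add: J_def p_def add.commute indicator_def)
    qed
    have J0: "J b = 0" if "R < \<bar>b\<bar>" for b
    proof -
      have "?D (a *\<^sub>R u + b *\<^sub>R rot90 u) = 0" for a
        using norm_rotated_ge(2)[OF u, where a = a and b = b] that
          divergence_support[OF T supp, of "a *\<^sub>R u + b *\<^sub>R rot90 u" u] by simp
      then show ?thesis by (simp add: J_def)
    qed
    have Ji: "integrable lborel J"
      unfolding J_def by (rule lborel_integral_rotated(3)[OF u i])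
    have "\<bar>\<integral>x. indicator S x * ?D x \<partial>lborel\<bar> = \<bar>\<integral>b. J b \<partial>lborel\<bar>"
      unfolding J_def by (subst lborel_integral_rotated(2)[OF u i]) simp
    also have "\<dots> \<le> (\<integral>b. \<bar>J b\<bar> \<partial>lborel)" by (rule integral_abs_bound)
    also have "\<dots> \<le> (\<integral>b. indicator {-R..R} b * 2 \<partial>lborel)"
    proof (rule integral_mono)
      show "\<bar>J b\<bar> \<le> indicator {-R..R} b * 2" for b
        using Jle[of b] J0[of b] by (cases "R < \<bar>b\<bar>") (auto simp: indicator_def)
    qed (use Ji in \<open>simp_all add: emeasure_lborel_Icc_eq\<close>)
    also have "\<dots> = 4 * R" using R by simp
    finally show ?thesis .
  qed
  let ?u = "axis 1 1 :: real^2"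
  have "norm ?u = 1" by simp
  then show ?thesis
    using line[of ?u] line[of "rot90 ?u"] set_integral_divergence[OF T supp S(1), of ?u] by simp
qed

text \<open>A test field supported in \<open>cball 0 R\<close> sees finitely many pieces, each
  contributing at most 8 * R.\<close>

lemma locally_finite_perimeter_convex_pieces:
  assumes A: "A \<in> sets borel"
    and pieces: "\<And>R. \<exists>(I :: 'i set) S. finite I \<and> disjoint_family_on S I \<and>
      (\<forall>i\<in>I. S i \<in> sets borel \<and> convex (S i)) \<and> A \<inter> cball 0 R = (\<Union>i\<in>I. S i) \<inter> cball 0 R"
  shows "locally_finite_perimeter A"
  unfolding locally_finite_perimeter_def
proof (intro conjI allI impI)
  show "A \<in> sets lebesgue" using A by simp
  fix C :: "(real^2) set" assume "compact C"
  then have "bounded C" by (rule compact_imp_bounded)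
  then obtain R where R: "0 < R" "C \<subseteq> cball 0 R" by (auto simp: bounded_pos subset_eq)
  obtain I :: "'i set" and S where I: "finite I" "disjoint_family_on S I"
    and S: "\<And>i. i \<in> I \<Longrightarrow> S i \<in> sets borel" "\<And>i. i \<in> I \<Longrightarrow> convex (S i)"
    and AS: "A \<inter> cball 0 R = (\<Union>i\<in>I. S i) \<inter> cball 0 R"
    using pieces[of R] by blast
  show "bdd_above {LINT x:A|lebesgue. divergence T x | T.
          test_field T \<and> closure {x. T x \<noteq> 0} \<subseteq> C \<and> (\<forall>x. norm (T x) \<le> 1)}"
  proof (rule bdd_aboveI, clarify)
    fix T :: "real^2 \<Rightarrow> real^2"
    assume T: "test_field T" "closure {x. T x \<noteq> 0} \<subseteq> C" "\<forall>x. norm (T x) \<le> 1"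
    have supp: "{x. T x \<noteq> 0} \<subseteq> cball 0 R"
      using T(2) R(2) closure_subset[of "{x. T x \<noteq> 0}"] by blast
    have div0: "divergence T x = 0" if "x \<notin> cball 0 R" for x
      by (simp add: divergence_def divergence_support[OF T(1) supp that])
    have ind: "indicator A x * divergence T x = (\<Sum>i\<in>I. indicator (S i) x * divergence T x)" for x
    proof (cases "x \<in> cball 0 R")
      case True
      have "x \<in> A \<longleftrightarrow> x \<in> (\<Union>i\<in>I. S i)"
        using AS True by blast
      then have "indicator A x = (indicator (\<Union>i\<in>I. S i) x :: real)"
        unfolding indicator_def by (simp only:)
      also have "\<dots> = (\<Sum>i\<in>I. indicator (S i) x)"
        by (rule indicator_UN_disjoint[OF I])
      finally show ?thesis by (simp add: sum_distrib_right)
    qed (simp add: div0)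
    have int: "integrable lborel (\<lambda>x. indicator (S i) x * divergence T x)" if "i \<in> I" for i
      using integrable_test_derivative[OF T(1) supp S(1)[OF that]]
      by (simp add: divergence_rotated[OF T(1), of "axis 1 1"] distrib_left)
    have conv: "(LINT x:X|lebesgue. divergence T x) = (\<integral>x. indicator X x * divergence T x \<partial>lborel)"
      if "X \<in> sets borel" for X
      using set_integral_divergence[OF T(1) supp that, of "axis 1 1"]
        integrable_test_derivative[OF T(1) supp that]
      by (simp add: divergence_rotated[OF T(1), of "axis 1 1"] distrib_left)
    have "(LINT x:A|lebesgue. divergence T x) = (\<integral>x. (\<Sum>i\<in>I. indicator (S i) x * divergence T x) \<partial>lborel)"
      by (simp only: conv[OF A] ind)
    also have "\<dots> = (\<Sum>i\<in>I. \<integral>x. indicator (S i) x * divergence T x \<partial>lborel)"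
      by (rule Bochner_Integration.integral_sum[OF int])
    also have "\<dots> \<le> (\<Sum>i\<in>I. 8 * R)"
    proof (rule sum_mono)
      fix i assume "i \<in> I"
      then show "(\<integral>x. indicator (S i) x * divergence T x \<partial>lborel) \<le> 8 * R"
        using integral_divergence_convex_le[OF T(1) supp less_imp_le[OF R(1)] T(3) S(1) S(2), of i]
          conv[OF S(1), of i] by (simp add: abs_le_iff)
    qed
    finally show "(LINT x:A|lebesgue. divergence T x) \<le> (\<Sum>i\<in>I. 8 * R)" .
  qed
qed

subsection \<open>The Gauss--Green measure of a periodic family of strips\<close>

text \<open>On the line the strips are the intervals from n / l to (n + M) / l; the bound on K puts
  those with index outside \<open>{-K..K}\<close> off the support of f. The rest is the fundamental
  theorem of calculus on each interval.\<close>

lemma integral_derivative_strips: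
  fixes F f :: "real \<Rightarrow> real"
  assumes F: "\<And>t. (F has_real_derivative f t) (at t)" and f: "continuous_on UNIV f"
    and supp: "\<And>t. R < \<bar>t\<bar> \<Longrightarrow> f t = 0" and l: "0 < l" and M: "0 < M" "M < 1"
    and K: "R * l + 1 \<le> of_int K"
  shows "(\<integral>t. indicator {t. frac (t * l) \<le> M} t * f t \<partial>lborel)
    = (\<Sum>n\<in>{-K..K}. F ((of_int n + M) / l) - F (of_int n / l))"
proof -
  have ind: "indicator {t. frac (t * l) \<le> M} t * f t
      = (\<Sum>n\<in>{-K..K}. f t * indicator {of_int n / l..(of_int n + M) / l} t)" for t
  proof -
    define m where "m = \<lfloor>t * l\<rfloor>"
    have m: "of_int m \<le> t * l" "t * l < of_int m + 1" unfolding m_def by linarith+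
    have other: "indicator {of_int n / l..(of_int n + M) / l} t = (0::real)" if "n \<noteq> m" for n
    proof -
      have "\<not> (of_int n \<le> t * l \<and> t * l \<le> of_int n + M)"
      proof
        assume "of_int n \<le> t * l \<and> t * l \<le> of_int n + M"
        then have "\<lfloor>t * l\<rfloor> = n" using M by (intro floor_unique) auto
        with that show False by (simp add: m_def)
      qed
      then show ?thesis using l by (auto simp: indicator_def field_simps)
    qed
    have this_m: "indicator {of_int m / l..(of_int m + M) / l} t = (indicator {t. frac (t * l) \<le> M} t :: real)"
      using l m(1) by (auto simp: indicator_def field_simps frac_def m_def)
    show ?thesis
    proof (cases "m \<in> {-K..K}")
      case True
      have "(\<Sum>n\<in>{-K..K}. f t * indicator {of_int n / l..(of_int n + M) / l} t)
          = (\<Sum>n\<in>{m}. f t * indicator {of_int n / l..(of_int n + M) / l} t)"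
        using True other by (intro sum.mono_neutral_right) auto
      also have "\<dots> = f t * indicator {t. frac (t * l) \<le> M} t"
        using this_m by simp
      finally show ?thesis by (simp only: mult.commute)
    next
      case False
      have "R < \<bar>t\<bar>"
      proof (cases "K < m")
        case True
        then have "real_of_int K < of_int m" by simp
        with m K have "R * l < t * l" by linarith
        then show ?thesis using l by auto
      next
        case m': False
        with False have "m + 1 \<le> - K" by auto
        then have "real_of_int m + 1 \<le> - real_of_int K"
          by (metis of_int_1 of_int_add of_int_le_iff of_int_minus)
        with m K have "R * l < (- t) * l" by simp
        then have "R < - t" using l by (simp only: mult_less_cancel_right_pos)
        then show ?thesis by auto
      qed
      then show ?thesis using supp by simp
    qed
  qed
  have pq: "of_int n / l \<le> (of_int n + M) / l" for n :: int
    using l M by (simp add: divide_right_mono)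
  have i: "integrable lborel (\<lambda>t. f t * indicator {p..q} t)" for p q
    using borel_integrable_atLeastAtMost'[of p q f] f continuous_on_subset
    by (auto simp: set_integrable_def mult.commute)
  have "(\<integral>t. indicator {t. frac (t * l) \<le> M} t * f t \<partial>lborel)
      = (\<integral>t. (\<Sum>n\<in>{-K..K}. f t * indicator {of_int n / l..(of_int n + M) / l} t) \<partial>lborel)"
    by (simp only: ind)
  also have "\<dots> = (\<Sum>n\<in>{-K..K}. \<integral>t. f t * indicator {of_int n / l..(of_int n + M) / l} t \<partial>lborel)"
    by (rule Bochner_Integration.integral_sum) (rule i)
  also have "\<dots> = (\<Sum>n\<in>{-K..K}. F ((of_int n + M) / l) - F (of_int n / l))"
    using f by (intro sum.cong refl integral_FTC_Icc_real[OF pq F]) (simp add: continuous_on_eq_continuous_at)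
  finally show ?thesis .
qed

lemma integral_derivative_eq_0:
  fixes F f :: "real \<Rightarrow> real"
  assumes F: "\<And>t. (F has_real_derivative f t) (at t)" and f: "continuous_on UNIV f"
    and supp: "\<And>t. R < \<bar>t\<bar> \<Longrightarrow> f t = 0" "\<And>t. R < \<bar>t\<bar> \<Longrightarrow> F t = 0"
  shows "(\<integral>t. f t \<partial>lborel) = 0"
proof -
  define Q where "Q = \<bar>R\<bar> + 1"
  have "f t = f t * indicator {-Q..Q} t" for t
    using supp(1)[of t] by (cases "R < \<bar>t\<bar>") (auto simp: Q_def indicator_def)
  then have "(\<integral>t. f t \<partial>lborel) = (\<integral>t. f t * indicator {-Q..Q} t \<partial>lborel)"
    by presburger
  also have "\<dots> = F Q - F (- Q)"
    using f by (intro integral_FTC_Icc_real F) (auto simp: continuous_on_eq_continuous_at Q_def)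
  also have "\<dots> = 0"
    using supp(2)[of Q] supp(2)[of "-Q"] by (simp add: Q_def)
  finally show ?thesis .
qed

text \<open>The pair is written down: \<open>\<mu>\<close> is length on the boundary lines,
  \<open>\<sigma>\<close> the outer normal there. The lines are parametrized by counting measure on
  their indices times Lebesgue measure, so that Fubini reduces the Gauss--Green identity to
  one-dimensional integrals.\<close>

lemma gauss_green_strips:
  fixes z :: "real^2"
  assumes "z \<noteq> 0" and M: "0 < M" "M < 1"
  shows "\<exists>\<mu> \<sigma>. is_gauss_green {x. frac (x \<bullet> z) \<le> M} \<mu> \<sigma> \<and>
    (\<forall>x r. frac (x \<bullet> z) = 0 \<or> frac (x \<bullet> z) = M \<longrightarrow> 0 < r \<longrightarrow> 0 < emeasure \<mu> (ball x r))"
proof -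
  define l where "l = norm z"
  have l: "0 < l" using assms(1) by (simp add: l_def)
  define u where "u = z /\<^sub>R l"
  have u: "norm u = 1" using l by (simp add: u_def l_def)
  have uz: "u \<bullet> z = l" "rot90 u \<bullet> z = 0" and zu: "z = l *\<^sub>R u"
    using l by (simp_all add: u_def rot90_scaleR l_def dot_square_norm power2_eq_square)
  have uu: "u \<bullet> u = 1" "rot90 u \<bullet> rot90 u = 1" using u by (simp_all add: norm_eq_sqrt_inner)
  define A where "A = {x. frac (x \<bullet> z) \<le> M}"
  have A: "A \<in> sets borel" unfolding A_def frac_def by measurable
  \<comment> \<open>Position along u of the lines \<open>x \<bullet> z = n\<close> and
    \<open>x \<bullet> z = n + M\<close>, told apart by the boolean.\<close>
  define off where "off i = (of_int (fst i) + (if snd i then M else 0)) / l" for i :: "int \<times> bool"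
  define g where "g p = off (fst p) *\<^sub>R u + snd p *\<^sub>R rot90 u" for p :: "(int \<times> bool) \<times> real"
  define sn where "sn i = (if snd i then 1 else - 1 :: real)" for i :: "int \<times> bool"
  \<comment> \<open>Giving the value u to all remaining points makes \<open>\<sigma>\<close> a unit
    vector everywhere.\<close>
  define \<sigma> where "\<sigma> x = (if frac (x \<bullet> z) = 0 then - u else u)" for x
  let ?C = "count_space (UNIV :: (int \<times> bool) set)"
  let ?N = "?C \<Otimes>\<^sub>M (lborel :: real measure)"
  define \<mu> where "\<mu> = distr ?N borel g"
  interpret C: sigma_finite_measure ?C
    by (rule sigma_finite_measure_count_space)
  interpret N: pair_sigma_finite ?C "lborel :: real measure" ..
  have g: "g \<in> borel_measurable ?N"
    by (rule measurable_pair_measure_countable1) (simp_all add: g_def)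
  have gz: "g p \<bullet> z = of_int (fst (fst p)) + (if snd (fst p) then M else 0)" for p
    using l by (simp add: g_def inner_add_left uz off_def)
  have \<sigma>g: "\<sigma> (g p) = sn (fst p) *\<^sub>R u" for p
  proof -
    have "frac (g p \<bullet> z) = (if snd (fst p) then M else 0)"
      using M by (subst frac_unique_iff) (simp add: gz)
    then show ?thesis using M by (simp add: \<sigma>_def sn_def)
  qed
  define I where "I K = {-K..K} \<times> (UNIV :: bool set)" for K :: int
  have I: "finite (I K)" for K by (simp add: I_def)
  have off_big: "R < \<bar>off i\<bar>" if "R * l + 1 \<le> of_int K" "i \<notin> I K" for R K i
  proof -
    obtain n s where i: "i = (n, s)" by (cases i)
    let ?m = "if s then M else 0"
    have m: "0 \<le> ?m" "?m < 1" using M by auto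
    have oi: "off i * l = of_int n + ?m" using l by (simp add: off_def i)
    from that(2) have "K < n \<or> n + 1 \<le> - K" by (auto simp: I_def i)
    then show ?thesis
    proof
      assume "K < n"
      then have "real_of_int K < of_int n" by simp
      with that(1) m have "R * l < off i * l" unfolding oi by linarith
      then show ?thesis using l by auto
    next
      assume "n + 1 \<le> - K"
      then have "real_of_int n + 1 \<le> - real_of_int K"
        by (metis of_int_1 of_int_add of_int_le_iff of_int_minus)
      with that(1) m have "R * l < - (off i * l)" unfolding oi by linarith
      then have "R * l < (- off i) * l" by simp
      then have "R < - off i" using l by (simp only: mult_less_cancel_right_pos)
      then show ?thesis by auto
    qed
  qed
  have box: "fst p \<in> I K \<and> snd p \<in> {-R..R}" if "R * l + 1 \<le> of_int K" "g p \<in> cball 0 R" for R K p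
    using norm_rotated_ge[OF u, where a = "off (fst p)" and b = "snd p"] off_big[OF that(1), of "fst p"] that(2)
    by (auto simp: g_def)
  have Ifin: "emeasure ?N (I K \<times> {-R..R}) < \<infinity>" for K R
    by (subst lborel.emeasure_pair_measure_Times) (auto simp: I ennreal_mult_less_top emeasure_lborel_Icc_eq of_nat_less_top)
  have gg: "is_gauss_green A \<mu> \<sigma>"
    unfolding is_gauss_green_def
  proof (intro conjI allI impI)
    show "sets \<mu> = sets borel" by (simp add: \<mu>_def)
    show "\<sigma> \<in> borel_measurable borel" unfolding \<sigma>_def frac_def by measurable
    show "AE x in \<mu>. norm (\<sigma> x) = 1" using u by (simp add: \<sigma>_def)
    fix C :: "(real^2) set" assume C: "compact C"
    then obtain R where R: "C \<subseteq> cball 0 R"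
      using compact_imp_bounded[OF C] by (auto simp: bounded_iff subset_eq)
    obtain K where K: "R * l + 1 \<le> of_int K" using ex_le_of_int by blast
    have "C \<in> sets borel" using C by (simp add: compact_imp_closed)
    then have "emeasure \<mu> C = emeasure ?N (g -` C \<inter> space ?N)"
      unfolding \<mu>_def by (intro emeasure_distr g)
    also have "\<dots> \<le> emeasure ?N (I K \<times> {-R..R})"
    proof (rule emeasure_mono)
      show "g -` C \<inter> space ?N \<subseteq> I K \<times> {-R..R}"
      proof
        fix p assume "p \<in> g -` C \<inter> space ?N"
        then have "g p \<in> cball 0 R" using R by auto
        from box[OF K this] show "p \<in> I K \<times> {-R..R}" by (cases p) auto
      qed
      show "I K \<times> {-R..R} \<in> sets ?N" by (intro pair_measureI) auto
    qed
    finally show "emeasure \<mu> C < \<infinity>" using Ifin le_less_trans by blast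
  next
    fix T :: "real^2 \<Rightarrow> real^2" assume T: "test_field T"
    have "bounded (closure {x. T x \<noteq> 0})" using T by (simp add: test_field_def compact_imp_bounded)
    then obtain R where "closure {x. T x \<noteq> 0} \<subseteq> cball 0 R" by (auto simp: bounded_iff subset_eq)
    then have supp: "{x. T x \<noteq> 0} \<subseteq> cball 0 R"
      using closure_subset[of "{x. T x \<noteq> 0}"] by (rule order_trans[rotated])
    obtain K where K: "R * l + 1 \<le> of_int K" using ex_le_of_int by blast
    have Tc: "continuous_on UNIV T"
      by (rule has_derivative_continuous_on[OF has_derivative_at_withinI[OF test_field_derivative(1)[OF T]]])
    have T0: "x \<notin> cball 0 R \<Longrightarrow> T x = 0" for x using supp by blast
    obtain B where B: "0 \<le> B" "\<And>x. norm (T x) \<le> B"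
      using continuous_compact_support_bounded[OF Tc T0] by metis
    have Tm: "T \<in> borel_measurable borel" using Tc by (rule borel_measurable_continuous_onI)
    define H where "H p = sn (fst p) * (T (g p) \<bullet> u)" for p
    have H0: "H p = 0" if "\<not> (fst p \<in> I K \<and> snd p \<in> {-R..R})" for p
      using box[OF K, of p] T0[of "g p"] that unfolding H_def by fastforce
    have HI: "i \<notin> I K \<Longrightarrow> H (i, b) = 0" for i b
      by (rule H0) simp
    have HB: "norm (H p) \<le> B" for p
      using Cauchy_Schwarz_ineq2[of "T (g p)" u] B(2)[of "g p"] u by (simp add: H_def sn_def abs_mult)
    have Hm: "H \<in> borel_measurable ?N"
      unfolding H_def
    proof (intro borel_measurable_times borel_measurable_inner borel_measurable_const)
      show "(\<lambda>p. sn (fst p)) \<in> borel_measurable ?N"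
        by (rule measurable_compose[OF measurable_fst]) simp
      show "(\<lambda>p. T (g p)) \<in> borel_measurable ?N"
        by (rule measurable_compose[OF g Tm])
    qed
    have Hi: "integrable ?N H"
    proof (rule integrableI_bounded_set[where A = "I K \<times> {-R..R}" and B = B])
      show "I K \<times> {-R..R} \<in> sets ?N" by (intro pair_measureI) auto
      show "AE p in ?N. p \<in> I K \<times> {-R..R} \<longrightarrow> norm (H p) \<le> B" using HB by simp
      show "AE p in ?N. p \<notin> I K \<times> {-R..R} \<longrightarrow> H p = 0"
        using H0 by (intro AE_I2) (auto simp: mem_Times_iff)
    qed (use Hm Ifin in auto)
    have rhs: "(LINT x|\<mu>. T x \<bullet> \<sigma> x) = (\<Sum>i\<in>I K. \<integral>b. H (i, b) \<partial>lborel)"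
    proof -
      have "(LINT x|\<mu>. T x \<bullet> \<sigma> x) = (LINT p|?N. T (g p) \<bullet> \<sigma> (g p))"
        unfolding \<mu>_def
      proof (rule integral_distr[OF g])
        have [measurable]: "\<sigma> \<in> borel_measurable borel" unfolding \<sigma>_def frac_def by measurable
        note [measurable] = Tm
        show "(\<lambda>x. T x \<bullet> \<sigma> x) \<in> borel_measurable borel" by measurable
      qed
      also have "\<dots> = (LINT p|?N. H p)" by (simp add: \<sigma>g H_def)
      also have "\<dots> = (LINT i|?C. LINT b|lborel. H (i, b))"
        by (rule N.integral_fst'[OF Hi, symmetric])
      also have "\<dots> = (\<Sum>i | i \<in> UNIV \<and> (LINT b|lborel. H (i, b)) \<noteq> 0. LINT b|lborel. H (i, b))"
      proof (intro lebesgue_integral_count_space_finite_support finite_subset[OF _ I[of K]] subsetI)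
        fix i assume "i \<in> {i \<in> UNIV. (LINT b|lborel. H (i, b)) \<noteq> 0}"
        then show "i \<in> I K" by (cases "i \<in> I K") (simp_all add: HI)
      qed
      also have "\<dots> = (\<Sum>i\<in>I K. LINT b|lborel. H (i, b))"
      proof (intro sum.mono_neutral_left I subsetI)
        fix i assume "i \<in> {i \<in> UNIV. (LINT b|lborel. H (i, b)) \<noteq> 0}"
        then show "i \<in> I K" by (cases "i \<in> I K") (simp_all add: HI)
      qed auto
      finally show ?thesis .
    qed
    have D0: "frechet_derivative T (at x) v = 0" if "x \<notin> cball 0 R" for x v
      by (rule divergence_support[OF T supp that])
    have Aab: "a *\<^sub>R u + b *\<^sub>R rot90 u \<in> A \<longleftrightarrow> frac (a * l) \<le> M" for a b
      by (simp add: A_def inner_add_left uz)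
    \<comment> \<open>Membership in A is constant along lines of direction \<open>rot90 u\<close>,
      so the compactly supported derivative integrates to 0 on each of them.\<close>
    have tangential: "(\<integral>x. indicator A x * (frechet_derivative T (at x) (rot90 u) \<bullet> rot90 u) \<partial>lborel) = 0"
    proof -
      have "(\<integral>b. indicator A (a *\<^sub>R u + b *\<^sub>R rot90 u) *
          (frechet_derivative T (at (a *\<^sub>R u + b *\<^sub>R rot90 u)) (rot90 u) \<bullet> rot90 u) \<partial>lborel) = 0" for a
      proof -
        have "(\<integral>b. frechet_derivative T (at (a *\<^sub>R u + b *\<^sub>R rot90 u)) (rot90 u) \<bullet> rot90 u \<partial>lborel) = 0"
        proof (rule integral_derivative_eq_0)
          show "((\<lambda>b. T (a *\<^sub>R u + b *\<^sub>R rot90 u) \<bullet> rot90 u) has_real_derivative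
              frechet_derivative T (at (a *\<^sub>R u + b *\<^sub>R rot90 u)) (rot90 u) \<bullet> rot90 u) (at b)" for b
            by (rule has_real_derivative_along_line[OF test_field_derivative(1)[OF T]])
          show "continuous_on UNIV (\<lambda>b. frechet_derivative T (at (a *\<^sub>R u + b *\<^sub>R rot90 u)) (rot90 u) \<bullet> rot90 u)"
            by (intro continuous_intros continuous_on_compose2[OF test_field_derivative(2)[OF T]]) auto
          fix b assume "R < \<bar>b\<bar>"
          then have "a *\<^sub>R u + b *\<^sub>R rot90 u \<notin> cball 0 R"
            using norm_rotated_ge(2)[OF u, where a = a and b = b] by simp
          then show "frechet_derivative T (at (a *\<^sub>R u + b *\<^sub>R rot90 u)) (rot90 u) \<bullet> rot90 u = 0"
            "T (a *\<^sub>R u + b *\<^sub>R rot90 u) \<bullet> rot90 u = 0"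
            by (simp_all add: D0 T0)
        qed
        then show ?thesis by (simp add: indicator_def Aab)
      qed
      then show ?thesis
        by (subst lborel_integral_rotated(1)[OF u integrable_test_derivative[OF T supp A]]) simp
    qed
    have Hb: "integrable lborel (\<lambda>b. H (i, b))" for i
    proof (rule integrable_compact_support[OF sets_lborel emeasure_lborel_cball_finite[of 0 R]])
      show "(\<lambda>b. H (i, b)) \<in> borel_measurable borel"
        using measurable_compose[OF measurable_Pair1'[of i ?C lborel] Hm] by simp
      show "norm (H (i, b)) \<le> B" for b by (rule HB)
      show "H (i, b) = 0" if "b \<notin> cball 0 R" for b
        using that by (intro H0) (auto simp: abs_le_iff)
    qed
    \<comment> \<open>In direction u the set is a union of intervals; their endpoint values, with
      the signs in \<open>sn\<close>, are the values of \<open>H\<close>.\<close>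
    have normal: "(\<integral>a. indicator A (a *\<^sub>R u + b *\<^sub>R rot90 u) *
          (frechet_derivative T (at (a *\<^sub>R u + b *\<^sub>R rot90 u)) u \<bullet> u) \<partial>lborel) = (\<Sum>i\<in>I K. H (i, b))" for b
    proof -
      define p where "p = b *\<^sub>R rot90 u"
      have "(\<integral>a. indicator {a. frac (a * l) \<le> M} a * (frechet_derivative T (at (p + a *\<^sub>R u)) u \<bullet> u) \<partial>lborel)
          = (\<Sum>n\<in>{-K..K}. T (p + ((of_int n + M) / l) *\<^sub>R u) \<bullet> u - T (p + (of_int n / l) *\<^sub>R u) \<bullet> u)"
      proof (rule integral_derivative_strips[OF _ _ _ l M K])
        show "((\<lambda>a. T (p + a *\<^sub>R u) \<bullet> u) has_real_derivative
              frechet_derivative T (at (p + a *\<^sub>R u)) u \<bullet> u) (at a)" for a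
          by (rule has_real_derivative_along_line[OF test_field_derivative(1)[OF T]])
        show "continuous_on UNIV (\<lambda>a. frechet_derivative T (at (p + a *\<^sub>R u)) u \<bullet> u)"
          by (intro continuous_intros continuous_on_compose2[OF test_field_derivative(2)[OF T]]) auto
        fix a assume "R < \<bar>a\<bar>"
        then have "p + a *\<^sub>R u \<notin> cball 0 R"
          using norm_rotated_ge(1)[OF u, where a = a and b = b] by (simp add: p_def add.commute)
        then show "frechet_derivative T (at (p + a *\<^sub>R u)) u \<bullet> u = 0" by (simp add: D0)
      qed
      also have "\<dots> = (\<Sum>n\<in>{-K..K}. \<Sum>s\<in>UNIV. H ((n, s), b))"
        by (intro sum.cong refl) (simp add: UNIV_bool H_def sn_def g_def off_def p_def add.commute)
      also have "\<dots> = (\<Sum>i\<in>I K. H (i, b))"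
        unfolding I_def by (simp add: sum.cartesian_product case_prod_beta')
      finally show ?thesis
        unfolding p_def by (simp add: indicator_def Aab add.commute[of "b *\<^sub>R rot90 u"])
    qed
    have "(LINT x:A|lebesgue. divergence T x)
        = (\<integral>x. indicator A x * (frechet_derivative T (at x) u \<bullet> u) \<partial>lborel)"
      by (simp add: set_integral_divergence[OF T supp A u] tangential)
    also have "\<dots> = (\<integral>b. (\<Sum>i\<in>I K. H (i, b)) \<partial>lborel)"
      by (subst lborel_integral_rotated(2)[OF u integrable_test_derivative[OF T supp A]]) (simp add: normal)
    also have "\<dots> = (\<Sum>i\<in>I K. \<integral>b. H (i, b) \<partial>lborel)"
      by (rule Bochner_Integration.integral_sum) (rule Hb)
    finally show "(LINT x:A|lebesgue. divergence T x) = (LINT x|\<mu>. T x \<bullet> \<sigma> x)"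
      unfolding rhs .
  qed
  have "0 < emeasure \<mu> (ball x r)" if x: "frac (x \<bullet> z) = 0 \<or> frac (x \<bullet> z) = M" and r: "0 < r" for x r
  proof -
    define i where "i = (\<lfloor>x \<bullet> z\<rfloor>, frac (x \<bullet> z) = M)"
    define b where "b = x \<bullet> rot90 u"
    have "off i = x \<bullet> z / l" using x M by (auto simp: off_def i_def frac_def)
    also have "\<dots> = x \<bullet> u" by (simp add: u_def divide_inverse mult.commute)
    finally have gx: "g (i, b) = x" using real2_decomp[OF u, of x] by (simp add: g_def b_def)
    \<comment> \<open>The boundary line through x cuts the ball in a segment of length 2 *
      r.\<close>
    have "{i} \<times> {b - r<..<b + r} \<subseteq> g -` ball x r \<inter> space ?N"
    proof
      fix p assume "p \<in> {i} \<times> {b - r<..<b + r}"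
      then obtain t where p: "p = (i, t)" and t: "b - r < t" "t < b + r" by auto
      have "x - g (i, t) = (b - t) *\<^sub>R rot90 u"
        by (subst gx[symmetric]) (simp add: g_def algebra_simps)
      then have "dist x (g (i, t)) < r" using t u by (simp add: dist_norm abs_less_iff)
      then show "p \<in> g -` ball x r \<inter> space ?N" by (simp add: p space_pair_measure)
    qed
    moreover have "g -` ball x r \<inter> space ?N \<in> sets ?N"
      by (rule measurable_sets[OF g]) simp
    ultimately have "emeasure ?N ({i} \<times> {b - r<..<b + r}) \<le> emeasure \<mu> (ball x r)"
      unfolding \<mu>_def by (subst emeasure_distr[OF g]) (auto intro: emeasure_mono)
    moreover have "emeasure ?N ({i} \<times> {b - r<..<b + r}) = ennreal (2 * r)"
      using r by (subst lborel.emeasure_pair_measure_Times) auto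
    ultimately show ?thesis using r by (metis ennreal_less_zero_iff less_le_trans zero_less_mult_iff zero_less_numeral)
  qed
  with gg show ?thesis unfolding A_def by blast
qed

subsection \<open>Zigzag sets\<close>

text \<open>The upper boundary line \<open>x \<bullet> z = M\<close> of the strip is replaced by a periodic zigzag whose edges
  have the outer normal directions \<open>c\<close> and \<open>z - c\<close>. The first coordinate \<open>pp\<close> of a point is made
  compatible with the lattice by subtracting a multiple of \<open>\<lfloor>x \<bullet> z\<rfloor>\<close>: a lattice vector then
  shifts it by an integer multiple of the tooth size \<open>\<delta>\<close>.\<close>

locale zigzag =
  fixes z w c :: "real^2" and k :: nat and M :: real
  assumes z: "z \<in> lattice" and w: "w \<in> lattice" "w \<bullet> z = 1"
    and D_pos: "0 < c \<bullet> rot90 z" and k: "0 < k" and M: "0 < M" "M < 1"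
    and small: "(c \<bullet> rot90 z) / (real k * (z \<bullet> z)) < 2 * min M (1 - M)"
begin

definition D where "D = c \<bullet> rot90 z"
text \<open>Lattice vectors change \<open>pp\<close> by integer multiples of D /
  (\<open>z \<bullet> z\<close>); the teeth subdivide this unit into k parts.\<close>

definition \<delta> where "\<delta> = D / (real k * (z \<bullet> z))"
text \<open>The coefficient of z when c is expanded in the orthogonal basis z,
  \<open>rot90 z\<close>.\<close>

definition a where "a = (c \<bullet> z) / (z \<bullet> z)"
definition pp where "pp x = c \<bullet> x - a * of_int \<lfloor>x \<bullet> z\<rfloor>"
text \<open>Distance up to the next multiple of \<open>\<delta>\<close>, equal to 0 at the
  multiples. The slope -1 produces the edges with normal z - c, the jumps those with normal
  c.\<close>

definition saw where "saw y = \<delta> * of_int \<lceil>y / \<delta>\<rceil> - y"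
text \<open>The zigzag runs at heights between \<open>level - \<delta>\<close> and
  \<open>level\<close>; this value centres it at \<open>x \<bullet> z = M\<close>.\<close>

definition level where "level = M + \<delta> / 2"
definition Z where "Z = {x. frac (x \<bullet> z) + saw (pp x) \<le> level}"

lemma zz: "0 < z \<bullet> z"
  using w by auto

lemma D: "0 < D"
  using D_pos by (simp add: D_def)

lemma \<delta>: "0 < \<delta>" "\<delta> < 2 * M" "\<delta> < 2 * (1 - M)"
proof -
  show "0 < \<delta>" using D zz k by (simp add: \<delta>_def)
  define m where "m = min M (1 - M)"
  have "\<delta> < 2 * m" using small by (simp add: \<delta>_def D_def m_def)
  moreover have "m \<le> M" "m \<le> 1 - M" by (simp_all add: m_def)
  ultimately show "\<delta> < 2 * M" by linarith
  show "\<delta> < 2 * (1 - M)" using \<open>\<delta> < 2 * m\<close> \<open>m \<le> 1 - M\<close> by simp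
qed

text \<open>The purpose of \<open>small\<close>: the teeth stay strictly between two consecutive
  lines on which \<open>x \<bullet> z\<close> is an integer.\<close>

lemma level: "level < 1" "\<delta> < level"
  using \<delta> M by (auto simp: level_def)

lemma ceiling_multiple: "y \<le> \<delta> * of_int \<lceil>y / \<delta>\<rceil>" "\<delta> * of_int \<lceil>y / \<delta>\<rceil> < y + \<delta>"
proof -
  have "y / \<delta> * \<delta> \<le> of_int \<lceil>y / \<delta>\<rceil> * \<delta>" using \<delta>(1) by (intro mult_right_mono) auto
  then show "y \<le> \<delta> * of_int \<lceil>y / \<delta>\<rceil>" using \<delta>(1) by (simp add: mult.commute)
  have "of_int \<lceil>y / \<delta>\<rceil> < y / \<delta> + 1" by linarith
  then have "of_int \<lceil>y / \<delta>\<rceil> * \<delta> < (y / \<delta> + 1) * \<delta>" using \<delta>(1) by (rule mult_strict_right_mono)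
  then show "\<delta> * of_int \<lceil>y / \<delta>\<rceil> < y + \<delta>" using \<delta>(1) by (simp add: algebra_simps)
qed

lemma saw_bounds: "0 \<le> saw y" "saw y < \<delta>"
  using ceiling_multiple[of y] by (simp_all add: saw_def)

lemma saw_eq:
  assumes "(of_int j - 1) * \<delta> < y" "y \<le> of_int j * \<delta>"
  shows "saw y = of_int j * \<delta> - y"
proof -
  have "\<lceil>y / \<delta>\<rceil> = j"
    using assms \<delta>(1) by (intro ceiling_unique) (simp_all add: field_simps)
  then show ?thesis by (simp add: saw_def mult.commute)
qed

lemma saw_cell: "\<exists>j::int. (of_int j - 1) * \<delta> < y \<and> y \<le> of_int j * \<delta>"
  using ceiling_multiple[of y] by (intro exI[of _ "\<lceil>y / \<delta>\<rceil>"]) (simp add: algebra_simps)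

lemma saw_shift: "saw (y + \<delta> * of_int n) = saw y"
proof -
  have "(y + \<delta> * of_int n) / \<delta> = y / \<delta> + of_int n" using \<delta>(1) by (simp add: field_simps)
  then have "\<lceil>(y + \<delta> * of_int n) / \<delta>\<rceil> = \<lceil>y / \<delta>\<rceil> + n" by (simp only: ceiling_add_of_int)
  then show ?thesis by (simp add: saw_def algebra_simps)
qed

lemma D_eq: "D = \<delta> * (real k * (z \<bullet> z))"
  using zz k by (simp add: \<delta>_def)

lemma inner_decomp: "(z \<bullet> z) * (c \<bullet> x) = (c \<bullet> z) * (x \<bullet> z) + D * (x \<bullet> rot90 z)"
  unfolding D_def by (simp add: inner_real2) algebra

text \<open>The correction by \<open>a\<close> cancels the component of c along z. What remains is D
  * (\<open>\<zeta> \<bullet> rot90 z\<close>) / (\<open>z \<bullet> z\<close>), and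
  \<open>\<zeta> \<bullet> rot90 z\<close> is an integer.\<close>

lemma pp_lattice:
  assumes "\<zeta> \<in> lattice"
  shows "\<exists>n::int. pp (x + \<zeta>) = pp x + \<delta> * of_int n"
proof -
  obtain m where m: "\<zeta> \<bullet> z = of_int m"
    using lattice_inner_Ints[OF assms z] by (auto elim: Ints_cases)
  obtain i where i: "\<zeta> \<bullet> rot90 z = of_int i"
    using lattice_inner_Ints[OF assms lattice_rot90[OF z]] by (auto elim: Ints_cases)
  have "\<lfloor>(x + \<zeta>) \<bullet> z\<rfloor> = \<lfloor>x \<bullet> z\<rfloor> + m" by (simp add: inner_add_left m)
  then have "pp (x + \<zeta>) = pp x + (c \<bullet> \<zeta> - a * (\<zeta> \<bullet> z))"
    by (simp add: pp_def inner_add_right m algebra_simps)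
  also have "c \<bullet> \<zeta> - a * (\<zeta> \<bullet> z) = ((z \<bullet> z) * (c \<bullet> \<zeta>) - (c \<bullet> z) * (\<zeta> \<bullet> z)) / (z \<bullet> z)"
    using zz by (simp add: a_def field_simps)
  also have "\<dots> = D * (\<zeta> \<bullet> rot90 z) / (z \<bullet> z)"
    by (simp add: inner_decomp)
  also have "\<dots> = \<delta> * of_int (int k * i)"
    using zz by (simp add: D_eq i)
  finally show ?thesis by blast
qed

lemma frac_lattice: "\<zeta> \<in> lattice \<Longrightarrow> frac ((x + \<zeta>) \<bullet> z) = frac (x \<bullet> z)"
  using lattice_inner_Ints[OF _ z, of \<zeta>] by (auto simp: inner_add_left frac_def elim!: Ints_cases)

lemma saw_pp_lattice: "\<zeta> \<in> lattice \<Longrightarrow> saw (pp (x + \<zeta>)) = saw (pp x)"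
  using pp_lattice[of \<zeta> x] saw_shift by auto

lemma periodic_Z: "periodic Z"
  by (simp add: periodic_def Z_def frac_lattice saw_pp_lattice)

lemma measurable_pp [measurable]: "pp \<in> borel_measurable borel"
  unfolding pp_def by measurable

lemma measurable_saw [measurable]: "saw \<in> borel_measurable borel"
  unfolding saw_def by measurable

lemma borel_Z: "Z \<in> sets borel"
  unfolding Z_def frac_def by measurable

text \<open>Where the floor in \<open>pp\<close> and the ceiling in \<open>saw\<close> are both
  constant, Z is an intersection of half-planes. A ball meets finitely many of these cells.\<close>

lemma finite_perimeter_Z: "locally_finite_perimeter Z"
proof (rule locally_finite_perimeter_convex_pieces[OF borel_Z, where 'i = "int \<times> int"])
  fix R :: real
  define S where "S p = (case p of (n, j) \<Rightarrow>
      {x. of_int n \<le> z \<bullet> x} \<inter> {x. z \<bullet> x < of_int n + 1}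
      \<inter> {x. c \<bullet> x > (of_int j - 1) * \<delta> + a * of_int n} \<inter> {x. c \<bullet> x \<le> of_int j * \<delta> + a * of_int n}
      \<inter> {x. (z - c) \<bullet> x \<le> level + of_int n - of_int j * \<delta> - a * of_int n})" for p :: "int \<times> int"
  have S_iff: "x \<in> S (n, j) \<longleftrightarrow> n = \<lfloor>x \<bullet> z\<rfloor> \<and> (of_int j - 1) * \<delta> < pp x \<and> pp x \<le> of_int j * \<delta> \<and> x \<in> Z" for x n j
  proof -
    have "of_int n \<le> z \<bullet> x \<and> z \<bullet> x < of_int n + 1 \<longleftrightarrow> n = \<lfloor>x \<bullet> z\<rfloor>"
      by (simp add: inner_commute) linarith
    moreover have "(z - c) \<bullet> x \<le> level + of_int n - of_int j * \<delta> - a * of_int n \<longleftrightarrow> x \<in> Z"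
      if "n = \<lfloor>x \<bullet> z\<rfloor>" "(of_int j - 1) * \<delta> < pp x" "pp x \<le> of_int j * \<delta>"
    proof -
      have "frac (x \<bullet> z) + saw (pp x) = z \<bullet> x - of_int n + of_int j * \<delta> - (c \<bullet> x - a * of_int n)"
        using saw_eq[OF that(2,3)] by (simp add: frac_def pp_def that(1) inner_commute)
      then show ?thesis by (auto simp: Z_def inner_diff_left)
    qed
    ultimately show ?thesis
      by (auto simp: S_def pp_def)
  qed
  obtain N where N: "R * norm z + 1 \<le> of_int N" using ex_le_of_int by blast
  \<comment> \<open>On the part of Z in the ball, \<open>pp\<close> is bounded by this numerator, so
    J teeth on either side suffice; the 1 is a margin for the half-open cells.\<close>
  obtain J where J: "(R * norm c + \<bar>a\<bar> * of_int N) / \<delta> + 1 \<le> of_int J" using ex_le_of_int by blast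
  define I where "I = {-N..N} \<times> {-J..J}"
  show "\<exists>(I :: (int \<times> int) set) S. finite I \<and> disjoint_family_on S I \<and> (\<forall>i\<in>I. S i \<in> sets borel \<and> convex (S i))
      \<and> Z \<inter> cball 0 R = (\<Union>i\<in>I. S i) \<inter> cball 0 R" 
  proof (intro exI conjI ballI)
    show "finite I" by (simp add: I_def)
    show "disjoint_family_on S I"
    proof -
      have "(n, j) = (n', j')" if "x \<in> S (n, j)" "x \<in> S (n', j')" for x n j n' j'
      proof -
        have "\<delta> * of_int \<lceil>pp x / \<delta>\<rceil> = of_int j * \<delta>" "\<delta> * of_int \<lceil>pp x / \<delta>\<rceil> = of_int j' * \<delta>"
          using that[unfolded S_iff] saw_eq[of j "pp x"] saw_eq[of j' "pp x"] by (simp_all add: saw_def)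
        then show ?thesis using that[unfolded S_iff] \<delta>(1) by simp
      qed
      then show ?thesis unfolding disjoint_family_on_def by (metis IntE equals0I surj_pair)
    qed
    fix i assume "i \<in> I"
    show "S i \<in> sets borel"
      by (cases i) (simp add: S_def sets.Int)
    show "convex (S i)"
      by (cases i) (simp add: S_def, intro convex_Int convex_halfspace_le convex_halfspace_lt convex_halfspace_ge convex_halfspace_gt)
  next
    have "x \<in> (\<Union>i\<in>I. S i)" if "x \<in> Z" "x \<in> cball 0 R" for x
    proof -
      obtain j where j: "(of_int j - 1) * \<delta> < pp x" "pp x \<le> of_int j * \<delta>" using saw_cell by blast
      have "\<bar>x \<bullet> z\<bar> \<le> R * norm z"
        using that(2) by (intro order_trans[OF Cauchy_Schwarz_ineq2] mult_right_mono) auto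
      then have n: "\<lfloor>x \<bullet> z\<rfloor> \<in> {-N..N}" using N by (auto simp: abs_le_iff) linarith+
      have "\<bar>c \<bullet> x\<bar> \<le> R * norm c"
        using Cauchy_Schwarz_ineq2[of c x] that(2) mult_right_mono[of "norm x" R "norm c"] by (simp add: mult.commute)
      moreover have "\<bar>a * of_int \<lfloor>x \<bullet> z\<rfloor>\<bar> \<le> \<bar>a\<bar> * of_int N"
        unfolding abs_mult using n by (intro mult_left_mono) (auto simp: abs_le_iff minus_le_iff)
      ultimately have "\<bar>pp x\<bar> \<le> R * norm c + \<bar>a\<bar> * of_int N" unfolding pp_def by linarith
      moreover have "R * norm c + \<bar>a\<bar> * of_int N \<le> (of_int J - 1) * \<delta>"
        using J \<delta>(1) by (simp add: field_simps)
      ultimately have "(of_int j - 1) * \<delta> < (of_int J) * \<delta>" "- of_int J * \<delta> < of_int j * \<delta>"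
        using j \<delta>(1) by (auto simp: algebra_simps)
      then have "of_int j - 1 < real_of_int J" "- real_of_int J < of_int j"
        using \<delta>(1) by (simp_all only: mult_less_cancel_right_pos)
      then have "j \<in> {-J..J}" by auto
      with n j that(1) show ?thesis by (auto simp: I_def S_iff intro!: bexI[of _ "(\<lfloor>x \<bullet> z\<rfloor>, j)"])
    qed
    moreover have "x \<in> Z" if "x \<in> (\<Union>i\<in>I. S i)" for x
      using that S_iff by auto
    ultimately show "Z \<inter> cball 0 R = (\<Union>i\<in>I. S i) \<inter> cball 0 R" by blast
  qed
qed

section \<open>Local shape of the zigzag set\<close>

lemma eventually_floor:
  assumes "0 < frac (x \<bullet> z)"
  shows "\<forall>\<^sub>F y in nhds x. \<lfloor>y \<bullet> z\<rfloor> = \<lfloor>x \<bullet> z\<rfloor>"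
proof -
  have t: "((\<lambda>y. y \<bullet> z) \<longlongrightarrow> x \<bullet> z) (nhds x)"
    by (intro tendsto_intros filterlim_ident)
  have "of_int \<lfloor>x \<bullet> z\<rfloor> < x \<bullet> z" using assms by (simp add: frac_def)
  moreover have "x \<bullet> z < of_int \<lfloor>x \<bullet> z\<rfloor> + 1" by linarith
  ultimately have "\<forall>\<^sub>F y in nhds x. of_int \<lfloor>x \<bullet> z\<rfloor> < y \<bullet> z" "\<forall>\<^sub>F y in nhds x. y \<bullet> z < of_int \<lfloor>x \<bullet> z\<rfloor> + 1"
    using order_tendstoD[OF t] by auto
  then show ?thesis by eventually_elim linarith
qed

text \<open>Just above a line with integer \<open>x \<bullet> z\<close> the fractional part is close
  to 0, just below it is close to 1; hence a half-plane with outer normal direction - z. It is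
  stated for a general set because it serves both the zigzag and the lamella.\<close>

lemma near_integer:
  assumes A: "\<And>y. frac (y \<bullet> z) < lo \<Longrightarrow> y \<in> A" "\<And>y. hi < frac (y \<bullet> z) \<Longrightarrow> y \<notin> A"
    and lo: "0 < lo" "lo < 1" and hi: "0 < hi" "hi < 1" and x: "frac (x \<bullet> z) = 0"
  shows "\<forall>\<^sub>F y in nhds x. y \<in> A \<longleftrightarrow> y \<bullet> - z \<le> x \<bullet> - z"
proof -
  have t: "((\<lambda>y. y \<bullet> z) \<longlongrightarrow> x \<bullet> z) (nhds x)"
    by (intro tendsto_intros filterlim_ident)
  define n where "n = \<lfloor>x \<bullet> z\<rfloor>"
  have n: "x \<bullet> z = of_int n" using x by (simp add: frac_def n_def)
  have "\<forall>\<^sub>F y in nhds x. x \<bullet> z - (1 - hi) < y \<bullet> z" "\<forall>\<^sub>F y in nhds x. y \<bullet> z < x \<bullet> z + lo"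
    using order_tendstoD[OF t] lo hi by auto
  then show ?thesis
  proof eventually_elim
    case (elim y)
    show ?case
    proof (cases "of_int n \<le> y \<bullet> z")
      case True
      then have "\<lfloor>y \<bullet> z\<rfloor> = n" using elim lo n by (intro floor_unique) auto
      then have "frac (y \<bullet> z) < lo" using elim n by (simp add: frac_def)
      then show ?thesis using A(1)[of y] True n by simp
    next
      case False
      then have "\<lfloor>y \<bullet> z\<rfloor> = n - 1" using elim hi n by (intro floor_unique) auto
      then have "hi < frac (y \<bullet> z)" using elim n by (simp add: frac_def)
      then show ?thesis using A(2)[of y] False n by simp
    qed
  qed
qed

lemma Z_near_integer:
  assumes "frac (x \<bullet> z) = 0"
  shows "\<forall>\<^sub>F y in nhds x. y \<in> Z \<longleftrightarrow> y \<bullet> - z \<le> x \<bullet> - z"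
proof (rule near_integer[OF _ _ _ _ _ _ assms])
  show "y \<in> Z" if "frac (y \<bullet> z) < level - \<delta>" for y
    using that saw_bounds(2)[of "pp y"] by (simp add: Z_def)
  show "y \<notin> Z" if "level < frac (y \<bullet> z)" for y
    using that saw_bounds(1)[of "pp y"] by (simp add: Z_def)
qed (use level \<delta>(1) in linarith)+

text \<open>Inside a cell the function compared with \<open>level\<close> is affine with gradient z
  - c.\<close>

lemma Z_near_smooth:
  assumes s: "0 < frac (x \<bullet> z)" and j: "(of_int j - 1) * \<delta> < pp x" "pp x < of_int j * \<delta>"
  shows "\<forall>\<^sub>F y in nhds x. y \<in> Z \<longleftrightarrow> y \<bullet> (z - c) \<le> x \<bullet> (z - c) + (level - (frac (x \<bullet> z) + saw (pp x)))"
proof -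
  define n where "n = \<lfloor>x \<bullet> z\<rfloor>"
  have t: "((\<lambda>y. c \<bullet> y - a * of_int n) \<longlongrightarrow> c \<bullet> x - a * of_int n) (nhds x)"
    by (intro tendsto_intros filterlim_ident)
  have "\<forall>\<^sub>F y in nhds x. (of_int j - 1) * \<delta> < c \<bullet> y - a * of_int n"
    "\<forall>\<^sub>F y in nhds x. c \<bullet> y - a * of_int n < of_int j * \<delta>"
    using order_tendstoD[OF t] j by (auto simp: pp_def n_def)
  with eventually_floor[OF s] show ?thesis
  proof eventually_elim
    case (elim y)
    then have "pp y = c \<bullet> y - a * of_int n" by (simp add: pp_def n_def)
    with elim have "saw (pp y) = of_int j * \<delta> - pp y" by (intro saw_eq) auto
    moreover have "saw (pp x) = of_int j * \<delta> - pp x" using j by (intro saw_eq) auto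
    ultimately show ?case using elim
      by (simp add: Z_def frac_def pp_def inner_diff_right inner_commute) argo
  qed
qed

text \<open>Crossing the line \<open>pp x = j * \<delta>\<close> in the direction of increasing
  \<open>pp\<close> raises \<open>saw\<close> by \<open>\<delta>\<close>, so the threshold for the
  continuous part drops from \<open>level\<close> to \<open>level - \<delta>\<close>. Below both
  thresholds Z fills a neighbourhood, above both it is absent, and in between it is a half-plane
  with normal c.\<close>

lemma Z_near_ridge:
  assumes s: "0 < frac (x \<bullet> z)" and j: "pp x = of_int j * \<delta>"
  shows "frac (x \<bullet> z) < level - \<delta> \<Longrightarrow> \<forall>\<^sub>F y in nhds x. y \<in> Z"
    and "level < frac (x \<bullet> z) \<Longrightarrow> \<forall>\<^sub>F y in nhds x. y \<notin> Z"
    and "level - \<delta> < frac (x \<bullet> z) \<Longrightarrow> frac (x \<bullet> z) < level \<Longrightarrow> \<forall>\<^sub>F y in nhds x. y \<in> Z \<longleftrightarrow> y \<bullet> c \<le> x \<bullet> c"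
proof -
  define n where "n = \<lfloor>x \<bullet> z\<rfloor>"
  define p where "p y = c \<bullet> y - a * of_int n" for y
  define s where "s y = y \<bullet> z - of_int n" for y
  have tp: "(p \<longlongrightarrow> p x) (nhds x)" and ts: "(s \<longlongrightarrow> s x) (nhds x)"
    and tsp: "((\<lambda>y. s y + (p x - p y)) \<longlongrightarrow> s x + (p x - p x)) (nhds x)"
    unfolding p_def s_def by (intro tendsto_intros filterlim_ident)+
  have px: "p x = of_int j * \<delta>" and sx: "s x = frac (x \<bullet> z)"
    using j by (simp_all add: p_def s_def pp_def n_def frac_def)
  have ev1: "\<forall>\<^sub>F y in nhds x. pp y = p y" and ev2: "\<forall>\<^sub>F y in nhds x. frac (y \<bullet> z) = s y"
    using eventually_floor[OF assms(1)] by (eventually_elim, simp add: p_def pp_def s_def n_def frac_def)+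
  have pnear: "\<forall>\<^sub>F y in nhds x. p x - \<delta> < p y" "\<forall>\<^sub>F y in nhds x. p y < p x + \<delta>"
    using order_tendstoD[OF tp] \<delta>(1) by auto
  with ev1 ev2 have mem: "\<forall>\<^sub>F y in nhds x. y \<in> Z \<longleftrightarrow>
      (if p y \<le> p x then s y + (p x - p y) \<le> level else s y + (p x - p y) \<le> level - \<delta>)"
  proof eventually_elim
    case (elim y)
    show ?case
    proof (cases "p y \<le> p x")
      case True
      then have "saw (p y) = of_int j * \<delta> - p y"
        using elim px by (intro saw_eq) (auto simp: algebra_simps)
      then show ?thesis using True elim px by (simp add: Z_def)
    next
      case False
      then have "saw (p y) = of_int (j + 1) * \<delta> - p y"
        using elim px by (intro saw_eq) (auto simp: algebra_simps)
      then have "s y + saw (p y) = s y + (p x - p y) + \<delta>" using px by (simp add: algebra_simps)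
      then show ?thesis using False elim unfolding Z_def mem_Collect_eq by auto
    qed
  qed
  show "\<forall>\<^sub>F y in nhds x. y \<in> Z" if "frac (x \<bullet> z) < level - \<delta>"
  proof -
    have "\<forall>\<^sub>F y in nhds x. s y + (p x - p y) < level - \<delta>"
      using order_tendstoD(2)[OF tsp, of "level - \<delta>"] that sx by auto
    with mem show ?thesis by eventually_elim (use \<delta>(1) in auto)
  qed
  show "\<forall>\<^sub>F y in nhds x. y \<notin> Z" if "level < frac (x \<bullet> z)"
  proof -
    have "\<forall>\<^sub>F y in nhds x. level < s y + (p x - p y)"
      using order_tendstoD(1)[OF tsp, of level] that sx by auto
    with mem show ?thesis by eventually_elim (use \<delta>(1) in auto)
  qed
  show "\<forall>\<^sub>F y in nhds x. y \<in> Z \<longleftrightarrow> y \<bullet> c \<le> x \<bullet> c" if "level - \<delta> < frac (x \<bullet> z)" "frac (x \<bullet> z) < level"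
  proof -
    have "\<forall>\<^sub>F y in nhds x. s y + (p x - p y) < level" "\<forall>\<^sub>F y in nhds x. level - \<delta> < s y + (p x - p y)"
      using order_tendstoD[OF tsp] that sx by auto
    with mem show ?thesis
      by eventually_elim (auto simp: p_def inner_commute)
  qed
qed

end

lemma not_reduced_boundary_locally_trivial:
  assumes "A \<in> sets borel" and "(\<forall>\<^sub>F y in nhds x. y \<in> A) \<or> (\<forall>\<^sub>F y in nhds x. y \<notin> A)"
  shows "x \<notin> reduced_boundary A"
proof -
  from assms(2) obtain r where "0 < r" "(\<forall>y. dist y x < r \<longrightarrow> y \<in> A) \<or> (\<forall>y. dist y x < r \<longrightarrow> y \<notin> A)"
    unfolding eventually_nhds_metric by blast
  then have "0 < r" "ball x r \<subseteq> A \<or> ball x r \<inter> A = {}"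
    by (auto simp: dist_commute)
  then show ?thesis
    using not_outer_normal_at_trivial[OF assms(1)] by (simp add: reduced_boundary_def)
qed

lemma halfplane_ball:
  fixes x v :: "real^2"
  assumes "v \<noteq> 0" and "\<forall>\<^sub>F y in nhds x. y \<in> A \<longleftrightarrow> y \<bullet> v \<le> x \<bullet> v"
  obtains r where "0 < r" "norm (v /\<^sub>R norm v) = 1"
    "\<And>y. y \<in> ball x r \<Longrightarrow> y \<in> A \<longleftrightarrow> y \<bullet> (v /\<^sub>R norm v) \<le> x \<bullet> (v /\<^sub>R norm v)"
proof -
  from assms(2) obtain r where r: "0 < r" "\<And>y. dist y x < r \<Longrightarrow> y \<in> A \<longleftrightarrow> y \<bullet> v \<le> x \<bullet> v"
    unfolding eventually_nhds_metric by blast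
  show ?thesis
  proof (rule that[OF r(1)])
    show "norm (v /\<^sub>R norm v) = 1" using assms(1) by simp
    fix y assume "y \<in> ball x r"
    then have "y \<in> A \<longleftrightarrow> y \<bullet> v \<le> x \<bullet> v" using r(2) by (simp add: dist_commute)
    then show "y \<in> A \<longleftrightarrow> y \<bullet> (v /\<^sub>R norm v) \<le> x \<bullet> (v /\<^sub>R norm v)"
      using assms(1) by simp
  qed
qed

lemma outer_normal_locally_halfplane:
  fixes x v :: "real^2"
  assumes "A \<in> sets borel" "v \<noteq> 0" "\<forall>\<^sub>F y in nhds x. y \<in> A \<longleftrightarrow> y \<bullet> v \<le> x \<bullet> v" "x \<in> reduced_boundary A"
  shows "outer_normal A x = v /\<^sub>R norm v"
  using halfplane_ball[OF assms(2,3)] outer_normal_halfplane[OF assms(1) _ _ _ assms(4)] by metis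

section \<open>Boundary edges of the zigzag set and their normals\<close>

context zigzag begin

definition F where "F = {x. 0 \<le> x \<bullet> z \<and> x \<bullet> z < 1 \<and> 0 \<le> c \<bullet> x \<and> c \<bullet> x < D}"
text \<open>Four families: \<open>B0\<close> the bottom lines, \<open>B1\<close> the edges with
  normal c, \<open>B2\<close> the edges with normal z - c, \<open>V\<close> the corners.\<close>

definition B0 where "B0 = {x. frac (x \<bullet> z) = 0}"
definition B1 where "B1 = {x. saw (pp x) = 0 \<and> level - \<delta> < frac (x \<bullet> z) \<and> frac (x \<bullet> z) < level}"
definition B2 where "B2 = {x. saw (pp x) \<noteq> 0 \<and> frac (x \<bullet> z) + saw (pp x) = level}"
definition V where "V = {x. saw (pp x) = 0 \<and> frac (x \<bullet> z) \<in> {level, level - \<delta>}}"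

lemma fundamental_domain_F: "fundamental_domain F"
  unfolding F_def D_def by (rule fundamental_domain_strip[OF z w D_pos])

lemma c_nonzero: "c \<noteq> 0" and z_nonzero: "z \<noteq> 0" and zc_nonzero: "z - c \<noteq> 0"
proof -
  show "c \<noteq> 0" "z \<noteq> 0" using D_pos w by auto
  show "z - c \<noteq> 0" using D_pos by auto
qed

lemma saw_zero: "saw (pp x) = 0 \<Longrightarrow> \<exists>j::int. pp x = of_int j * \<delta>"
  by (metis eq_iff_diff_eq_0 mult.commute saw_def)

text \<open>For an upper bound of the perimeter an inclusion suffices. At the corners no normal is
  determined; \<open>V\<close> is countable and hence null for length.\<close>

lemma reduced_boundary_Z:
  assumes "x \<in> reduced_boundary Z"
  shows "x \<in> B0 \<and> outer_normal Z x = - z /\<^sub>R norm z \<or> x \<in> B1 \<and> outer_normal Z x = c /\<^sub>R norm c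
    \<or> x \<in> B2 \<and> outer_normal Z x = (z - c) /\<^sub>R norm (z - c) \<or> x \<in> V"
proof (cases "frac (x \<bullet> z) = 0")
  case True
  then show ?thesis
    using outer_normal_locally_halfplane[OF borel_Z _ Z_near_integer[OF True] assms] z_nonzero
    by (simp add: B0_def)
next
  case False
  then have s: "0 < frac (x \<bullet> z)" using frac_ge_0[of "x \<bullet> z"] by linarith
  have nt: "\<not> (\<forall>\<^sub>F y in nhds x. y \<in> Z)" "\<not> (\<forall>\<^sub>F y in nhds x. y \<notin> Z)"
    using not_reduced_boundary_locally_trivial[OF borel_Z] assms by blast+
  show ?thesis
  proof (cases "saw (pp x) = 0")
    case saw0: True
    then obtain j :: int where j: "pp x = of_int j * \<delta>" using saw_zero by blast
    from Z_near_ridge[OF s j] nt have "level - \<delta> \<le> frac (x \<bullet> z)" "frac (x \<bullet> z) \<le> level"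
      by (auto simp: not_less[symmetric])
    then consider "frac (x \<bullet> z) \<in> {level, level - \<delta>}" | "level - \<delta> < frac (x \<bullet> z)" "frac (x \<bullet> z) < level"
      by fastforce
    then show ?thesis
    proof cases
      case 1
      then show ?thesis using saw0 by (simp add: V_def)
    next
      case 2
      have "outer_normal Z x = c /\<^sub>R norm c"
        by (rule outer_normal_locally_halfplane[OF borel_Z c_nonzero Z_near_ridge(3)[OF s j 2] assms])
      then show ?thesis using 2 saw0 by (simp add: B1_def)
    qed
  next
    case saw0: False
    obtain j :: int where j: "(of_int j - 1) * \<delta> < pp x" "pp x \<le> of_int j * \<delta>" using saw_cell by blast
    have "saw (pp x) = of_int j * \<delta> - pp x" by (rule saw_eq[OF j])
    then have j': "pp x < of_int j * \<delta>" using saw0 j(2) by linarith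
    note near = Z_near_smooth[OF s j(1) j']
    have t: "((\<lambda>y. y \<bullet> (z - c)) \<longlongrightarrow> x \<bullet> (z - c)) (nhds x)"
      by (intro tendsto_intros filterlim_ident)
    consider "frac (x \<bullet> z) + saw (pp x) < level" | "level < frac (x \<bullet> z) + saw (pp x)"
      | "frac (x \<bullet> z) + saw (pp x) = level" by linarith
    then show ?thesis
    proof cases
      case 1
      then have "\<forall>\<^sub>F y in nhds x. y \<bullet> (z - c) < x \<bullet> (z - c) + (level - (frac (x \<bullet> z) + saw (pp x)))"
        by (intro order_tendstoD(2)[OF t]) linarith
      with near have "\<forall>\<^sub>F y in nhds x. y \<in> Z" by eventually_elim auto
      with nt show ?thesis by blast
    next
      case 2
      then have "\<forall>\<^sub>F y in nhds x. x \<bullet> (z - c) + (level - (frac (x \<bullet> z) + saw (pp x))) < y \<bullet> (z - c)"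
        by (intro order_tendstoD(1)[OF t]) linarith
      with near have "\<forall>\<^sub>F y in nhds x. y \<notin> Z" by eventually_elim auto
      with nt show ?thesis by blast
    next
      case 3
      with near have "\<forall>\<^sub>F y in nhds x. y \<in> Z \<longleftrightarrow> y \<bullet> (z - c) \<le> x \<bullet> (z - c)" by simp
      from outer_normal_locally_halfplane[OF borel_Z zc_nonzero this assms] show ?thesis
        using 3 saw0 by (simp add: B2_def)
    qed
  qed
qed

text \<open>The point with \<open>x \<bullet> z = s\<close> and \<open>c \<bullet> x = q\<close>.\<close>

definition pt where "pt s q = (q / D) *\<^sub>R rot90 z - (s / D) *\<^sub>R rot90 c"

lemma rot90_c_z: "rot90 c \<bullet> z = - D"
  by (simp add: D_def inner_real2)

lemma pt_inner: "pt s q \<bullet> z = s" "c \<bullet> pt s q = q"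
  using D by (simp_all add: pt_def inner_diff_left inner_diff_right rot90_c_z D_def[symmetric])

lemma coordinates_inj:
  assumes "x \<bullet> z = y \<bullet> z" "c \<bullet> x = c \<bullet> y"
  shows "x = y"
proof -
  let ?v = "x - y"
  have "?v \<bullet> z = 0" "c \<bullet> ?v = 0" using assms by (simp_all add: inner_diff_left inner_diff_right)
  moreover from this have "?v \<bullet> rot90 z = 0" using inner_decomp[of ?v] D by simp
  moreover have "(?v \<bullet> z)\<^sup>2 + (?v \<bullet> rot90 z)\<^sup>2 = (z \<bullet> z) * (?v \<bullet> ?v)"
    unfolding inner_real2 rot90_nth by algebra
  ultimately show ?thesis using zz by simp
qed

lemma eq_pt: "x = pt (x \<bullet> z) (c \<bullet> x)"
  by (rule coordinates_inj) (simp_all add: pt_inner)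

lemma pt_line: "pt (s + t * s') (q + t * q') = pt s q + t *\<^sub>R pt s' q'"
  by (simp add: pt_def algebra_simps add_divide_distrib)

lemma norm_pt: "norm (pt 0 q) = \<bar>q\<bar> / D * norm z" "norm (pt s 0) = \<bar>s\<bar> / D * norm c"
  "norm (pt s s) = \<bar>s\<bar> / D * norm (z - c)"
proof -
  have "pt s s = (s / D) *\<^sub>R rot90 (z - c)" by (simp add: pt_def real2_eq_iff algebra_simps)
  then show "norm (pt s s) = \<bar>s\<bar> / D * norm (z - c)" using D by simp
qed (use D in \<open>simp_all add: pt_def\<close>)

lemma countable_V: "countable V"
proof -
  let ?S = "(\<lambda>(n :: int, j :: int, b). (of_int n + (if b then level else level - \<delta>), of_int j * \<delta> + a * of_int n)) ` UNIV"
  have "(x \<bullet> z, c \<bullet> x) \<in> ?S" if x: "x \<in> V" for x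
  proof -
    obtain j :: int where j: "pp x = of_int j * \<delta>" using x saw_zero by (auto simp: V_def)
    have "frac (x \<bullet> z) = (if frac (x \<bullet> z) = level then level else level - \<delta>)" using x by (auto simp: V_def)
    then obtain b where "frac (x \<bullet> z) = (if b then level else level - \<delta>)" by blast
    then have "(x \<bullet> z, c \<bullet> x) = (\<lambda>(n :: int, j :: int, b). (of_int n + (if b then level else level - \<delta>),
        of_int j * \<delta> + a * of_int n)) (\<lfloor>x \<bullet> z\<rfloor>, j, b)"
      using j by (simp add: frac_def pp_def algebra_simps)
    then show ?thesis by blast
  qed
  then have "(\<lambda>x. (x \<bullet> z, c \<bullet> x)) ` V \<subseteq> ?S" by blast
  moreover have "countable ?S" by simp
  ultimately have "countable ((\<lambda>x. (x \<bullet> z, c \<bullet> x)) ` V)" by (rule countable_subset)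
  then show ?thesis
    by (rule countable_image_inj_on) (auto intro: inj_onI coordinates_inj)
qed

section \<open>Lengths of the edges in one period\<close>

lemma borel_edges [measurable]: "B0 \<in> sets borel" "B1 \<in> sets borel" "B2 \<in> sets borel" "F \<in> sets borel"
  unfolding B0_def B1_def B2_def F_def frac_def by measurable

lemma periodic_edges: "periodic B0" "periodic B1" "periodic B2"
  by (simp_all add: periodic_def B0_def B1_def B2_def frac_lattice saw_pp_lattice del: frac_eq_0_iff)

lemma F_simps: "x \<in> F \<Longrightarrow> frac (x \<bullet> z) = x \<bullet> z" "x \<in> F \<Longrightarrow> pp x = c \<bullet> x"
proof -
  assume "x \<in> F"
  then have "\<lfloor>x \<bullet> z\<rfloor> = 0" by (intro floor_unique) (auto simp: F_def)
  then show "frac (x \<bullet> z) = x \<bullet> z" "pp x = c \<bullet> x" by (simp_all add: frac_def pp_def)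
qed

text \<open>\<open>z \<bullet> z\<close> is an integer because z is a lattice vector, so one period
  holds a whole number of teeth.\<close>

lemma period_count: "\<exists>J::nat. D = \<delta> * real J"
proof -
  obtain i where i: "z \<bullet> z = of_int i" using lattice_inner_Ints[OF z z] by (auto elim: Ints_cases)
  then have "real (nat i) = z \<bullet> z" using zz by simp
  then have "D = \<delta> * real (k * nat i)" by (simp add: D_eq)
  then show ?thesis by blast
qed

lemma length_B0: "emeasure hausdorff1 (B0 \<inter> F) \<le> ennreal (norm z)"
proof -
  have "B0 \<inter> F \<subseteq> {0 + t *\<^sub>R pt 0 D | t. 0 \<le> t \<and> t \<le> 1}"
  proof
    fix x assume x: "x \<in> B0 \<inter> F"
    then have "x \<bullet> z = 0" using F_simps(1)[of x] by (simp add: B0_def del: frac_eq_0_iff)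
    then have "x = pt (0 + (c \<bullet> x / D) * 0) (0 + (c \<bullet> x / D) * D)"
      using eq_pt[of x] D by simp
    then have "x = 0 + (c \<bullet> x / D) *\<^sub>R pt 0 D" unfolding pt_line by (simp add: pt_def)
    moreover have "0 \<le> c \<bullet> x / D" "c \<bullet> x / D \<le> 1" using x D by (auto simp: F_def)
    ultimately show "x \<in> {0 + t *\<^sub>R pt 0 D | t. 0 \<le> t \<and> t \<le> 1}" by blast
  qed
  then have "hausdorff1_outer (B0 \<inter> F) \<le> ennreal (norm (pt 0 D))"
    by (rule hausdorff1_segment_le)
  then show ?thesis using D by (simp add: emeasure_hausdorff1 norm_pt)
qed

lemma length_teeth_le:
  assumes X: "\<And>j. j < J \<Longrightarrow> X j \<in> sets borel" "\<And>j. j < J \<Longrightarrow> X j \<subseteq> {p j + t *\<^sub>R d | t. 0 \<le> t \<and> t \<le> 1}"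
    and d: "real J * norm d = l" and B: "B \<subseteq> (\<Union>j<J. X j)"
  shows "emeasure hausdorff1 B \<le> ennreal l"
proof -
  have "emeasure hausdorff1 B \<le> emeasure hausdorff1 (\<Union>j<J. X j)"
    using B X by (intro emeasure_mono) auto
  also have "\<dots> \<le> (\<Sum>j<J. emeasure hausdorff1 (X j))"
    using X by (intro emeasure_subadditive_finite) auto
  also have "\<dots> \<le> (\<Sum>j<J. ennreal (norm d))"
  proof (rule sum_mono)
    fix j assume "j \<in> {..<J}"
    then show "emeasure hausdorff1 (X j) \<le> ennreal (norm d)"
      using hausdorff1_segment_le[OF X(2)[of j]] X(1)[of j] by (simp add: emeasure_hausdorff1)
  qed
  also have "\<dots> = ennreal l" using d by (simp add: ennreal_of_nat_eq_real_of_nat ennreal_mult[symmetric])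
  finally show ?thesis .
qed

text \<open>Each of the J = D / \<delta> edges is a translate of the segment along
  \<open>pt \<delta> 0\<close>, of length \<delta> / D * norm c. The total is therefore independent
  of the tooth size.\<close>

lemma length_B1: "emeasure hausdorff1 (B1 \<inter> F) \<le> ennreal (norm c)"
proof -
  obtain J :: nat where J: "D = \<delta> * real J" using period_count by blast
  show ?thesis
  proof (rule length_teeth_le[where d = "pt \<delta> 0" and p = "\<lambda>j. pt (level - \<delta>) (real j * \<delta>)"
        and J = J and X = "\<lambda>j. B1 \<inter> F \<inter> {x. c \<bullet> x = real j * \<delta>}"])
    have "real J \<noteq> 0" using D J by (metis less_irrefl mult_zero_right)
    then show "real J * norm (pt \<delta> 0) = norm (c)" using \<delta>(1) by (simp add: norm_pt J)
    show "B1 \<inter> F \<subseteq> (\<Union>j<J. B1 \<inter> F \<inter> {x. c \<bullet> x = real j * \<delta>})"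
    proof
      fix x assume x: "x \<in> B1 \<inter> F"
      then obtain j :: int where j: "c \<bullet> x = of_int j * \<delta>"
        using saw_zero[of x] F_simps(2)[of x] by (auto simp: B1_def)
      then have "0 \<le> of_int j * \<delta>" "of_int j * \<delta> < real J * \<delta>" using x J by (auto simp: F_def mult.commute)
      then have "0 \<le> j" "j < int J" using \<delta>(1) by (auto simp: zero_le_mult_iff)
      then have "nat j < J" "c \<bullet> x = real (nat j) * \<delta>" using j by auto
      with x show "x \<in> (\<Union>j<J. B1 \<inter> F \<inter> {x. c \<bullet> x = real j * \<delta>})" by blast
    qed
    fix j assume "j < J"
    show "B1 \<inter> F \<inter> {x. c \<bullet> x = real j * \<delta>} \<in> sets borel" by measurable
    show "B1 \<inter> F \<inter> {x. c \<bullet> x = real j * \<delta>} \<subseteq> {pt (level - \<delta>) (real j * \<delta>) + t *\<^sub>R pt \<delta> 0 | t. 0 \<le> t \<and> t \<le> 1}"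
    proof
      fix x assume x: "x \<in> B1 \<inter> F \<inter> {x. c \<bullet> x = real j * \<delta>}"
      define t where "t = (x \<bullet> z - (level - \<delta>)) / \<delta>"
      have "0 \<le> t" "t \<le> 1" using x F_simps(1)[of x] \<delta>(1) by (auto simp: t_def B1_def divide_le_eq)
      moreover have "x = pt (level - \<delta> + t * \<delta>) (real j * \<delta> + t * 0)"
        using eq_pt[of x] x \<delta>(1) by (simp add: t_def)
      then have "x = pt (level - \<delta>) (real j * \<delta>) + t *\<^sub>R pt \<delta> 0" unfolding pt_line .
      ultimately show "x \<in> {pt (level - \<delta>) (real j * \<delta>) + t *\<^sub>R pt \<delta> 0 | t. 0 \<le> t \<and> t \<le> 1}" by blast
    qed
  qed
qed

lemma length_B2: "emeasure hausdorff1 (B2 \<inter> F) \<le> ennreal (norm (z - c))"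
proof -
  obtain J :: nat where J: "D = \<delta> * real J" using period_count by blast
  show ?thesis
  proof (rule length_teeth_le[where d = "pt \<delta> \<delta>" and p = "\<lambda>j. pt (level - \<delta>) (real j * \<delta>)"
        and J = J and X = "\<lambda>j. B2 \<inter> F \<inter> {x. real j * \<delta> < c \<bullet> x \<and> c \<bullet> x \<le> (real j + 1) * \<delta>}"])
    have "real J \<noteq> 0" using D J by (metis less_irrefl mult_zero_right)
    then show "real J * norm (pt \<delta> \<delta>) = norm (z - c)" using \<delta>(1) by (simp add: norm_pt J)
    show "B2 \<inter> F \<subseteq> (\<Union>j<J. B2 \<inter> F \<inter> {x. real j * \<delta> < c \<bullet> x \<and> c \<bullet> x \<le> (real j + 1) * \<delta>})"
    proof
      fix x assume x: "x \<in> B2 \<inter> F"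
      obtain j :: int where j: "(of_int j - 1) * \<delta> < c \<bullet> x" "c \<bullet> x \<le> of_int j * \<delta>" using saw_cell by blast
      have cx: "0 \<le> c \<bullet> x" "c \<bullet> x < real J * \<delta>" using x J by (auto simp: F_def mult.commute)
      \<comment> \<open>On \<open>B2\<close> the sawtooth is nonzero, which excludes the left end of
        the period and with it the cell j = 0.\<close>
      have "c \<bullet> x \<noteq> 0" using x F_simps(2)[of x] by (auto simp: B2_def saw_def)
      then have "0 < of_int j * \<delta>" using cx j by linarith
      then have "0 < j" using \<delta>(1) by (simp add: zero_less_mult_iff)
      have "(of_int j - 1) * \<delta> < real J * \<delta>" using cx j by linarith
      then have "of_int j - 1 < real J" using \<delta>(1) by simp
      \<comment> \<open>\<open>saw_cell\<close> numbers the cells by their right ends, the teeth are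
        numbered by their left ends.\<close>
      then have "nat (j - 1) < J" "real (nat (j - 1)) = of_int j - 1" using \<open>0 < j\<close> by auto
      with x j show "x \<in> (\<Union>j<J. B2 \<inter> F \<inter> {x. real j * \<delta> < c \<bullet> x \<and> c \<bullet> x \<le> (real j + 1) * \<delta>})"
        by (intro UN_I[of "nat (j - 1)"]) auto
    qed
    fix j assume "j < J"
    show "B2 \<inter> F \<inter> {x. real j * \<delta> < c \<bullet> x \<and> c \<bullet> x \<le> (real j + 1) * \<delta>} \<in> sets borel" by measurable
    show "B2 \<inter> F \<inter> {x. real j * \<delta> < c \<bullet> x \<and> c \<bullet> x \<le> (real j + 1) * \<delta>}
        \<subseteq> {pt (level - \<delta>) (real j * \<delta>) + t *\<^sub>R pt \<delta> \<delta> | t. 0 \<le> t \<and> t \<le> 1}"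
    proof
      fix x assume x: "x \<in> B2 \<inter> F \<inter> {x. real j * \<delta> < c \<bullet> x \<and> c \<bullet> x \<le> (real j + 1) * \<delta>}"
      define t where "t = (c \<bullet> x - real j * \<delta>) / \<delta>"
      have td: "c \<bullet> x = real j * \<delta> + t * \<delta>" using \<delta>(1) by (simp add: t_def)
      have "saw (c \<bullet> x) = of_int (int j + 1) * \<delta> - c \<bullet> x" using x by (intro saw_eq) auto
      also have "\<dots> = \<delta> - t * \<delta>" by (simp add: td algebra_simps)
      finally have "saw (c \<bullet> x) = \<delta> - t * \<delta>" .
      moreover have "x \<bullet> z + saw (c \<bullet> x) = level" using x F_simps[of x] by (simp add: B2_def)
      ultimately have "x \<bullet> z = level - \<delta> + t * \<delta>" by linarith
      moreover note td
      ultimately have "x = pt (level - \<delta> + t * \<delta>) (real j * \<delta> + t * \<delta>)"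
        using eq_pt[of x] by simp
      then have "x = pt (level - \<delta>) (real j * \<delta>) + t *\<^sub>R pt \<delta> \<delta>" unfolding pt_line .
      moreover have "0 \<le> t" "t \<le> 1" using x \<delta>(1) by (auto simp: t_def divide_le_eq algebra_simps)
      ultimately show "x \<in> {pt (level - \<delta>) (real j * \<delta>) + t *\<^sub>R pt \<delta> \<delta> | t. 0 \<le> t \<and> t \<le> 1}" by blast
    qed
  qed
qed

end

section \<open>Equality of the areas of zigzag and lamella\<close>

lemma emeasure_lborel_point_reflection:
  fixes p :: "'a::euclidean_space"
  assumes "B \<in> sets borel"
  shows "emeasure lborel ((\<lambda>x. p - x) -` B) = emeasure lborel B"
proof -
  have "lborel = density (distr lborel borel (\<lambda>x. p + (- 1) *\<^sub>R x)) (\<lambda>_. ennreal (\<bar>- 1\<bar> ^ DIM('a)))"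
    by (rule lborel_affine) simp
  then have "distr lborel borel (\<lambda>x. p - x) = lborel" by (simp add: density_1)
  then have "emeasure lborel B = emeasure (distr lborel borel (\<lambda>x. p - x)) B" by simp
  also have "\<dots> = emeasure lborel ((\<lambda>x. p - x) -` B)"
    using assms by (subst emeasure_distr) auto
  finally show ?thesis by simp
qed

lemma fundamental_domain_reflection:
  assumes "fundamental_domain F"
  shows "fundamental_domain ((\<lambda>x. p - x) -` F)"
  unfolding fundamental_domain_def
proof (intro conjI allI)
  have "(\<lambda>x. p - x) \<in> borel_measurable borel" by measurable
  from measurable_sets[OF this, of F] show "(\<lambda>x. p - x) -` F \<in> sets borel"
    using fundamental_domain_borel[OF assms] by simp
  fix x
  obtain \<zeta> where \<zeta>: "\<zeta> \<in> lattice" "(p - x) + \<zeta> \<in> F"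
    using fundamental_domain_ex[OF assms] by blast
  show "\<exists>!\<zeta>. \<zeta> \<in> lattice \<and> x + \<zeta> \<in> (\<lambda>x. p - x) -` F"
  proof (rule ex1I[of _ "- \<zeta>"])
    show "- \<zeta> \<in> lattice \<and> x + - \<zeta> \<in> (\<lambda>x. p - x) -` F" using \<zeta> by (simp add: algebra_simps)
    fix \<xi> assume "\<xi> \<in> lattice \<and> x + \<xi> \<in> (\<lambda>x. p - x) -` F"
    then have "- \<xi> \<in> lattice" "(p - x) + - \<xi> \<in> F" by (simp_all add: algebra_simps)
    then have "- \<xi> = \<zeta>" using fundamental_domain_unique[OF assms] \<zeta> by blast
    then show "\<xi> = - \<zeta>" by auto
  qed
qed

lemma equiv_up_to_translation_lift:
  assumes "periodic A" "periodic B" "equiv_up_to_translation (proj ` A) (proj ` B)"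
  shows "\<exists>v. negligible (sym_diff ((+) v ` A) B)"
proof -
  have "proj -` sym_diff X Y = sym_diff (proj -` X) (proj -` Y)" for X Y by auto
  then show ?thesis
    using assms(3) by (simp add: equiv_up_to_translation_def vimage_proj_torus_translate
        vimage_proj_image[OF assms(1)] vimage_proj_image[OF assms(2)] negligible_iff_null_sets)
qed

text \<open>The gaps between the intervals from n to n + L have length 1 - L, so a longer open
  interval does not fit into a gap.\<close>

lemma exists_frac_in_interval:
  fixes \<alpha> \<beta> L :: real
  assumes "0 < L" "L \<le> 1" "\<alpha> < \<beta>" "1 - L < \<beta> - \<alpha>"
  shows "\<exists>t. \<alpha> < t \<and> t < \<beta> \<and> 0 < frac t \<and> frac t < L"
proof -
  define n where "n = \<lfloor>\<alpha>\<rfloor>"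
  have n: "of_int n \<le> \<alpha>" "\<alpha> < of_int n + 1" unfolding n_def by linarith+
  have *: "\<exists>t. \<alpha> < t \<and> t < \<beta> \<and> 0 < frac t \<and> frac t < L"
    if m: "max \<alpha> (of_int m) < min \<beta> (of_int m + L)" for m :: int
  proof -
    obtain t where t: "max \<alpha> (of_int m) < t" "t < min \<beta> (of_int m + L)" using dense[OF m] by blast
    then have "\<lfloor>t\<rfloor> = m" using assms by (intro floor_unique) auto
    then have "frac t = t - of_int m" by (simp add: frac_def)
    then show ?thesis using t by (intro exI[of _ t]) auto
  qed
  show ?thesis
  proof (cases "\<alpha> < of_int n + L")
    case True
    then show ?thesis using n assms by (intro *[of n]) auto
  next
    case False
    then show ?thesis using n assms by (intro *[of "n + 1"]) auto
  qed
qed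

context zigzag begin

definition S where "S = {x. frac (x \<bullet> z) \<le> M}"

lemma borel_S [measurable]: "S \<in> sets borel"
  unfolding S_def frac_def by measurable

lemma periodic_S: "periodic S"
  by (simp add: periodic_def S_def frac_lattice)

lemma saw_uminus: "saw y \<noteq> 0 \<Longrightarrow> saw (- y) = \<delta> - saw y"
proof -
  assume y: "saw y \<noteq> 0"
  obtain j :: int where j: "(of_int j - 1) * \<delta> < y" "y \<le> of_int j * \<delta>" using saw_cell by blast
  have s: "saw y = of_int j * \<delta> - y" by (rule saw_eq[OF j])
  then have "y < of_int j * \<delta>" using y j(2) by linarith
  then have "saw (- y) = of_int (1 - j) * \<delta> - (- y)"
    using j by (intro saw_eq) (auto simp: algebra_simps)
  then show ?thesis by (simp add: s algebra_simps)
qed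

text \<open>Off this null set the inequalities defining Z and S are never equalities and
  \<open>saw\<close> is away from its jumps, as the reflection argument requires.\<close>

definition exceptional where
  "exceptional = {x. saw (pp x) = 0 \<or> frac (x \<bullet> z) + saw (pp x) = level \<or> frac (x \<bullet> z) = M}"

lemma borel_exceptional [measurable]: "exceptional \<in> sets borel"
  unfolding exceptional_def frac_def by measurable

text \<open>Each of the three conditions confines the point to countably many lines, indexed by
  strip and tooth.\<close>

lemma null_exceptional: "exceptional \<in> null_sets lborel"
proof -
  define H where "H p = (case p of (n :: int, j :: int) \<Rightarrow> {x. c \<bullet> x = of_int j * \<delta> + a * of_int n}
      \<union> {x. (z - c) \<bullet> x = level + of_int n - of_int j * \<delta> - a * of_int n} \<union> {x. z \<bullet> x = of_int n + M})" for p
  have neg: "negligible (H p)" for p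
    unfolding H_def using c_nonzero z_nonzero zc_nonzero
    by (cases p) (simp only: prod.case negligible_Un negligible_hyperplane simp_thms)
  have "exceptional \<subseteq> (\<Union>p. H p)"
  proof
    fix x assume x: "x \<in> exceptional"
    obtain j :: int where j: "(of_int j - 1) * \<delta> < pp x" "pp x \<le> of_int j * \<delta>" using saw_cell by blast
    have s: "saw (pp x) = of_int j * \<delta> - pp x" by (rule saw_eq[OF j])
    have "x \<in> H (\<lfloor>x \<bullet> z\<rfloor>, j)"
      using x s by (auto simp: H_def exceptional_def pp_def frac_def inner_diff_left inner_commute[of z])
    then show "x \<in> (\<Union>p. H p)" by blast
  qed
  moreover have "negligible (\<Union>p. H p)"
    using negligible_countable_Union[of "range H"] neg by auto
  ultimately have "negligible exceptional" by (rule negligible_subset[rotated])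
  then show ?thesis
    by (simp add: negligible_iff_null_sets null_sets_completion_iff)
qed

text \<open>The point reflection in a midpoint of an edge of type \<open>B1\<close> exchanges the parts of the teeth
  above and below the line \<open>x \<bullet> z = M\<close>.\<close>

lemma reflect_teeth:
  defines "\<rho> \<equiv> \<lambda>x. pt (2 * M) 0 - x"
  shows "x \<in> (Z - S) - exceptional \<longleftrightarrow> \<rho> x \<in> (S - Z) - exceptional"
proof -
  have flip: "frac (\<rho> x \<bullet> z) = 2 * M - frac (x \<bullet> z) \<and> saw (pp (\<rho> x)) = \<delta> - saw (pp x)"
    if s: "level - \<delta> < frac (x \<bullet> z)" "frac (x \<bullet> z) < level" and "saw (pp x) \<noteq> 0" for x
  proof -
    define n where "n = \<lfloor>x \<bullet> z\<rfloor>"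
    have \<rho>z: "\<rho> x \<bullet> z = 2 * M - x \<bullet> z" by (simp add: \<rho>_def inner_diff_left pt_inner)
    \<comment> \<open>The map sending h to 2 * M - h preserves the open interval from
      \<open>level - \<delta>\<close> to \<open>level\<close>, which lies inside the unit
      interval.\<close>
    have "\<lfloor>\<rho> x \<bullet> z\<rfloor> = - n"
      using s \<delta> by (intro floor_unique) (simp_all add: \<rho>z level_def frac_def n_def)
    then have "frac (\<rho> x \<bullet> z) = 2 * M - frac (x \<bullet> z)" "pp (\<rho> x) = - pp x"
      by (simp_all add: frac_def \<rho>z n_def pp_def) (simp add: \<rho>_def inner_diff_right pt_inner)
    then show ?thesis using saw_uminus[OF that(3)] by simp
  qed
  have dir1: "\<rho> x \<in> (S - Z) - exceptional" if "x \<in> (Z - S) - exceptional" for x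
  proof -
    have x: "M < frac (x \<bullet> z)" "frac (x \<bullet> z) + saw (pp x) < level" "saw (pp x) \<noteq> 0"
      using that by (auto simp: Z_def S_def exceptional_def)
    have "level - \<delta> < frac (x \<bullet> z)" "frac (x \<bullet> z) < level"
      using x saw_bounds[of "pp x"] \<delta>(1) by (auto simp: level_def)
    from flip[OF this x(3)] show ?thesis
      using x saw_bounds[of "pp x"] by (auto simp: Z_def S_def exceptional_def level_def)
  qed
  have dir2: "\<rho> x \<in> (Z - S) - exceptional" if "x \<in> (S - Z) - exceptional" for x
  proof -
    have x: "frac (x \<bullet> z) < M" "level < frac (x \<bullet> z) + saw (pp x)" "saw (pp x) \<noteq> 0"
      using that by (auto simp: Z_def S_def exceptional_def)
    have "level - \<delta> < frac (x \<bullet> z)" "frac (x \<bullet> z) < level"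
      using x saw_bounds[of "pp x"] \<delta>(1) by (auto simp: level_def)
    from flip[OF this x(3)] show ?thesis
      using x saw_bounds[of "pp x"] by (auto simp: Z_def S_def exceptional_def level_def)
  qed
  have "\<rho> (\<rho> x) = x" by (simp add: \<rho>_def)
  then show ?thesis using dir1[of x] dir2[of "\<rho> x"] by metis
qed

text \<open>The reflection exchanges Z - S and S - Z up to a null set but also moves the fundamental
  domain; by periodicity the moved domain can be replaced by \<open>F\<close>.\<close>

lemma torus_area_Z: "torus_area (proj ` Z) = torus_area (proj ` S)"
proof -
  note [measurable] = borel_Z
  let ?\<rho> = "\<lambda>x. pt (2 * M) 0 - x"
  let ?X = "(Z - S) - exceptional" and ?Y = "(S - Z) - exceptional"
  have per: "periodic ?X"
    by (simp add: periodic_def Z_def S_def exceptional_def frac_lattice saw_pp_lattice)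
  have X: "?X \<in> sets borel" and \<rho>F: "?\<rho> -` F \<in> sets borel"
    using fundamental_domain_borel[OF fundamental_domain_reflection[OF fundamental_domain_F]] by simp_all
  have invol: "?\<rho> (?\<rho> x) = x" for x by simp
  have "?Y \<inter> F = ?\<rho> -` (?X \<inter> ?\<rho> -` F)"
  proof (rule set_eqI)
    fix y
    have "?\<rho> y \<in> ?X \<longleftrightarrow> y \<in> ?Y" using reflect_teeth[of "?\<rho> y"] by (simp only: invol)
    then show "y \<in> ?Y \<inter> F \<longleftrightarrow> y \<in> ?\<rho> -` (?X \<inter> ?\<rho> -` F)" by (simp only: Int_iff vimage_eq invol)
  qed
  then have "emeasure lborel (?Y \<inter> F) = emeasure lborel (?X \<inter> ?\<rho> -` F)"
    using X \<rho>F by (simp only: emeasure_lborel_point_reflection sets.Int)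
  also have "\<dots> = emeasure lborel (?X \<inter> F)"
    by (rule fundamental_domain_lborel_eq[OF X per fundamental_domain_reflection[OF fundamental_domain_F] fundamental_domain_F])
  finally have eq: "emeasure lborel (?Y \<inter> F) = emeasure lborel (?X \<inter> F)" .
  have split: "emeasure lborel (A \<inter> F) = emeasure lborel (A \<inter> B \<inter> F) + emeasure lborel ((A - B - exceptional) \<inter> F)"
    if [measurable]: "A \<in> sets borel" "B \<in> sets borel" for A B
  proof -
    have "emeasure lborel ((A - B - exceptional) \<inter> F) = emeasure lborel ((A - B) \<inter> F - exceptional)"
      by (rule arg_cong[of _ _ "emeasure lborel"]) auto
    also have "\<dots> = emeasure lborel ((A - B) \<inter> F)"
      using null_exceptional by (rule emeasure_Diff_null_set) measurable
    also have "emeasure lborel (A \<inter> B \<inter> F) + \<dots> = emeasure lborel (A \<inter> B \<inter> F \<union> (A - B) \<inter> F)"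
      by (rule plus_emeasure) auto
    also have "A \<inter> B \<inter> F \<union> (A - B) \<inter> F = A \<inter> F" by auto
    finally show ?thesis by simp
  qed
  have "emeasure lborel (Z \<inter> F) = emeasure lborel (S \<inter> F)"
    using split[OF borel_Z borel_S] split[OF borel_S borel_Z] eq by (simp add: Int_commute)
  then show ?thesis
    by (simp add: torus_area_proj_image[OF borel_Z periodic_Z fundamental_domain_F]
        torus_area_proj_image[OF borel_S periodic_S fundamental_domain_F] measure_def)
qed

section \<open>The width of the gaps of the zigzag set\<close>

lemma Z_gap: "x \<in> Z \<Longrightarrow> frac (x \<bullet> z) \<le> level"
  using saw_bounds(1)[of "pp x"] by (simp add: Z_def)

text \<open>\<open>Z\<close> has gaps where the fractional part exceeds \<open>level\<close>, and by
  this lemma no wider open strip is free of Z up to null sets. The gap width 1 -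
  \<open>level\<close> is what tells zigzags apart modulo translations.\<close>

lemma Z_strip_not_negligible:
  assumes "\<alpha> < \<beta>" "1 - level < \<beta> - \<alpha>"
  shows "\<not> negligible (Z \<inter> {x. \<alpha> < x \<bullet> z \<and> x \<bullet> z < \<beta>})"
proof
  assume neg: "negligible (Z \<inter> {x. \<alpha> < x \<bullet> z \<and> x \<bullet> z < \<beta>})"
  have "0 < level" "level \<le> 1" using level \<delta>(1) by auto
  then obtain t where t: "\<alpha> < t" "t < \<beta>" "0 < frac t" "frac t < level"
    using exists_frac_in_interval[of level \<alpha> \<beta>] assms by auto
  \<comment> \<open>The witness lies just before a jump, where \<open>saw\<close> has the small
    value \<eta>; this leaves it strictly below \<open>level\<close> and hence interior to
    Z.\<close>
  define \<eta> where "\<eta> = min \<delta> (level - frac t) / 2"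
  have \<eta>: "0 < \<eta>" "\<eta> < \<delta>" "frac t + \<eta> < level"
    using \<delta>(1) t by (auto simp: \<eta>_def min_def field_simps)
  define x where "x = pt t (a * of_int \<lfloor>t\<rfloor> - \<eta>)"
  have xz: "x \<bullet> z = t" and px: "pp x = - \<eta>" by (simp_all add: x_def pt_inner pp_def)
  have j: "(of_int 0 - 1) * \<delta> < pp x" "pp x < of_int 0 * \<delta>" using \<eta> by (simp_all add: px)
  have sx: "saw (pp x) = \<eta>" using saw_eq[of 0 "pp x"] j by (simp add: px)
  have t1: "((\<lambda>y. y \<bullet> (z - c)) \<longlongrightarrow> x \<bullet> (z - c)) (nhds x)" and t2: "((\<lambda>y. y \<bullet> z) \<longlongrightarrow> x \<bullet> z) (nhds x)"
    by (intro tendsto_intros filterlim_ident)+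
  have "\<forall>\<^sub>F y in nhds x. y \<bullet> (z - c) < x \<bullet> (z - c) + (level - (frac (x \<bullet> z) + saw (pp x)))"
    using \<eta>(3) by (intro order_tendstoD(2)[OF t1]) (simp add: xz sx)
  moreover have "\<forall>\<^sub>F y in nhds x. \<alpha> < y \<bullet> z" "\<forall>\<^sub>F y in nhds x. y \<bullet> z < \<beta>"
    using order_tendstoD[OF t2] t by (auto simp: xz)
  moreover have "\<forall>\<^sub>F y in nhds x. y \<in> Z \<longleftrightarrow> y \<bullet> (z - c) \<le> x \<bullet> (z - c) + (level - (frac (x \<bullet> z) + saw (pp x)))"
    using t(3) by (intro Z_near_smooth[OF _ j]) (simp add: xz)
  ultimately have "\<forall>\<^sub>F y in nhds x. y \<in> Z \<inter> {x. \<alpha> < x \<bullet> z \<and> x \<bullet> z < \<beta>}"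
    by eventually_elim auto
  then obtain U where U: "open U" "x \<in> U" "U \<subseteq> Z \<inter> {x. \<alpha> < x \<bullet> z \<and> x \<bullet> z < \<beta>}"
    unfolding eventually_nhds by blast
  then show False
    using negligible_subset[OF neg U(3)] open_not_negligible[of U] by blast
qed

section \<open>Comparison of the perimeters\<close>

lemma aniso_perimeter_Z_le:
  assumes nonneg: "\<And>y. 0 \<le> \<phi> y" and hom: "\<And>r y. 0 \<le> r \<Longrightarrow> \<phi> (r *\<^sub>R y) = r * \<phi> y"
  shows "aniso_perimeter \<phi> (proj ` Z) \<le> ennreal (\<phi> (- z)) + ennreal (\<phi> c) + ennreal (\<phi> (z - c))"
proof -
  let ?n = "\<lambda>v :: real^2. v /\<^sub>R norm v"
  let ?Q = unit_square
  note [measurable] = fundamental_domain_borel[OF fundamental_domain_unit_square]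
  \<comment> \<open>An edge family with normal direction v has length norm v per period, so
    homogeneity turns length times density into the value of \<open>\<phi>\<close> at v
    itself.\<close>
  have scale: "ennreal (\<phi> (?n v)) * ennreal (norm v) = ennreal (\<phi> v)" if "v \<noteq> 0" for v
    using hom[of "norm v" "?n v"] nonneg that by (simp add: ennreal_mult[symmetric] mult.commute)
  have len: "emeasure hausdorff1 (B \<inter> ?Q) \<le> ennreal l"
    if "B \<in> sets borel" "periodic B" "emeasure hausdorff1 (B \<inter> F) \<le> ennreal l" for B l
    using fundamental_domain_hausdorff1_eq[OF that(1,2) fundamental_domain_unit_square fundamental_domain_F] that(3) by simp
  have "aniso_perimeter \<phi> (proj ` Z) \<le>
    (\<integral>\<^sup>+ x. ennreal (\<phi> (?n (- z))) * indicator (B0 \<inter> ?Q) x + ennreal (\<phi> (?n c)) * indicator (B1 \<inter> ?Q) x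
      + ennreal (\<phi> (?n (z - c))) * indicator (B2 \<inter> ?Q) x \<partial>hausdorff1)"
    unfolding aniso_perimeter_def vimage_proj_image[OF periodic_Z]
  proof (rule nn_integral_mono_AE)
    have "AE x in hausdorff1. x \<notin> V"
      by (rule AE_not_in[OF countable_null_hausdorff1[OF countable_V]])
    then show "AE x in hausdorff1. ennreal (\<phi> (outer_normal Z x)) * indicator (reduced_boundary Z \<inter> ?Q) x
        \<le> ennreal (\<phi> (?n (- z))) * indicator (B0 \<inter> ?Q) x + ennreal (\<phi> (?n c)) * indicator (B1 \<inter> ?Q) x
          + ennreal (\<phi> (?n (z - c))) * indicator (B2 \<inter> ?Q) x"
    proof eventually_elim
      case (elim x)
      show ?case
      proof (cases "x \<in> reduced_boundary Z \<inter> ?Q")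
        case True
        then have "x \<in> B0 \<and> outer_normal Z x = ?n (- z) \<or> x \<in> B1 \<and> outer_normal Z x = ?n c
            \<or> x \<in> B2 \<and> outer_normal Z x = ?n (z - c)"
          using reduced_boundary_Z[of x] elim by auto
        then show ?thesis using True by (elim disjE) (simp_all add: add_increasing add_increasing2)
      qed simp
    qed
  qed
  also have "\<dots> = ennreal (\<phi> (?n (- z))) * emeasure hausdorff1 (B0 \<inter> ?Q)
      + ennreal (\<phi> (?n c)) * emeasure hausdorff1 (B1 \<inter> ?Q)
      + ennreal (\<phi> (?n (z - c))) * emeasure hausdorff1 (B2 \<inter> ?Q)"
    by (simp add: nn_integral_add nn_integral_cmult_indicator)
  also have "\<dots> \<le> ennreal (\<phi> (?n (- z))) * ennreal (norm (- z)) + ennreal (\<phi> (?n c)) * ennreal (norm c)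
      + ennreal (\<phi> (?n (z - c))) * ennreal (norm (z - c))"
    using len[OF borel_edges(1) periodic_edges(1) length_B0] len[OF borel_edges(2) periodic_edges(2) length_B1]
      len[OF borel_edges(3) periodic_edges(3) length_B2]
    by (intro add_mono mult_left_mono) simp_all
  also have "\<dots> = ennreal (\<phi> (- z)) + ennreal (\<phi> c) + ennreal (\<phi> (z - c))"
    using c_nonzero z_nonzero zc_nonzero by (simp only: scale neg_equal_0_iff_equal not_False_eq_True)
  finally show ?thesis .
qed

lemma length_line_ge:
  assumes "0 \<le> m" "m < 1"
  shows "ennreal (norm z) \<le> emeasure hausdorff1 ({x. frac (x \<bullet> z) = m} \<inter> unit_square)"
proof -
  let ?B = "{x. frac (x \<bullet> z) = m}"
  have B: "?B \<in> sets borel" unfolding frac_def by measurable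
  have per: "periodic ?B" by (simp add: periodic_def frac_lattice)
  have "ennreal (norm z) \<le> hausdorff1_outer (?B \<inter> F)"
  proof (rule hausdorff1_segment_ge[where u = "rot90 z /\<^sub>R norm z" and p = "pt m 0"])
    show "norm (rot90 z /\<^sub>R norm z) = 1" using z_nonzero by simp
    fix t assume t: "0 < t" "t < norm z"
    let ?x = "pt m 0 + t *\<^sub>R (rot90 z /\<^sub>R norm z)"
    have "?x \<bullet> z = m" by (simp add: inner_add_left pt_inner)
    moreover have "c \<bullet> ?x = t / norm z * D"
      by (simp add: inner_add_right pt_inner D_def divide_inverse)
    moreover have "t / norm z * D < 1 * D"
      using t D by (intro mult_strict_right_mono) (auto simp: divide_less_eq)
    moreover have "frac m = m" using assms by (simp add: frac_eq)
    ultimately show "?x \<in> ?B \<inter> F" using t D assms by (simp add: F_def)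
  qed
  also have "\<dots> = emeasure hausdorff1 (?B \<inter> F)" using B by (simp add: emeasure_hausdorff1)
  also have "\<dots> = emeasure hausdorff1 (?B \<inter> unit_square)"
    by (rule fundamental_domain_hausdorff1_eq[OF B per fundamental_domain_F fundamental_domain_unit_square])
  finally show ?thesis .
qed

lemma S_near_boundary:
  shows "frac (x \<bullet> z) = 0 \<Longrightarrow> \<forall>\<^sub>F y in nhds x. y \<in> S \<longleftrightarrow> y \<bullet> - z \<le> x \<bullet> - z"
    and "frac (x \<bullet> z) = M \<Longrightarrow> \<forall>\<^sub>F y in nhds x. y \<in> S \<longleftrightarrow> y \<bullet> z \<le> x \<bullet> z"
proof -
  show "\<forall>\<^sub>F y in nhds x. y \<in> S \<longleftrightarrow> y \<bullet> - z \<le> x \<bullet> - z" if "frac (x \<bullet> z) = 0"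
    by (rule near_integer[where lo = M and hi = M, OF _ _ _ _ _ _ that]) (use M in \<open>simp_all add: S_def\<close>)
  show "\<forall>\<^sub>F y in nhds x. y \<in> S \<longleftrightarrow> y \<bullet> z \<le> x \<bullet> z" if "frac (x \<bullet> z) = M"
  proof -
    have "\<forall>\<^sub>F y in nhds x. x \<bullet> z = of_int \<lfloor>x \<bullet> z\<rfloor> + M" using that by (simp add: frac_def)
    moreover have "\<forall>\<^sub>F y in nhds x. \<lfloor>y \<bullet> z\<rfloor> = \<lfloor>x \<bullet> z\<rfloor>" using that M by (intro eventually_floor) simp
    ultimately show ?thesis
      by eventually_elim (simp only: S_def frac_def mem_Collect_eq, linarith)
  qed
qed

text \<open>A lower bound needs the boundary lines to lie in the reduced boundary. The explicit
  Gauss--Green pair gives this: its measure charges every ball centred on the lines, and S is a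
  half-plane near them.\<close>

lemma aniso_perimeter_S_ge:
  assumes nonneg: "\<And>y. 0 \<le> \<phi> y" and hom: "\<And>r y. 0 \<le> r \<Longrightarrow> \<phi> (r *\<^sub>R y) = r * \<phi> y"
  shows "ennreal (\<phi> (- z)) + ennreal (\<phi> z) \<le> aniso_perimeter \<phi> (proj ` S)"
proof -
  let ?n = "\<lambda>v :: real^2. v /\<^sub>R norm v"
  let ?Q = unit_square
  let ?BM = "{x. frac (x \<bullet> z) = M}"
  note [measurable] = fundamental_domain_borel[OF fundamental_domain_unit_square]
  have BM [measurable]: "?BM \<in> sets borel" unfolding frac_def by measurable
  have scale: "ennreal (\<phi> (?n v)) * ennreal (norm v) = ennreal (\<phi> v)" if "v \<noteq> 0" for v
    using hom[of "norm v" "?n v"] nonneg that by (simp add: ennreal_mult[symmetric] mult.commute)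
  obtain \<mu> \<sigma> where gg: "is_gauss_green S \<mu> \<sigma>"
    and pos: "\<And>x r. frac (x \<bullet> z) = 0 \<or> frac (x \<bullet> z) = M \<Longrightarrow> 0 < r \<Longrightarrow> 0 < emeasure \<mu> (ball x r)"
    using gauss_green_strips[OF z_nonzero M] unfolding S_def by blast
  have bd: "x \<in> reduced_boundary S \<and> outer_normal S x = ?n v"
    if x: "frac (x \<bullet> z) = 0 \<or> frac (x \<bullet> z) = M" and v: "v \<noteq> 0"
      and near: "\<forall>\<^sub>F y in nhds x. y \<in> S \<longleftrightarrow> y \<bullet> v \<le> x \<bullet> v" for x v
  proof -
    obtain r where r: "0 < r" "norm (?n v) = 1" "\<And>y. y \<in> ball x r \<Longrightarrow> y \<in> S \<longleftrightarrow> y \<bullet> ?n v \<le> x \<bullet> ?n v"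
      using halfplane_ball[OF v near] by metis
    have "outer_normal_at S x (?n v)"
      by (rule outer_normal_at_halfplane[OF gg pos[OF x] borel_S r])
    then have "x \<in> reduced_boundary S" by (auto simp: reduced_boundary_def)
    then show ?thesis using outer_normal_locally_halfplane[OF borel_S v near] by simp
  qed
  have "ennreal (\<phi> (- z)) + ennreal (\<phi> z)
      = ennreal (\<phi> (?n (- z))) * ennreal (norm (- z)) + ennreal (\<phi> (?n z)) * ennreal (norm z)"
    using z_nonzero by (simp only: scale neg_equal_0_iff_equal not_False_eq_True)
  also have "\<dots> \<le> ennreal (\<phi> (?n (- z))) * emeasure hausdorff1 (B0 \<inter> ?Q)
      + ennreal (\<phi> (?n z)) * emeasure hausdorff1 (?BM \<inter> ?Q)"
    using length_line_ge[of 0] length_line_ge[of M] M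
    by (intro add_mono mult_left_mono) (simp_all add: B0_def del: frac_eq_0_iff)
  also have "\<dots> = (\<integral>\<^sup>+ x. ennreal (\<phi> (?n (- z))) * indicator (B0 \<inter> ?Q) x
      + ennreal (\<phi> (?n z)) * indicator (?BM \<inter> ?Q) x \<partial>hausdorff1)"
    by (simp add: nn_integral_add nn_integral_cmult_indicator)
  also have "\<dots> \<le> aniso_perimeter \<phi> (proj ` S)"
    unfolding aniso_perimeter_def vimage_proj_image[OF periodic_S]
  proof (rule nn_integral_mono)
    fix x
    consider "x \<in> B0 \<inter> ?Q" "x \<notin> ?BM" | "x \<in> ?BM \<inter> ?Q" "x \<notin> B0" | "x \<notin> B0 \<inter> ?Q" "x \<notin> ?BM \<inter> ?Q"
      using M by (auto simp: B0_def simp del: frac_eq_0_iff)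
    then show "ennreal (\<phi> (?n (- z))) * indicator (B0 \<inter> ?Q) x + ennreal (\<phi> (?n z)) * indicator (?BM \<inter> ?Q) x
        \<le> ennreal (\<phi> (outer_normal S x)) * indicator (reduced_boundary S \<inter> ?Q) x"
    proof cases
      case 1
      then have "frac (x \<bullet> z) = 0" by (simp add: B0_def del: frac_eq_0_iff)
      from bd[OF disjI1[OF this] _ S_near_boundary(1)[OF this]] show ?thesis using 1 z_nonzero by simp
    next
      case 2
      then have "frac (x \<bullet> z) = M" by simp
      from bd[OF disjI2[OF this] _ S_near_boundary(2)[OF this]] show ?thesis using 2 z_nonzero by simp
    qed simp
  qed
  finally show ?thesis .
qed

end

lemma (in zigzag) lamella_eq: "lamella z M = proj ` S"
proof
  have zz': "(norm z)\<^sup>2 = z \<bullet> z" by (rule power2_norm_eq_inner)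
  show "lamella z M \<subseteq> proj ` S"
  proof -
    have "t *\<^sub>R rot90 z + s *\<^sub>R z \<in> S" if s: "0 \<le> s" "s \<le> M / (norm z)\<^sup>2" for t s
    proof -
      have "s * (z \<bullet> z) \<le> M" "0 \<le> s * (z \<bullet> z)" using s zz by (simp_all add: zz' pos_le_divide_eq)
      moreover have "(t *\<^sub>R rot90 z + s *\<^sub>R z) \<bullet> z = s * (z \<bullet> z)" by (simp add: inner_add_left)
      moreover from calculation have "frac (s * (z \<bullet> z)) = s * (z \<bullet> z)" using M by (simp add: frac_eq)
      ultimately show ?thesis by (simp add: S_def)
    qed
    then show ?thesis unfolding lamella_def by blast
  qed
  show "proj ` S \<subseteq> lamella z M"
  proof
    fix p assume "p \<in> proj ` S"
    then obtain x where x: "frac (x \<bullet> z) \<le> M" "p = proj x" by (auto simp: S_def)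
    \<comment> \<open>Subtracting a lattice multiple of w lowers \<open>x \<bullet> z\<close> to its
      fractional part and so moves x into the single strip used by \<open>lamella\<close>.\<close>
    define y where "y = x - of_int \<lfloor>x \<bullet> z\<rfloor> *\<^sub>R w"
    have yz: "y \<bullet> z = frac (x \<bullet> z)" by (simp add: y_def inner_diff_left w frac_def)
    have "p = proj y" using w by (simp add: x(2) proj_eq_iff y_def lattice_scaleR)
    moreover have "y = (y \<bullet> rot90 z / (z \<bullet> z)) *\<^sub>R rot90 z + (y \<bullet> z / (z \<bullet> z)) *\<^sub>R z"
    proof -
      have "(z \<bullet> z) *\<^sub>R y = (y \<bullet> rot90 z) *\<^sub>R rot90 z + (y \<bullet> z) *\<^sub>R z"
        unfolding real2_eq_iff by (simp add: inner_real2 algebra_simps)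
      then have "(1 / (z \<bullet> z)) *\<^sub>R ((z \<bullet> z) *\<^sub>R y) = (1 / (z \<bullet> z)) *\<^sub>R ((y \<bullet> rot90 z) *\<^sub>R rot90 z + (y \<bullet> z) *\<^sub>R z)"
        by simp
      then show ?thesis using zz by (simp add: scaleR_add_right)
    qed
    moreover have "0 \<le> y \<bullet> z / (z \<bullet> z)" "y \<bullet> z / (z \<bullet> z) \<le> M / (norm z)\<^sup>2"
      using x(1) zz by (simp_all add: yz zz' divide_right_mono)
    ultimately show "p \<in> lamella z M" unfolding lamella_def by blast
  qed
qed

section \<open>Distinguishing zigzags modulo translations and null sets\<close>

lemma sym_diff_translation:
  fixes A B :: "'a::euclidean_space set"
  assumes "negligible (sym_diff ((+) v ` A) B)"
  shows "negligible (sym_diff ((+) (- v) ` B) A)"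
proof -
  have "(+) (- v) ` (sym_diff ((+) v ` A) B) = sym_diff ((+) (- v) ` B) A"
    by (simp add: image_Un image_set_diff image_image Un_commute)
  then show ?thesis using negligible_translation[OF assms, of "- v"] by simp
qed

text \<open>The translate of A is empty on a strip of width 1 - L1, which exceeds 1 - L2. The part
  of B in this strip is not negligible and lies in the symmetric difference.\<close>

lemma strips_distinguish:
  assumes neg: "negligible (sym_diff ((+) v ` A) B)"
    and gap: "\<And>x. x \<in> A \<Longrightarrow> frac (x \<bullet> z) \<le> L1" and L: "0 \<le> L1" "L1 < L2" "L2 \<le> 1"
    and dense: "\<And>\<alpha> \<beta>. \<alpha> < \<beta> \<Longrightarrow> 1 - L2 < \<beta> - \<alpha> \<Longrightarrow> \<not> negligible (B \<inter> {x. \<alpha> < x \<bullet> z \<and> x \<bullet> z < \<beta>})"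
  shows False
proof -
  let ?St = "{x. L1 + v \<bullet> z < x \<bullet> z \<and> x \<bullet> z < 1 + v \<bullet> z}"
  have "B \<inter> ?St \<subseteq> sym_diff ((+) v ` A) B"
  proof
    fix x assume x: "x \<in> B \<inter> ?St"
    have "x \<notin> (+) v ` A"
    proof
      assume "x \<in> (+) v ` A"
      then have "x - v \<in> A" by auto
      moreover have "L1 < (x - v) \<bullet> z" "(x - v) \<bullet> z < 1" using x by (auto simp: inner_diff_left)
      moreover from this have "frac ((x - v) \<bullet> z) = (x - v) \<bullet> z" using L by (simp add: frac_eq)
      ultimately show False using gap[of "x - v"] by simp
    qed
    with x show "x \<in> sym_diff ((+) v ` A) B" by blast
  qed
  then have "negligible (B \<inter> ?St)" by (rule negligible_subset[OF neg])
  moreover have "\<not> negligible (B \<inter> ?St)" using L by (intro dense) auto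
  ultimately show False by blast
qed

text \<open>More teeth mean a smaller tooth size, hence a lower \<open>level\<close> and wider
  gaps.\<close>

lemma zigzag_not_equiv:
  assumes "zigzag z w c k M" "zigzag z w c k' M" "k < k'"
  shows "\<not> equiv_up_to_translation (proj ` zigzag.Z z c k M) (proj ` zigzag.Z z c k' M)"
    and "\<not> equiv_up_to_translation (proj ` zigzag.Z z c k' M) (proj ` zigzag.Z z c k M)"
proof -
  interpret A: zigzag z w c k M by fact
  interpret B: zigzag z w c k' M by fact
  have "B.\<delta> < A.\<delta>"
    unfolding A.\<delta>_def B.\<delta>_def using assms(3) A.D A.zz A.k
    by (intro divide_strict_left_mono mult_strict_right_mono mult_pos_pos) auto
  then have L: "0 \<le> B.level" "B.level < A.level" "A.level \<le> 1"
    using B.level B.\<delta>(1) A.level by (auto simp: A.level_def B.level_def)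
  have no: "\<not> negligible (sym_diff ((+) v ` B.Z) A.Z)" for v
    using strips_distinguish[OF _ B.Z_gap L A.Z_strip_not_negligible] by blast
  then have no': "\<not> negligible (sym_diff ((+) v ` A.Z) B.Z)" for v
    using sym_diff_translation by blast
  show "\<not> equiv_up_to_translation (proj ` A.Z) (proj ` B.Z)"
    using equiv_up_to_translation_lift[OF A.periodic_Z B.periodic_Z] no' by blast
  show "\<not> equiv_up_to_translation (proj ` B.Z) (proj ` A.Z)"
    using equiv_up_to_translation_lift[OF B.periodic_Z A.periodic_Z] no by blast
qed

lemma equiv_up_to_translation_refl:
  assumes "periodic A"
  shows "equiv_up_to_translation (proj ` A) (proj ` A)"
proof -
  have "proj -` sym_diff X Y = sym_diff (proj -` X) (proj -` Y)" for X Y by auto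
  then have "proj -` sym_diff (torus_translate 0 (proj ` A)) (proj ` A) = {}"
    by (simp add: vimage_proj_torus_translate)
  then show ?thesis unfolding equiv_up_to_translation_def by (intro exI[of _ 0]) simp
qed

lemma infinitely_many_zigzag_minimizers:
  fixes \<phi> :: "real^2 \<Rightarrow> real"
  assumes lat: "z \<in> lattice" "w \<in> lattice" "w \<bullet> z = 1" and M: "0 < M" "M < 1"
    and nonneg: "\<And>y. 0 \<le> \<phi> y" and hom: "\<And>r y. 0 \<le> r \<Longrightarrow> \<phi> (r *\<^sub>R y) = r * \<phi> y"
    and c: "0 < c \<bullet> rot90 z" and split: "\<phi> c + \<phi> (z - c) \<le> \<phi> z"
    and minim: "is_minimizer \<phi> M (lamella z M)"
  shows "\<exists>\<F> :: torus set set. infinite \<F> \<and> (\<forall>E\<in>\<F>. is_minimizer \<phi> M E) \<and>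
           (\<forall>E\<in>\<F>. \<forall>F\<in>\<F>. E \<noteq> F \<longrightarrow> \<not> equiv_up_to_translation E F)"
proof -
  have zz: "0 < z \<bullet> z" using lat(3) by auto
  define b where "b = 2 * min M (1 - M)"
  have b: "0 < b" using M by (simp add: b_def)
  \<comment> \<open>From this index on the teeth satisfy the locale assumption
    \<open>small\<close>.\<close>
  obtain k0 :: nat where k0: "c \<bullet> rot90 z / (z \<bullet> z) / b < real k0" using reals_Archimedean2 by blast
  have zig: "zigzag z w c k M" if "k0 \<le> k" for k
  proof
    have "0 < c \<bullet> rot90 z / (z \<bullet> z) / b" using c zz b by simp
    moreover have "real k0 \<le> real k" using that by simp
    ultimately have k: "0 < real k" "c \<bullet> rot90 z / (z \<bullet> z) / b < real k" using k0 by linarith+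
    then show "0 < k" by simp
    have "c \<bullet> rot90 z < real k * b * (z \<bullet> z)" using k(2) zz b by (simp add: divide_less_eq mult_ac)
    then show "c \<bullet> rot90 z / (real k * (z \<bullet> z)) < 2 * min M (1 - M)"
      unfolding b_def[symmetric] using k(1) zz by (simp add: divide_less_eq mult_ac)
  qed (use lat c M in auto)
  define E where "E k = proj ` zigzag.Z z c k M" for k
  have noneq: "\<not> equiv_up_to_translation (E k) (E k')" if "k0 \<le> k" "k0 \<le> k'" "k \<noteq> k'" for k k'
    using zigzag_not_equiv[OF zig[OF that(1)] zig[OF that(2)]] zigzag_not_equiv[OF zig[OF that(2)] zig[OF that(1)]] that(3)
    unfolding E_def by (cases "k < k'") auto
  have refl: "equiv_up_to_translation (E k) (E k)" if "k0 \<le> k" for k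
    unfolding E_def by (rule equiv_up_to_translation_refl[OF zigzag.periodic_Z[OF zig[OF that]]])
  have "is_minimizer \<phi> M (E k)" if "k0 \<le> k" for k
  proof -
    interpret zigzag z w c k M by (rule zig[OF that])
    have S: "admissible M (proj ` S)" "\<And>F. admissible M F \<Longrightarrow> aniso_perimeter \<phi> (proj ` S) \<le> aniso_perimeter \<phi> F"
      using minim unfolding lamella_eq is_minimizer_def by auto
    have "admissible M (E k)"
      using S(1) borel_Z finite_perimeter_Z
      by (simp add: admissible_def torus_measurable_def finite_perimeter_def E_def
          vimage_proj_image[OF periodic_Z] torus_area_Z)
    moreover have "aniso_perimeter \<phi> (E k) \<le> aniso_perimeter \<phi> (proj ` S)"
    proof -
      have "aniso_perimeter \<phi> (E k) \<le> ennreal (\<phi> (- z)) + ennreal (\<phi> c) + ennreal (\<phi> (z - c))"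
        unfolding E_def by (rule aniso_perimeter_Z_le[OF nonneg hom])
      also have "\<dots> = ennreal (\<phi> (- z) + (\<phi> c + \<phi> (z - c)))"
        using nonneg by (simp add: ennreal_plus add.assoc)
      also have "\<dots> \<le> ennreal (\<phi> (- z) + \<phi> z)"
        using split by (intro ennreal_leI) simp
      also have "\<dots> = ennreal (\<phi> (- z)) + ennreal (\<phi> z)"
        using nonneg by (simp add: ennreal_plus)
      also have "\<dots> \<le> aniso_perimeter \<phi> (proj ` S)"
        by (rule aniso_perimeter_S_ge[OF nonneg hom])
      finally show ?thesis .
    qed
    ultimately show ?thesis
      using S(2) by (auto simp: is_minimizer_def intro: order_trans)
  qed
  moreover have "infinite (E ` {k0..})"
  proof -
    \<comment> \<open>Equal sets would be equivalent by \<open>refl\<close>, against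
      \<open>noneq\<close>.\<close>
    have "inj_on E {k0..}"
    proof (rule inj_onI)
      fix k k' assume k: "k \<in> {k0..}" "k' \<in> {k0..}" "E k = E k'"
      then have "equiv_up_to_translation (E k) (E k')" using refl[of k] by simp
      then show "k = k'" using noneq[of k k'] k(1,2) by auto
    qed
    then show ?thesis by (simp add: finite_image_iff infinite_Ici)
  qed
  ultimately show ?thesis
    using noneq by (intro exI[of _ "E ` {k0..}"]) auto
qed

subsection \<open>Support functions\<close>

lemma support_fun_upper:
  assumes "compact K" "x \<in> K"
  shows "x \<bullet> y \<le> support_fun K y"
proof -
  have "compact ((\<lambda>x. x \<bullet> y) ` K)"
    by (intro compact_continuous_image continuous_intros assms)
  then have "bdd_above ((\<lambda>x. x \<bullet> y) ` K)"
    by (intro bounded_imp_bdd_above compact_imp_bounded)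
  then show ?thesis unfolding support_fun_def by (rule cSUP_upper[OF assms(2)])
qed

lemma support_fun_least:
  assumes "K \<noteq> {}" "\<And>x. x \<in> K \<Longrightarrow> x \<bullet> y \<le> b"
  shows "support_fun K y \<le> b"
  unfolding support_fun_def using assms by (rule cSUP_least)

lemma support_fun_scaleR:
  assumes "compact K" "K \<noteq> {}" "0 \<le> r"
  shows "support_fun K (r *\<^sub>R y) = r * support_fun K y"
proof (rule antisym)
  show "support_fun K (r *\<^sub>R y) \<le> r * support_fun K y"
    using assms support_fun_upper[OF assms(1)] by (intro support_fun_least) (auto intro: mult_left_mono)
  show "r * support_fun K y \<le> support_fun K (r *\<^sub>R y)"
  proof (cases "r = 0")
    case True
    obtain x where "x \<in> K" using assms(2) by blast
    then show ?thesis using support_fun_upper[OF assms(1), of x 0] True by simp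
  next
    case False
    then have "0 < r" using assms(3) by simp
    have "support_fun K y \<le> support_fun K (r *\<^sub>R y) / r"
    proof (rule support_fun_least[OF assms(2)])
      fix x assume "x \<in> K"
      then have "r * (x \<bullet> y) \<le> support_fun K (r *\<^sub>R y)"
        using support_fun_upper[OF assms(1), of x "r *\<^sub>R y"] by simp
      then show "x \<bullet> y \<le> support_fun K (r *\<^sub>R y) / r" using \<open>0 < r\<close> by (simp add: field_simps)
    qed
    then show ?thesis using \<open>0 < r\<close> by (simp add: field_simps)
  qed
qed

lemma support_fun_pos:
  assumes "compact K" "0 \<in> interior K" "y \<noteq> 0"
  shows "0 < support_fun K y"
proof -
  obtain e where e: "0 < e" "cball 0 e \<subseteq> K"
    using assms(2) by (meson mem_interior_cball)
  have "(e / norm y) *\<^sub>R y \<in> K" using e assms(3) by (intro subsetD[OF e(2)]) simp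
  then have "(e / norm y) *\<^sub>R y \<bullet> y \<le> support_fun K y" by (rule support_fun_upper[OF assms(1)])
  moreover have "0 < (e / norm y) *\<^sub>R y \<bullet> y" using e assms(3) by simp
  ultimately show ?thesis by linarith
qed

text \<open>A width direction is primitive: dividing it by the gcd of its coordinates would decrease the
  width.\<close>

lemma width_direction_dual_lattice_vector:
  assumes K: "convex_body K" and z: "z \<in> width_directions K"
  shows "\<exists>w\<in>lattice. w \<bullet> z = 1"
proof -
  have cK: "compact K" and iK: "0 \<in> interior K" and neK: "K \<noteq> {}"
    using K by (auto simp: convex_body_def)
  have zl: "z \<in> lattice" "z \<noteq> 0" and zw: "support_fun K z + support_fun K (- z) = lattice_width K"
    using z by (auto simp: width_directions_def)
  obtain p where p: "z $ 1 = of_int p" using zl(1) unfolding lattice_def mem_Collect_eq by (meson Ints_cases)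
  obtain q where q: "z $ 2 = of_int q" using zl(1) unfolding lattice_def mem_Collect_eq by (meson Ints_cases)
  define g where "g = gcd p q"
  have "p \<noteq> 0 \<or> q \<noteq> 0" using zl(2) p q by (auto simp: real2_eq_iff)
  then have g: "0 < g" by (auto simp: g_def gcd_pos_int)
  have "g dvd p" "g dvd q" by (simp_all add: g_def)
  then obtain p' q' where pq: "p = g * p'" "q = g * q'"
    unfolding dvd_def by (elim exE)
  define z' :: "real^2" where "z' = vector [of_int p', of_int q']"
  have z': "z = of_int g *\<^sub>R z'" by (simp add: real2_eq_iff z'_def p q pq)
  have z'l: "z' \<in> lattice - {0}"
    using zl(2) z' by (auto simp: lattice_def forall_2 z'_def)
  have pos: "0 < support_fun K y" if "y \<noteq> 0" for y
    using support_fun_pos[OF cK iK that] .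
  have "lattice_width K \<le> support_fun K z' + support_fun K (- z')"
    unfolding lattice_width_def
  proof (rule cINF_lower[OF _ z'l])
    show "bdd_below ((\<lambda>z. support_fun K z + support_fun K (- z)) ` (lattice - {0}))"
    proof (rule bdd_belowI2)
      fix y :: "real^2" assume "y \<in> lattice - {0}"
      then show "0 \<le> support_fun K y + support_fun K (- y)"
        using pos[of y] pos[of "- y"] by simp
    qed
  qed
  moreover have "support_fun K z + support_fun K (- z) = of_int g * (support_fun K z' + support_fun K (- z'))"
    using support_fun_scaleR[OF cK neK, of "of_int g" z'] support_fun_scaleR[OF cK neK, of "of_int g" "- z'"] g
    by (simp add: z' distrib_left)
  ultimately have "of_int g * (support_fun K z' + support_fun K (- z')) \<le> 1 * (support_fun K z' + support_fun K (- z'))"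
    using zw by simp
  moreover have "0 < support_fun K z' + support_fun K (- z')"
    using pos[of z'] pos[of "- z'"] z'l by auto
  ultimately have "real_of_int g \<le> 1" by (rule mult_right_le_imp_le)
  then have "g = 1" using g by linarith
  then obtain u v where "u * p + v * q = 1" using bezout_int[of p q] by (auto simp: g_def)
  then have "real_of_int u * of_int p + of_int v * of_int q = 1" by (metis of_int_1 of_int_add of_int_mult)
  then have "vector [of_int u, of_int v] \<bullet> z = 1" by (simp add: inner_real2 p q)
  moreover have "(vector [of_int u, of_int v] :: real^2) \<in> lattice" by (simp add: lattice_def forall_2)
  ultimately show ?thesis by blast
qed

section \<open>The interior of a cone spanned by two vectors\<close>

lemma independent_pair_coeffs:
  assumes "independent {u, v}" "u \<noteq> v" "s *\<^sub>R u + t *\<^sub>R v = 0"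
  shows "s = 0" "t = 0"
proof -
  have *: "s = 0" if "independent {u, v}" "u \<noteq> v" "s *\<^sub>R u + t *\<^sub>R v = 0" for s t and u v :: 'a
  proof (rule ccontr)
    assume "s \<noteq> 0"
    have "u = (- t / s) *\<^sub>R v"
    proof -
      have "s *\<^sub>R u = - (t *\<^sub>R v)" using that(3) by (simp add: eq_neg_iff_add_eq_0)
      then have "(1 / s) *\<^sub>R (s *\<^sub>R u) = (1 / s) *\<^sub>R (- (t *\<^sub>R v))" by simp
      then show ?thesis using \<open>s \<noteq> 0\<close> by simp
    qed
    then have "u \<in> span {v}" by (metis span_base span_scale singletonI)
    with that(1,2) show False by (simp add: independent_insert)
  qed
  show "s = 0" using *[OF assms] .
  show "t = 0" using *[of v u t s] assms by (simp add: insert_commute add.commute)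
qed

text \<open>For an interior point z both z - \<epsilon> u and z - \<epsilon> v still belong to the
  cone. Comparing coefficients, those of z are at least \<epsilon>.\<close>

lemma interior_convex_cone_pair:
  fixes u v z :: "'a::euclidean_space"
  assumes ind: "independent {u, v}" "u \<noteq> v" and z: "z \<in> interior (convex_cone hull {u, v})"
  obtains s t where "0 < s" "0 < t" "z = s *\<^sub>R u + t *\<^sub>R v"
proof -
  let ?C = "{s *\<^sub>R u + t *\<^sub>R v | s t. 0 \<le> s \<and> 0 \<le> t}"
  have sub: "convex_cone hull {u, v} \<subseteq> ?C"
  proof (rule hull_minimal)
    have "u = 1 *\<^sub>R u + 0 *\<^sub>R v" "v = 0 *\<^sub>R u + 1 *\<^sub>R v" by simp_all
    then show "{u, v} \<subseteq> ?C" by (metis (mono_tags, lifting) empty_subsetI insert_subset mem_Collect_eq order_refl zero_le_one)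
    show "convex_cone ?C"
      unfolding convex_cone_iff
    proof (intro conjI ballI allI impI)
      show "0 \<in> ?C" by (rule CollectI, intro exI[of _ 0]) simp
      fix x y assume "x \<in> ?C" "y \<in> ?C"
      then obtain s t s' t' where "x = s *\<^sub>R u + t *\<^sub>R v" "y = s' *\<^sub>R u + t' *\<^sub>R v" "0 \<le> s" "0 \<le> t" "0 \<le> s'" "0 \<le> t'"
        by blast
      then have "x + y = (s + s') *\<^sub>R u + (t + t') *\<^sub>R v" "0 \<le> s + s'" "0 \<le> t + t'"
        by (simp_all add: algebra_simps)
      then show "x + y \<in> ?C" by blast
    next
      fix x and r :: real assume "x \<in> ?C" "0 \<le> r"
      then obtain s t where "x = s *\<^sub>R u + t *\<^sub>R v" "0 \<le> s" "0 \<le> t" by blast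
      then have "r *\<^sub>R x = (r * s) *\<^sub>R u + (r * t) *\<^sub>R v" "0 \<le> r * s" "0 \<le> r * t"
        using \<open>0 \<le> r\<close> by (simp_all add: algebra_simps)
      then show "r *\<^sub>R x \<in> ?C" by blast
    qed
  qed
  obtain e where e: "0 < e" "cball z e \<subseteq> convex_cone hull {u, v}"
    using z by (meson mem_interior_cball)
  have near: "\<exists>s t. 0 \<le> s \<and> 0 \<le> t \<and> x = s *\<^sub>R u + t *\<^sub>R v" if "norm (z - x) \<le> e" for x
    using that e(2) sub by (force simp: dist_norm)
  define \<epsilon> where "\<epsilon> = e / (norm u + norm v + 1)"
  have \<epsilon>: "0 < \<epsilon>" "\<epsilon> * norm u \<le> e" "\<epsilon> * norm v \<le> e"
  proof -
    have n: "0 < norm u + norm v + 1" by (simp add: add_nonneg_pos)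
    then show "0 < \<epsilon>" using e(1) by (simp add: \<epsilon>_def)
    have "\<epsilon> * (norm u + norm v + 1) = e" using n by (simp add: \<epsilon>_def)
    moreover have "\<epsilon> * norm u \<le> \<epsilon> * (norm u + norm v + 1)" "\<epsilon> * norm v \<le> \<epsilon> * (norm u + norm v + 1)"
      using \<open>0 < \<epsilon>\<close> by (simp_all add: mult_left_mono)
    ultimately show "\<epsilon> * norm u \<le> e" "\<epsilon> * norm v \<le> e" by simp_all
  qed
  obtain s t where st: "z = s *\<^sub>R u + t *\<^sub>R v" using near[of z] e(1) by auto
  have "0 < s"
  proof -
    obtain s' t' where *: "0 \<le> s'" "z - \<epsilon> *\<^sub>R u = s' *\<^sub>R u + t' *\<^sub>R v"
      using near[of "z - \<epsilon> *\<^sub>R u"] \<epsilon> by auto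
    then have "(s - \<epsilon> - s') *\<^sub>R u + (t - t') *\<^sub>R v = 0" by (simp add: st algebra_simps)
    from independent_pair_coeffs(1)[OF ind this] show ?thesis using * \<epsilon> by simp
  qed
  moreover have "0 < t"
  proof -
    obtain s' t' where *: "0 \<le> t'" "z - \<epsilon> *\<^sub>R v = s' *\<^sub>R u + t' *\<^sub>R v"
      using near[of "z - \<epsilon> *\<^sub>R v"] \<epsilon> by auto
    then have "(s - s') *\<^sub>R u + (t - \<epsilon> - t') *\<^sub>R v = 0" by (simp add: st algebra_simps)
    from independent_pair_coeffs(2)[OF ind this] show ?thesis using * \<epsilon> by simp
  qed
  ultimately show ?thesis using that st by blast
qed

theorem proposition4p4:
  fixes K :: "(real^2) set" and z\<^sub>0 \<nu>\<^sub>1 \<nu>\<^sub>2 P :: "real^2" and M :: real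
  assumes "convex_body K"
    and "z\<^sub>0 \<in> width_directions K"
    and "norm \<nu>\<^sub>1 = 1" and "norm \<nu>\<^sub>2 = 1"
    and "\<nu>\<^sub>1 \<noteq> \<nu>\<^sub>2" and "independent {\<nu>\<^sub>1, \<nu>\<^sub>2}"
    and "z\<^sub>0 \<in> interior (convex_cone hull {\<nu>\<^sub>1, \<nu>\<^sub>2})"
    and "supporting_line K \<nu>\<^sub>1 \<inter> supporting_line K \<nu>\<^sub>2 = {P}" and "P \<in> frontier K"
    and "0 < M" and "M < 1"
    and "is_minimizer (support_fun K) M (lamella z\<^sub>0 M)"
  shows "\<exists>\<F> :: torus set set. infinite \<F> \<and>
           (\<forall>E\<in>\<F>. is_minimizer (support_fun K) M E) \<and>
           (\<forall>E\<in>\<F>. \<forall>F\<in>\<F>. E \<noteq> F \<longrightarrow> \<not> equiv_up_to_translation E F)"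
proof -
  let ?\<phi> = "support_fun K"
  have cK: "compact K" and iK: "0 \<in> interior K"
    using assms(1) by (auto simp: convex_body_def)
  then have neK: "K \<noteq> {}" by auto
  have "0 \<in> K" using iK interior_subset by blast
  then have nonneg: "0 \<le> ?\<phi> y" for y
    using support_fun_upper[OF cK, of 0 y] by simp
  have hom: "?\<phi> (r *\<^sub>R y) = r * ?\<phi> y" if "0 \<le> r" for r y
    by (rule support_fun_scaleR[OF cK neK that])
  have zl: "z\<^sub>0 \<in> lattice" using assms(2) by (simp add: width_directions_def)
  obtain w where w: "w \<in> lattice" "w \<bullet> z\<^sub>0 = 1"
    using width_direction_dual_lattice_vector[OF assms(1,2)] by blast
  obtain s t where st: "0 < s" "0 < t" "z\<^sub>0 = s *\<^sub>R \<nu>\<^sub>1 + t *\<^sub>R \<nu>\<^sub>2"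
    using interior_convex_cone_pair[OF assms(6,5,7)] .
  have PK: "P \<in> K"
    using assms(9) cK by (auto simp: frontier_def compact_imp_closed)
  have "P \<in> supporting_line K \<nu>\<^sub>1" "P \<in> supporting_line K \<nu>\<^sub>2" using assms(8) by blast+
  then have "P \<bullet> \<nu>\<^sub>1 = ?\<phi> \<nu>\<^sub>1" "P \<bullet> \<nu>\<^sub>2 = ?\<phi> \<nu>\<^sub>2" by (simp_all add: supporting_line_def)
  \<comment> \<open>The common contact point P realizes both support values; since P belongs to K,
    testing the support function at \<open>z\<^sub>0\<close> with P gives the inequality that the
    zigzag needs.\<close>
  then have "?\<phi> (s *\<^sub>R \<nu>\<^sub>1) + ?\<phi> (t *\<^sub>R \<nu>\<^sub>2) = P \<bullet> z\<^sub>0"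
    using st by (simp add: hom inner_add_right)
  also have "\<dots> \<le> ?\<phi> z\<^sub>0" by (rule support_fun_upper[OF cK PK])
  finally have split: "?\<phi> (s *\<^sub>R \<nu>\<^sub>1) + ?\<phi> (t *\<^sub>R \<nu>\<^sub>2) \<le> ?\<phi> z\<^sub>0" .
  have "\<nu>\<^sub>1 \<bullet> rot90 \<nu>\<^sub>2 \<noteq> 0"
  proof
    assume "\<nu>\<^sub>1 \<bullet> rot90 \<nu>\<^sub>2 = 0"
    then have "1 *\<^sub>R \<nu>\<^sub>1 + (- (\<nu>\<^sub>1 \<bullet> \<nu>\<^sub>2)) *\<^sub>R \<nu>\<^sub>2 = 0"
      using real2_decomp[OF assms(4), of \<nu>\<^sub>1] by simp
    from independent_pair_coeffs(1)[OF assms(6,5) this] show False by simp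
  qed
  then consider "0 < \<nu>\<^sub>1 \<bullet> rot90 \<nu>\<^sub>2" | "\<nu>\<^sub>1 \<bullet> rot90 \<nu>\<^sub>2 < 0" by linarith
  then have "0 < s * t * (\<nu>\<^sub>1 \<bullet> rot90 \<nu>\<^sub>2) \<or> s * t * (\<nu>\<^sub>1 \<bullet> rot90 \<nu>\<^sub>2) < 0"
    using st(1,2) by cases (simp_all add: mult_pos_pos mult_pos_neg)
  moreover have "(s *\<^sub>R \<nu>\<^sub>1) \<bullet> rot90 z\<^sub>0 = s * t * (\<nu>\<^sub>1 \<bullet> rot90 \<nu>\<^sub>2)"
    "(t *\<^sub>R \<nu>\<^sub>2) \<bullet> rot90 z\<^sub>0 = - (s * t * (\<nu>\<^sub>1 \<bullet> rot90 \<nu>\<^sub>2))"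
    unfolding st(3) by (simp_all add: inner_real2 algebra_simps)
  \<comment> \<open>The zigzag requires \<open>0 < c \<bullet> rot90 z\<close>. The two candidates
    for c have inner products of opposite sign, so one of them can play this role.\<close>
  ultimately consider "0 < (s *\<^sub>R \<nu>\<^sub>1) \<bullet> rot90 z\<^sub>0" | "0 < (t *\<^sub>R \<nu>\<^sub>2) \<bullet> rot90 z\<^sub>0"
    by linarith
  then show ?thesis
  proof cases
    case 1
    have "z\<^sub>0 - s *\<^sub>R \<nu>\<^sub>1 = t *\<^sub>R \<nu>\<^sub>2" by (simp add: st(3))
    with split show ?thesis
      by (intro infinitely_many_zigzag_minimizers[OF zl w assms(10,11) nonneg hom 1 _ assms(12)]) simp_all
  next
    case 2
    have "z\<^sub>0 - t *\<^sub>R \<nu>\<^sub>2 = s *\<^sub>R \<nu>\<^sub>1" by (simp add: st(3))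
    with split show ?thesis
      by (intro infinitely_many_zigzag_minimizers[OF zl w assms(10,11) nonneg hom 2 _ assms(12)]) simp_all
  qed
qed

end
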